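(* Let $N\ge1$ be an integer with $\lambda_{N+1}>0$, let $j\ge1$ be an integer, and let $\mu_i,\varphi_i,C,B_i$ ($i=1,\dots,j$) be as in the context. Let $K_i=(K_{i,1},\dots,K_{i,N})^T\in\mathbb{R}^N$ ($i=1,\dots,j$), $\sigma>0$, and a symmetric positive definite matrix $R=\{R_{n,m}:n,m=1,\dots,N\}\in\mathbb{R}^{N\times N}$ satisfy $$R\Big(C+\sum_{i=1}^jB_iK_i^T\Big)+\Big(C+\sum_{i=1}^jB_iK_i^T\Big)^TR\le-2\sigma I .$$ Assume that $\omega_1,\dots,\omega_j,\gamma>0$ satisfy $$\sigma\mu_i\ge2j\,\omega_i|K_i|^2,\quad i=1,\dots,j,\qquad\text{and}\qquad \sigma\lambda_{N+1}\ge2j\gamma\sum_{i=1}^j\|\varphi_i\|^2|K_i|^2 .$$ Let $V(w,y)=\frac12\langle Gw,w\rangle+\frac{\gamma}{2}\|w-Pw\|^2+\frac12\sum_{i=1}^j\omega_iy_i^2$ for $(w,y)\in L_r^2(0,1)\times\mathbb{R}^j$. Then $V$ is a Control Lyapunov Functional for the system $$\frac{\partial w}{\partial t}(t,x)=-(Aw[t])(x)-\sum_{i=1}^j\varphi_i(x)v_i(t),\quad x\in(0,1),\qquad(\mathrm{i})$$ $$b_1w(t,0)+b_2\frac{\partial w}{\partial x}(t,0)=a_1w(t,1)+a_2\frac{\partial w}{\partial x}(t,1)=0,\qquad(\mathrm{ii})$$ $$\dot y_i(t)=-\mu_iy_i(t)+v_i(t),\quad i=1,\dots,j,\qquad(\mathrm{iii})$$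 in the sense that for every $L_1,\dots,L_j\ge0$ and every integer $M\ge N+1$ with $$4(\lambda_{M+1}-\lambda_{N+1})\ge\gamma\sum_{i=1}^jL_i\sum_{n=M+1}^\infty\langle\phi_n,\varphi_i\rangle^2,$$ the following inequality holds for all $(w,y)\in D\times\mathbb{R}^j$: $$\dot V\le-\frac12\sum_{i=1}^j\omega_i\mu_iy_i^2-\frac{\min(\gamma\lambda_{N+1},\sigma)}{2}\|w\|^2,$$ where $$\dot V=\Big\langle Gw,-Aw-\sum_{i=1}^jv_i\varphi_i\Big\rangle+\gamma\Big\langle w-Pw,-Aw+PAw-\sum_{i=1}^jv_i\varphi_i+\sum_{i=1}^jv_iP\varphi_i\Big\rangle+\sum_{i=1}^j\omega_iy_iv_i-\sum_{i=1}^j\mu_i\omega_iy_i^2$$ and $$v_i=\langle k_i,w\rangle-\omega_iL_iy_i,\quad i=1,\dots,j,\qquad(\mathrm{iv})$$ $$k_i:=\sum_{n=1}^N\Big(K_{i,n}+L_i\Big\langle\sum_{m=1}^NR_{n,m}\phi_m,\varphi_i\Big\rangle\Big)\phi_n+\gamma L_i\sum_{n=N+1}^M\langle\phi_n,\varphi_i\rangle\phi_n,\quad i=1,\dots,j.$$ Moreover, the feedback law (iv) is a globally exponentially stabilizing feedback law for (i), (ii), (iii), in the sense that there exist constants $\bar K,\bar\sigma>0$ such that for every $w_0\in D$, $y_0\in\mathbb{R}^j$, the initial-boundary value problem (i)-(iv) with initial condition $w[0]=w_0$, $y(0)=y_0$ admits a unique solution $w\in C^0([0,+\infty)\times[0,1])\cap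 C^1((0,+\infty)\times[0,1])$, $y\in C^1([0,+\infty);\mathbb{R}^j)$ with $w[t]\in D\cap C^2([0,1])$ for all $t>0$, which satisfies (i), (ii), (iii), (iv) for all $t>0$ and the estimate $$\|w[t]\|+|y(t)|\le\bar K\exp(-\bar\sigma t)\left(\|w_0\|+|y_0|\right),\quad\text{for all }t\ge0.$$
   Context: $L_r^2(0,1)$ is the Hilbert space of measurable functions on $[0,1]$ with inner product $\langle u,v\rangle=\int_0^1 r(x)u(x)v(x)\,dx$ and induced norm $\|\cdot\|$; $|\cdot|$ is the Euclidean norm; $w[t]$ denotes the profile $x\mapsto w(t,x)$; $y=(y_1,\dots,y_j)^T$. Let $p\in C^1([0,1];(0,+\infty))$, $r\in C^0([0,1];(0,+\infty))$, $q\in C^0([0,1];\mathbb{R})$, and $a_1,a_2,b_1,b_2\in\mathbb{R}$ with $a_1^2+a_2^2=1$, $b_1^2+b_2^2=1$. Let $D\subseteq H^2(0,1)$ be the set of all $f$ with $b_1f(0)+b_2f'(0)=a_1f(1)+a_2f'(1)=0$. The Sturm-Liouville operator $A:D\to L_r^2(0,1)$ is $$(Af)(x)=-\frac{1}{r(x)}\frac{d}{dx}\left(p(x)\frac{df}{dx}(x)\right)+\frac{q(x)}{r(x)}f(x).$$ Its eigenvalues are real and form a strictly increasing sequence $\lambda_1<\lambda_2<\cdots$ with $\lambda_n\to+\infty$; to each $\lambda_n$ corresponds exactly one (up to sign) normalized eigenfunction $\phi_n\in C^2([0,1])\cap D$, $A\phi_n=\lambda_n\phi_n$, $\|\phi_n\|=1$,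 and $\{\phi_n\}_{n\ge1}$ is an orthonormal basis of $L_r^2(0,1)$. Standing assumption: $\sum_{n=N'+1}^{\infty}\lambda_n^{-1}\max_{0\le x\le1}|\phi_n(x)|<+\infty$ for some $N'>0$ with $\lambda_{N'+1}>0$. The constants $\mu_1,\dots,\mu_j>0$ satisfy $\mu_i\ne\lambda_n$ for all $i$ and $n$, and $\varphi_i\in C^2([0,1])$ is the (unique) solution of $(p\varphi_i')'-q\varphi_i=-\mu_ir\varphi_i$ on $[0,1]$ with $b_1\varphi_i(0)+b_2\varphi_i'(0)=0$, $a_1\varphi_i(1)+a_2\varphi_i'(1)=1$. Moreover $C=-\mathrm{diag}(\lambda_1,\dots,\lambda_N)$ and $B_i=-(\langle\varphi_i,\phi_1\rangle,\dots,\langle\varphi_i,\phi_N\rangle)^T\in\mathbb{R}^N$. The operators $G,P:L_r^2(0,1)\to L_r^2(0,1)$ are $Gw=\sum_{n=1}^N\sum_{m=1}^NR_{n,m}\phi_m\langle\phi_n,w\rangle$ and $Pw=\sum_{n=1}^N\langle\phi_n,w\rangle\phi_n$. The expression $\dot V$ is the derivative of $V(w,y)$ along solutions of (i), (ii), (iii). *)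

theory Defs
  imports "HOL-Analysis.Analysis"
begin

text \<open>
  Functions on \<open>[0,1]\<close> are represented by functions of type \<^typ>\<open>real \<Rightarrow> real\<close>; nothing below
  depends on their values outside \<open>[0,1]\<close>. Families such as \<open>\<lambda>\<^sub>n\<close>, \<open>\<phi>\<^sub>n\<close>, \<open>\<mu>\<^sub>i\<close> and the entries of
  vectors and matrices are indexed from 1, and their values at other indices are irrelevant.
\<close>

section \<open>Function spaces on the unit interval\<close>

text \<open>The derivative on \<open>[0,1]\<close>: two-sided at interior points, one-sided at 0 and 1.\<close>

definition deriv01 :: "(real \<Rightarrow> real) \<Rightarrow> real \<Rightarrow> real" where
  "deriv01 f x = vector_derivative f (at x within {0..1})"

definition C1_01 :: "(real \<Rightarrow> real) set" where
  "C1_01 = {f. f differentiable_on {0..1} \<and> continuous_on {0..1} (deriv01 f)}"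

definition C2_01 :: "(real \<Rightarrow> real) set" where
  "C2_01 = {f. f \<in> C1_01 \<and> deriv01 f \<in> C1_01}"

definition L2 :: "(real \<Rightarrow> real) \<Rightarrow> (real \<Rightarrow> real) set" where
  "L2 r = {f. set_borel_measurable lebesgue {0..1} f \<and>
              set_integrable lebesgue {0..1} (\<lambda>x. r x * (f x)\<^sup>2)}"

definition ip :: "(real \<Rightarrow> real) \<Rightarrow> (real \<Rightarrow> real) \<Rightarrow> (real \<Rightarrow> real) \<Rightarrow> real" where
  "ip r u v = set_lebesgue_integral lebesgue {0..1} (\<lambda>x. r x * u x * v x)"

definition nrm :: "(real \<Rightarrow> real) \<Rightarrow> (real \<Rightarrow> real) \<Rightarrow> real" where
  "nrm r f = sqrt (ip r f f)"

text \<open>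
  The Sobolev space \<open>H\<^sup>2(0,1)\<close>, each class being represented by its \<open>C\<^sup>1\<close> representative (the one
  for which boundary values make sense): \<open>f'\<close> is absolutely continuous, i.e. differentiable almost
  everywhere and the integral of its almost-everywhere derivative, and \<open>f''\<close> is square integrable.
\<close>

definition H2_01 :: "(real \<Rightarrow> real) set" where
  "H2_01 = {f. f \<in> C1_01 \<and>
      (AE x in lebesgue. x \<in> {0..1} \<longrightarrow> deriv01 f differentiable (at x within {0..1})) \<and>
      deriv01 (deriv01 f) \<in> L2 (\<lambda>_. 1) \<and>
      (\<forall>x\<in>{0..1}. deriv01 f x
          = deriv01 f 0 + set_lebesgue_integral lebesgue {0..x} (deriv01 (deriv01 f)))}"

section \<open>The Sturm--Liouville operator and its eigensystem\<close>

definition SL_dom :: "real \<Rightarrow> real \<Rightarrow> real \<Rightarrow> real \<Rightarrow> (real \<Rightarrow> real) set" where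
  "SL_dom a1 a2 b1 b2 = {f \<in> H2_01. b1 * f 0 + b2 * deriv01 f 0 = 0 \<and>
                                    a1 * f 1 + a2 * deriv01 f 1 = 0}"

text \<open>
  For \<open>f \<in> H\<^sup>2(0,1)\<close> the value is meaningful for almost every \<open>x\<close>, and for \<open>f \<in> C\<^sup>2([0,1])\<close> at
  every \<open>x \<in> [0,1]\<close>.
\<close>

definition SL_op :: "(real \<Rightarrow> real) \<Rightarrow> (real \<Rightarrow> real) \<Rightarrow> (real \<Rightarrow> real) \<Rightarrow> (real \<Rightarrow> real) \<Rightarrow> real \<Rightarrow> real"
  where "SL_op p r q f x = - (1 / r x) * deriv01 (\<lambda>s. p s * deriv01 f s) x + q x / r x * f x"

text \<open>Equality in \<open>L\<^sub>r\<^sup>2(0,1)\<close> is equality almost everywhere.\<close>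

definition SL_eigenpair where
  "SL_eigenpair p r q a1 a2 b1 b2 l f \<longleftrightarrow>
     f \<in> SL_dom a1 a2 b1 b2 \<and> nrm r f \<noteq> 0 \<and>
     (AE x in lebesgue. x \<in> {0..1} \<longrightarrow> SL_op p r q f x = l * f x)"

definition orthonormal_basis :: "(real \<Rightarrow> real) \<Rightarrow> (nat \<Rightarrow> real \<Rightarrow> real) \<Rightarrow> bool" where
  "orthonormal_basis r phi \<longleftrightarrow>
     (\<forall>n\<ge>1. phi n \<in> L2 r) \<and>
     (\<forall>n\<ge>1. \<forall>m\<ge>1. ip r (phi n) (phi m) = (if n = m then 1 else 0)) \<and>
     (\<forall>f\<in>L2 r. (\<lambda>k. nrm r (\<lambda>x. f x - (\<Sum>n=1..k. ip r (phi n) f * phi n x))) \<longlonglongrightarrow> 0)"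

text \<open>
  \<open>lam\<close> enumerates all eigenvalues in increasing order and \<open>phi\<close> is a choice (of signs) of
  normalized eigenfunctions. That the eigenvalues are simple and tend to infinity and that the
  eigenfunctions form an orthonormal basis is classical Sturm--Liouville theory, recorded here as
  part of the description of the eigensystem.
\<close>

definition SL_eigensystem where
  "SL_eigensystem p r q a1 a2 b1 b2 lam phi \<longleftrightarrow>
     strict_mono_on {1..} lam \<and> filterlim lam at_top sequentially \<and>
     {l. \<exists>f. SL_eigenpair p r q a1 a2 b1 b2 l f} = lam ` {1::nat..} \<and>
     (\<forall>n\<ge>1. phi n \<in> C2_01 \<and> phi n \<in> SL_dom a1 a2 b1 b2 \<and> nrm r (phi n) = 1 \<and>
        (\<forall>x\<in>{0..1}. SL_op p r q (phi n) x = lam n * phi n x) \<and>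
        (\<forall>f. SL_eigenpair p r q a1 a2 b1 b2 (lam n) f \<and> nrm r f = 1 \<longrightarrow>
             (\<forall>x\<in>{0..1}. f x = phi n x) \<or> (\<forall>x\<in>{0..1}. f x = - phi n x))) \<and>
     orthonormal_basis r phi"

section \<open>Matrices with indices in \<open>{1..N}\<close>\<close>

type_synonym rmat = "nat \<Rightarrow> nat \<Rightarrow> real"

definition mmul :: "nat \<Rightarrow> rmat \<Rightarrow> rmat \<Rightarrow> rmat" where
  "mmul N X Y n m = (\<Sum>k=1..N. X n k * Y k m)"

definition mtransp :: "rmat \<Rightarrow> rmat" where
  "mtransp X n m = X m n"

definition qform :: "nat \<Rightarrow> rmat \<Rightarrow> (nat \<Rightarrow> real) \<Rightarrow> real" where
  "qform N X \<xi> = (\<Sum>n=1..N. \<Sum>m=1..N. \<xi> n * X n m * \<xi> m)"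

definition sym_pos_def :: "nat \<Rightarrow> rmat \<Rightarrow> bool" where
  "sym_pos_def N X \<longleftrightarrow> (\<forall>n\<in>{1..N}. \<forall>m\<in>{1..N}. X n m = X m n) \<and>
     (\<forall>\<xi>. (\<exists>n\<in>{1..N}. \<xi> n \<noteq> 0) \<longrightarrow> qform N X \<xi> > 0)"

text \<open>The Loewner order; it is only used for symmetric matrices.\<close>

definition loewner_le :: "nat \<Rightarrow> rmat \<Rightarrow> rmat \<Rightarrow> bool" where
  "loewner_le N X Y \<longleftrightarrow> (\<forall>\<xi>. qform N X \<xi> \<le> qform N Y \<xi>)"

text \<open>The matrix \<open>C + \<Sum>\<^sub>i B\<^sub>i K\<^sub>i\<^sup>T\<close>; the \<open>n\<close>-th entry of \<open>K\<^sub>i\<close> is \<open>K i n\<close>.\<close>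

definition Cmat :: "(nat \<Rightarrow> real) \<Rightarrow> rmat" where
  "Cmat lam n m = (if n = m then - lam n else 0)"

definition Bvec :: "(real \<Rightarrow> real) \<Rightarrow> (nat \<Rightarrow> real \<Rightarrow> real) \<Rightarrow> (nat \<Rightarrow> real \<Rightarrow> real) \<Rightarrow> nat \<Rightarrow> nat \<Rightarrow> real"
  where "Bvec r phi vphi i n = - ip r (vphi i) (phi n)"

definition closed_loop_mat where
  "closed_loop_mat r lam phi vphi j K n m
     = Cmat lam n m + (\<Sum>i=1..j. Bvec r phi vphi i n * K i m)"

section \<open>The control Lyapunov functional and the feedback law\<close>

definition Gop :: "(real \<Rightarrow> real) \<Rightarrow> (nat \<Rightarrow> real \<Rightarrow> real) \<Rightarrow> nat \<Rightarrow> rmat \<Rightarrow> (real \<Rightarrow> real) \<Rightarrow> real \<Rightarrow> real"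
  where "Gop r phi N R w x = (\<Sum>n=1..N. \<Sum>m=1..N. R n m * phi m x * ip r (phi n) w)"

definition Pop :: "(real \<Rightarrow> real) \<Rightarrow> (nat \<Rightarrow> real \<Rightarrow> real) \<Rightarrow> nat \<Rightarrow> (real \<Rightarrow> real) \<Rightarrow> real \<Rightarrow> real"
  where "Pop r phi N w x = (\<Sum>n=1..N. ip r (phi n) w * phi n x)"

definition Vfun where
  "Vfun r phi N R \<gamma> j \<omega> w y =
     1/2 * ip r (Gop r phi N R w) w
     + \<gamma>/2 * (nrm r (\<lambda>x. w x - Pop r phi N w x))\<^sup>2
     + 1/2 * (\<Sum>i=1..j. \<omega> i * (y i)\<^sup>2)"

text \<open>The expression \<open>\<dot>V\<close> as a function of the state \<open>(w,y)\<close> and the input \<open>v\<close>.\<close>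

definition Vdot where
  "Vdot p r q phi vphi N R \<gamma> j \<omega> \<mu> w y v =
     ip r (Gop r phi N R w) (\<lambda>x. - SL_op p r q w x - (\<Sum>i=1..j. v i * vphi i x))
     + \<gamma> * ip r (\<lambda>x. w x - Pop r phi N w x)
          (\<lambda>x. - SL_op p r q w x + Pop r phi N (SL_op p r q w) x
               - (\<Sum>i=1..j. v i * vphi i x) + (\<Sum>i=1..j. v i * Pop r phi N (vphi i) x))
     + (\<Sum>i=1..j. \<omega> i * y i * v i) - (\<Sum>i=1..j. \<mu> i * \<omega> i * (y i)\<^sup>2)"

definition kfun where
  "kfun r phi vphi N R K \<gamma> L M i x =
     (\<Sum>n=1..N. (K i n + L i * ip r (\<lambda>z. \<Sum>m=1..N. R n m * phi m z) (vphi i)) * phi n x)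
     + \<gamma> * L i * (\<Sum>n=N+1..M. ip r (phi n) (vphi i) * phi n x)"

definition feedback where
  "feedback r phi vphi N R K \<gamma> \<omega> L M w y i =
     ip r (kfun r phi vphi N R K \<gamma> L M i) w - \<omega> i * L i * y i"

section \<open>Solutions\<close>

text \<open>
  The state at time \<open>t\<close> is \<open>(w t, y t)\<close>, with \<open>y t i\<close> the \<open>i\<close>-th component of \<open>y(t)\<close>.
\<close>

definition C0_strip :: "(real \<Rightarrow> real \<Rightarrow> real) set" where
  "C0_strip = {w. continuous_on ({0..} \<times> {0..1}) (\<lambda>(t, x). w t x)}"

text \<open>\<open>C\<^sup>1((0,\<infinity>) \<times> [0,1])\<close>: both partial derivatives exist and are jointly continuous.\<close>

definition C1_strip :: "(real \<Rightarrow> real \<Rightarrow> real) set" where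
  "C1_strip = {w. (\<forall>t>0. \<forall>x\<in>{0..1}. (\<lambda>s. w s x) differentiable (at t) \<and>
                                  w t differentiable (at x within {0..1})) \<and>
      continuous_on ({0<..} \<times> {0..1}) (\<lambda>(t, x). vector_derivative (\<lambda>s. w s x) (at t)) \<and>
      continuous_on ({0<..} \<times> {0..1}) (\<lambda>(t, x). deriv01 (w t) x)}"

definition C1_halfline :: "(real \<Rightarrow> real) set" where
  "C1_halfline = {g. g differentiable_on {0..} \<and>
      continuous_on {0..} (\<lambda>t. vector_derivative g (at t within {0..}))}"

text \<open>Solutions of the open-loop system (PDE, boundary conditions, ODEs) with input \<open>v t i\<close>.\<close>

definition is_solution where
  "is_solution p r q a1 a2 b1 b2 vphi j \<mu> v w y \<longleftrightarrow>
     w \<in> C0_strip \<and> w \<in> C1_strip \<and> (\<forall>i\<in>{1..j}. (\<lambda>t. y t i) \<in> C1_halfline) \<and>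
     (\<forall>t>0. w t \<in> SL_dom a1 a2 b1 b2 \<inter> C2_01 \<and>
        (\<forall>x\<in>{0<..<1}. vector_derivative (\<lambda>s. w s x) (at t)
             = - SL_op p r q (w t) x - (\<Sum>i=1..j. vphi i x * v t i)) \<and>
        b1 * w t 0 + b2 * deriv01 (w t) 0 = 0 \<and>
        a1 * w t 1 + a2 * deriv01 (w t) 1 = 0 \<and>
        (\<forall>i\<in>{1..j}. vector_derivative (\<lambda>s. y s i) (at t) = - \<mu> i * y t i + v t i))"

definition is_closed_loop_solution where
  "is_closed_loop_solution p r q a1 a2 b1 b2 phi vphi N R K \<gamma> j \<omega> \<mu> L M w0 y0 w y \<longleftrightarrow>
     is_solution p r q a1 a2 b1 b2 vphi j \<mu>
       (\<lambda>t. feedback r phi vphi N R K \<gamma> \<omega> L M (w t) (y t)) w y \<and>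
     (\<forall>x\<in>{0..1}. w 0 x = w0 x) \<and> (\<forall>i\<in>{1..j}. y 0 i = y0 i)"

end

theory Submission
  imports Defs
begin

text \<open>
  In the eigenbasis the closed loop is a family of scalar equations. With \<open>c\<^sub>n = \<langle>\<phi>\<^sub>n,w\<rangle>\<close> and
  \<open>d\<^sub>i\<^sub>n = \<langle>\<phi>\<^sub>n,\<phi>\<^sub>i\<rangle>\<close> (the second \<open>\<phi>\<^sub>i\<close> being the input profile, called \<open>vphi i\<close> below), symmetry of
  the operator (\<open>A_coeff\<close>) turns the equation for \<open>w\<close> into \<open>c\<^sub>n' = - \<lambda>\<^sub>n c\<^sub>n - \<Sum>\<^sub>i d\<^sub>i\<^sub>n v\<^sub>i\<close>.

  \<^emph>\<open>The Lyapunov inequality.\<close> By Parseval's identity \<open>Vdot\<close> is a sum over the modes. The feedback has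
  the form \<open>v\<^sub>i = K\<^sub>i\<^sup>T c + L\<^sub>i s\<^sub>i\<close>, where \<open>s\<^sub>i\<close> (\<open>gain\<close>) is chosen so that the coefficient of \<open>v\<^sub>i\<close> in
  \<open>Vdot\<close> is \<open>- s\<^sub>i\<close> up to a contribution of the modes beyond \<open>M\<close>. Hence \<open>L\<^sub>i\<close> contributes a negative
  square and an error that the spectral gap \<open>\<lambda>\<^sub>M\<^sub>+\<^sub>1 - \<lambda>\<^sub>N\<^sub>+\<^sub>1\<close> absorbs. The part \<open>K\<^sub>i\<^sup>T c\<close> acts on
  the first \<open>N\<close> modes through the matrix inequality, which yields \<open>- \<sigma> |c|\<^sup>2\<close>, and produces cross terms
  with \<open>y\<close> and with the modes beyond \<open>N\<close>. The two smallness conditions ensure that half of the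
  available dissipation pays for these cross terms (\<open>channel_estimate\<close>, \<open>tail_energy\<close>, \<open>Vdot_le\<close>).

  \<^emph>\<open>Decay and uniqueness.\<close> Along solutions \<open>Vdot\<close> is the derivative of \<open>V\<close> (\<open>V_deriv\<close>), and \<open>V\<close> is
  equivalent to the square of the norm (\<open>V_bounds\<close>), so every solution decays exponentially
  (\<open>closed_loop_decay\<close>). As the closed loop is linear, the difference of two solutions with the same
  data decays from zero, which gives uniqueness.

  \<^emph>\<open>Existence.\<close> The feedback sees only \<open>c\<^sub>1, \<dots>, c\<^sub>M\<close> and \<open>y\<close>, and these satisfy a finite linear system
  of ordinary differential equations. Its solution determines smooth inputs \<open>v\<^sub>i\<close>, and these drive the
  other modes. It remains to see that \<open>\<Sum>\<^sub>n c\<^sub>n(t) \<phi>\<^sub>n(x)\<close> is a classical solution. Damping gives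
  \<open>c\<^sub>n = O(1/\<lambda>\<^sub>n)\<close> and, for times bounded away from 0, also \<open>c\<^sub>n' = O(1/\<lambda>\<^sub>n)\<close>, since the inputs
  are differentiable. By the standing assumption the series for \<open>w\<close> and for its time derivative
  converge uniformly. The image under the operator of the partial sums converges only in \<open>L\<^sub>r\<^sup>2\<close>,
  because the input profiles violate the boundary condition at 1. This suffices: a bound for \<open>f'\<close> by
  \<open>sup |f|\<close> and \<open>\<parallel>A f\<parallel>\<close> (\<open>deriv_bound\<close>) makes the operator closed in the sense of \<open>A_closed\<close>, and
  also gives joint continuity of the space derivative.
\<close>

section \<open>Differentiation on the unit interval\<close>

lemma has_real_derivative_transform:
  fixes f g :: "real \<Rightarrow> real"
  assumes "(f has_real_derivative d) (at x within S)" "\<And>x. x \<in> S \<Longrightarrow> f x = g x" "x \<in> S"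
  shows "(g has_real_derivative d) (at x within S)"
  using has_derivative_transform[of x S g f "(*) d"] assms
  unfolding has_field_derivative_def by simp

lemma deriv01_eqI:
  assumes "(f has_real_derivative d) (at x within {0..1})" "x \<in> {0..1}"
  shows "deriv01 f x = d"
  unfolding deriv01_def
  by (rule vector_derivative_within_closed_interval)
     (use assms in \<open>auto simp: has_real_derivative_iff_has_vector_derivative\<close>)

lemma C1_01I:
  assumes "\<And>x. x \<in> {0..1} \<Longrightarrow> (f has_real_derivative g x) (at x within {0..1})"
    and "continuous_on {0..1} g"
  shows "f \<in> C1_01"
proof -
  have "deriv01 f x = g x" if "x \<in> {0..1}" for x
    using deriv01_eqI assms(1) that by blast
  then have "continuous_on {0..1} (deriv01 f)"
    using assms(2) continuous_on_cong[OF refl, of "{0..1}" "deriv01 f" g] by blast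
  moreover have "f differentiable_on {0..1}"
    unfolding differentiable_on_def
    using assms(1) real_differentiable_def by blast
  ultimately show ?thesis by (simp add: C1_01_def)
qed

lemma C1_01_deriv:
  assumes "f \<in> C1_01" "x \<in> {0..1}"
  shows "(f has_real_derivative deriv01 f x) (at x within {0..1})"
proof -
  obtain d where "(f has_real_derivative d) (at x within {0..1})"
    using assms unfolding C1_01_def differentiable_on_def real_differentiable_def by blast
  then show ?thesis using deriv01_eqI assms(2) by metis
qed

lemma C1_01_deriv_continuous: "f \<in> C1_01 \<Longrightarrow> continuous_on {0..1} (deriv01 f)"
  by (simp add: C1_01_def)

lemma C1_01_continuous: "f \<in> C1_01 \<Longrightarrow> continuous_on {0..1} f"
  by (meson C1_01_deriv DERIV_continuous continuous_on_eq_continuous_within)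

lemma deriv01_cong:
  assumes "\<And>x. x \<in> {0..1} \<Longrightarrow> f x = g x" "x \<in> {0..1}"
  shows "deriv01 f x = deriv01 g x"
proof -
  have "(f has_vector_derivative d) (at x within {0..1}) \<longleftrightarrow>
        (g has_vector_derivative d) (at x within {0..1})" for d
    using assms by (metis has_vector_derivative_transform)
  then show ?thesis unfolding deriv01_def vector_derivative_def by simp
qed

lemma C1_01_cong:
  assumes "\<And>x. x \<in> {0..1} \<Longrightarrow> f x = g x" "g \<in> C1_01"
  shows "f \<in> C1_01"
proof (rule C1_01I)
  show "(f has_real_derivative deriv01 g x) (at x within {0..1})" if "x \<in> {0..1}" for x
    using has_real_derivative_transform[OF C1_01_deriv[OF assms(2) that]] assms(1) that by simp
qed (use assms C1_01_deriv_continuous in auto)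

lemma C1_01_lincomb:
  assumes "f \<in> C1_01" "g \<in> C1_01"
  shows "(\<lambda>x. a * f x + b * g x) \<in> C1_01"
    and "x \<in> {0..1} \<Longrightarrow> deriv01 (\<lambda>x. a * f x + b * g x) x = a * deriv01 f x + b * deriv01 g x"
proof -
  have *: "((\<lambda>x. a * f x + b * g x) has_real_derivative a * deriv01 f x + b * deriv01 g x)
      (at x within {0..1})" if "x \<in> {0..1}" for x
    using C1_01_deriv[OF assms(1) that] C1_01_deriv[OF assms(2) that]
    by (auto intro!: derivative_eq_intros)
  show "(\<lambda>x. a * f x + b * g x) \<in> C1_01"
    by (rule C1_01I[OF *]) (auto intro!: continuous_intros C1_01_deriv_continuous assms)
  show "x \<in> {0..1} \<Longrightarrow> deriv01 (\<lambda>x. a * f x + b * g x) x = a * deriv01 f x + b * deriv01 g x"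
    using * deriv01_eqI by blast
qed

lemma C1_01_mult:
  assumes "f \<in> C1_01" "g \<in> C1_01"
  shows "(\<lambda>x. f x * g x) \<in> C1_01"
    and "x \<in> {0..1} \<Longrightarrow> deriv01 (\<lambda>x. f x * g x) x = f x * deriv01 g x + deriv01 f x * g x"
proof -
  have *: "((\<lambda>x. f x * g x) has_real_derivative f x * deriv01 g x + deriv01 f x * g x)
      (at x within {0..1})" if "x \<in> {0..1}" for x
    using C1_01_deriv[OF assms(1) that] C1_01_deriv[OF assms(2) that]
    by (auto intro!: derivative_eq_intros)
  show "(\<lambda>x. f x * g x) \<in> C1_01"
    by (rule C1_01I[OF *], assumption)
       (intro continuous_intros C1_01_deriv_continuous C1_01_continuous assms)
  show "x \<in> {0..1} \<Longrightarrow> deriv01 (\<lambda>x. f x * g x) x = f x * deriv01 g x + deriv01 f x * g x"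
    using * deriv01_eqI by blast
qed

lemma C1_01_inverse:
  assumes "p \<in> C1_01" "\<And>x. x \<in> {0..1} \<Longrightarrow> p x > 0"
  shows "(\<lambda>x. inverse (p x)) \<in> C1_01"
proof (rule C1_01I)
  show "((\<lambda>x. inverse (p x)) has_real_derivative - (inverse (p x) * deriv01 p x * inverse (p x)))
      (at x within {0..1})" if "x \<in> {0..1}" for x
    using DERIV_inverse'[OF C1_01_deriv[OF assms(1) that]] assms(2)[OF that]
    by (simp add: power2_eq_square field_simps)
  show "continuous_on {0..1} (\<lambda>x. - (inverse (p x) * deriv01 p x * inverse (p x)))"
    using assms(2) by (intro continuous_intros C1_01_deriv_continuous C1_01_continuous assms) force+
qed

lemma C2_01D: "f \<in> C2_01 \<Longrightarrow> f \<in> C1_01" "f \<in> C2_01 \<Longrightarrow> deriv01 f \<in> C1_01"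
  by (auto simp: C2_01_def)

lemma C2_01_lincomb:
  assumes "f \<in> C2_01" "g \<in> C2_01"
  shows "(\<lambda>x. a * f x + b * g x) \<in> C2_01"
proof -
  have "deriv01 (\<lambda>x. a * f x + b * g x) \<in> C1_01"
    by (rule C1_01_cong[OF C1_01_lincomb(2)[OF C2_01D(1)[OF assms(1)] C2_01D(1)[OF assms(2)]]])
       (auto intro: C1_01_lincomb(1) C2_01D assms)
  then show ?thesis using assms by (auto simp: C2_01_def intro: C1_01_lincomb)
qed

lemma const_C1_01: "(\<lambda>x. c) \<in> C1_01" and deriv01_const: "x \<in> {0..1} \<Longrightarrow> deriv01 (\<lambda>x. c) x = 0"
proof -
  show "(\<lambda>x. c) \<in> C1_01" by (rule C1_01I[where g="\<lambda>_. 0"]) auto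
  show "x \<in> {0..1} \<Longrightarrow> deriv01 (\<lambda>x. c) x = 0" by (rule deriv01_eqI) auto
qed

lemma zero_C2_01: "(\<lambda>x. 0) \<in> C2_01"
  unfolding C2_01_def
  using const_C1_01 C1_01_cong[OF deriv01_const[where c=0] const_C1_01] by auto

lemma deriv01_sum:
  assumes "finite I" "\<And>i. i \<in> I \<Longrightarrow> f i \<in> C1_01"
  shows "x \<in> {0..1} \<Longrightarrow> deriv01 (\<lambda>x. \<Sum>i\<in>I. a i * f i x) x = (\<Sum>i\<in>I. a i * deriv01 (f i) x)"
  by (intro deriv01_eqI) (auto intro!: derivative_eq_intros C1_01_deriv assms sum.cong)

lemma C2_01_sum:
  assumes "finite I" "\<And>i. i \<in> I \<Longrightarrow> f i \<in> C2_01"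
  shows "(\<lambda>x. \<Sum>i\<in>I. a i * f i x) \<in> C2_01"
  using assms
proof (induction I rule: finite_induct)
  case (insert i I)
  then show ?case
    using C2_01_lincomb[of "f i" "\<lambda>x. \<Sum>i\<in>I. a i * f i x" "a i" 1] by simp
qed (simp add: zero_C2_01)

lemma continuous_interval_bound:
  fixes g :: "real \<Rightarrow> real"
  assumes "continuous_on {a..b} g"
  obtains B where "0 < B" "\<And>x. x \<in> {a..b} \<Longrightarrow> \<bar>g x\<bar> \<le> B"
proof -
  have "compact (g ` {a..b})" by (intro compact_continuous_image assms) simp
  then obtain B where "\<And>x. x \<in> {a..b} \<Longrightarrow> \<bar>g x\<bar> \<le> B"
    by (metis bounded_iff compact_imp_bounded imageI real_norm_def)
  then show ?thesis using that[of "max B 1"] by fastforce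
qed

lemma cont_set_integrable:
  fixes f :: "real \<Rightarrow> real"
  shows "continuous_on {a..b} f \<Longrightarrow> set_integrable lebesgue {a..b} f"
  by (metis absolutely_integrable_continuous_real)

lemma cont_set_integral:
  fixes f :: "real \<Rightarrow> real"
  shows "continuous_on {a..b} f \<Longrightarrow> set_lebesgue_integral lebesgue {a..b} f = integral {a..b} f"
  by (rule set_lebesgue_integral_eq_integral(2)[OF cont_set_integrable])

lemma FTC_01:
  assumes "f \<in> C1_01" "0 \<le> a" "a \<le> b" "b \<le> 1"
  shows "(deriv01 f has_integral (f b - f a)) {a..b}"
proof (rule fundamental_theorem_of_calculus[OF \<open>a \<le> b\<close>])
  fix x assume "x \<in> {a..b}"
  then have "(f has_real_derivative deriv01 f x) (at x within {0..1})"
    using assms by (intro C1_01_deriv) auto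
  then show "(f has_vector_derivative deriv01 f x) (at x within {a..b})"
    using assms by (auto simp: has_real_derivative_iff_has_vector_derivative
        intro: has_vector_derivative_within_subset)
qed

lemma FTC_01_eq:
  assumes "f \<in> C1_01" "0 \<le> a" "a \<le> b" "b \<le> 1"
  shows "set_lebesgue_integral lebesgue {a..b} (deriv01 f) = f b - f a"
proof -
  have "continuous_on {a..b} (deriv01 f)"
    using assms by (auto intro: continuous_on_subset[OF C1_01_deriv_continuous])
  then show ?thesis using FTC_01[OF assms] cont_set_integral integral_unique by metis
qed

lemma C1_01_from_integral:
  assumes "continuous_on {0..1} g" "\<And>x. x \<in> {0..1} \<Longrightarrow> f x = c + integral {0..x} g"
  shows "f \<in> C1_01" and "x \<in> {0..1} \<Longrightarrow> deriv01 f x = g x"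
proof -
  have *: "(f has_real_derivative g x) (at x within {0..1})" if "x \<in> {0..1}" for x
  proof -
    have "((\<lambda>x. c + integral {0..x} g) has_real_derivative g x) (at x within {0..1})"
      using integral_has_real_derivative[OF assms(1) that] by (auto intro!: derivative_eq_intros)
    then show ?thesis by (rule has_real_derivative_transform) (use assms(2) that in auto)
  qed
  show "f \<in> C1_01" by (rule C1_01I[OF * assms(1)])
  show "x \<in> {0..1} \<Longrightarrow> deriv01 f x = g x" using * deriv01_eqI by blast
qed

lemma L2_continuous:
  assumes "continuous_on {0..1} r" "continuous_on {0..1} f"
  shows "f \<in> L2 r"
  unfolding L2_def
  using cont_set_integrable[OF assms(2)]
    cont_set_integrable[OF continuous_on_mult[OF assms(1) continuous_on_power[OF assms(2), of 2]]]
  by (auto simp: set_integrable_def set_borel_measurable_def borel_measurable_integrable)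

lemma C2_01_H2: 
  assumes "f \<in> C2_01" shows "f \<in> H2_01"
proof -
  have f: "f \<in> C1_01" "deriv01 f \<in> C1_01" using assms by (auto simp: C2_01_def)
  have "deriv01 f differentiable at x within {0..1}" if "x \<in> {0..1}" for x
    using C1_01_deriv[OF f(2) that] real_differentiable_def by blast
  moreover have "deriv01 (deriv01 f) \<in> L2 (\<lambda>_. 1)"
    by (intro L2_continuous C1_01_deriv_continuous f continuous_intros)
  moreover have "deriv01 f x = deriv01 f 0 + set_lebesgue_integral lebesgue {0..x} (deriv01 (deriv01 f))"
    if "x \<in> {0..1}" for x
    using FTC_01_eq[OF f(2), of 0 x] that by simp
  ultimately show ?thesis using f(1) unfolding H2_01_def by blast
qed

section \<open>The weighted inner product\<close>

lemma sigma_finite_lebesgue: "sigma_finite_measure (lebesgue :: real measure)"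
proof
  obtain A :: "real set set" where A: "countable A" "A \<subseteq> sets lborel" "\<Union> A = space lborel"
    "\<forall>a\<in>A. emeasure lborel a \<noteq> \<infinity>"
    using lborel.sigma_finite_countable by auto
  then show "\<exists>A::real set set. countable A \<and> A \<subseteq> sets lebesgue \<and> \<Union> A = space lebesgue \<and>
      (\<forall>a\<in>A. emeasure lebesgue a \<noteq> \<infinity>)"
    by (intro exI[of _ A]) (auto simp: subset_iff)
qed

text \<open>Fubini's theorem on the triangle \<open>s \<le> x\<close>. The function \<open>U\<close> is an indefinite integral of the
  merely integrable \<open>h\<close>, so the product rule is available almost everywhere only and the fundamental
  theorem of calculus does not apply to \<open>U G\<close>.\<close>

lemma integration_by_parts_L1:
  assumes h: "set_integrable lebesgue {0..1} h" and G: "G \<in> C1_01"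
    and U: "\<And>x. x \<in> {0..1} \<Longrightarrow> U x = U 0 + set_lebesgue_integral lebesgue {0..x} h"
    and UG: "set_integrable lebesgue {0..1} (\<lambda>x. U x * deriv01 G x)"
  shows "set_lebesgue_integral lebesgue {0..1} (\<lambda>x. h x * G x)
    = U 1 * G 1 - U 0 * G 0 - set_lebesgue_integral lebesgue {0..1} (\<lambda>x. U x * deriv01 G x)"
proof -
  interpret L: sigma_finite_measure "lebesgue :: real measure" by (rule sigma_finite_lebesgue)
  interpret LL: pair_sigma_finite "lebesgue :: real measure" "lebesgue :: real measure" ..
  define g where "g = deriv01 G"
  have gc: "continuous_on {0..1} g" unfolding g_def by (rule C1_01_deriv_continuous[OF G])
  have hi: "integrable lebesgue (\<lambda>x. indicator {0..1} x * h x)"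
    using h by (simp add: set_integrable_def)
  have gi: "integrable lebesgue (\<lambda>x. indicator {0..1} x * g x)"
    using cont_set_integrable[OF gc] by (simp add: set_integrable_def)
  have hm: "(\<lambda>x. indicator {0..1} x * h x) \<in> borel_measurable lebesgue"
    using hi by (rule borel_measurable_integrable)
  have gm: "(\<lambda>x. indicator {0..1} x * g x) \<in> borel_measurable lebesgue"
    using gi by (rule borel_measurable_integrable)
  \<comment> \<open>the integrand on the triangle \<open>s \<le> x\<close>\<close>
  define k where "k = (\<lambda>s x::real. indicator {0..1} s * h s * (indicator {0..1} x * g x)
      * indicator {z::real \<times> real. fst z \<le> snd z} (s, x))"
  have tri: "{z::real \<times> real. fst z \<le> snd z} \<in> sets (lebesgue \<Otimes>\<^sub>M lebesgue)"
  proof -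
    have [measurable]: "(\<lambda>x. x) \<in> borel_measurable (lebesgue :: real measure)"
      by (intro measurable_completion) simp
    have "Measurable.pred (lebesgue \<Otimes>\<^sub>M lebesgue) (\<lambda>z::real \<times> real. fst z \<le> snd z)"
      by measurable
    then show ?thesis by (simp add: pred_def space_pair_measure)
  qed
  have km: "case_prod k \<in> borel_measurable (lebesgue \<Otimes>\<^sub>M lebesgue)"
  proof -
    note [measurable] = hm gm tri
    have "(\<lambda>z. (indicator {0..1} (fst z) * h (fst z)) * (indicator {0..1} (snd z) * g (snd z))
      * (indicator {z::real \<times> real. fst z \<le> snd z} z :: real)) \<in> borel_measurable (lebesgue \<Otimes>\<^sub>M lebesgue)"
      by (intro borel_measurable_times borel_measurable_indicator tri
          measurable_compose[OF measurable_fst hm] measurable_compose[OF measurable_snd gm])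
    then show ?thesis by (simp add: k_def case_prod_beta)
  qed
  have kbound: "norm (k s x) \<le> norm (indicator {0..1} s * h s) * norm (indicator {0..1} x * g x)" for s x
    unfolding k_def norm_mult by (rule mult_left_le) (auto simp: indicator_def)
  have kint: "integrable (lebesgue \<Otimes>\<^sub>M lebesgue) (case_prod k)"
  proof (rule Bochner_Integration.integrable_bound[OF _ km])
    show "integrable (lebesgue \<Otimes>\<^sub>M lebesgue)
       (\<lambda>(s, x). (indicator {0..1} s * h s) * (indicator {0..1} x * g x))"
    proof (rule LL.Fubini_integrable)
      show "(\<lambda>(s, x). (indicator {0..1} s * h s) * (indicator {0..1} x * g x))
          \<in> borel_measurable (lebesgue \<Otimes>\<^sub>M lebesgue)"
        unfolding case_prod_beta
        by (intro borel_measurable_times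
          measurable_compose[OF measurable_fst hm] measurable_compose[OF measurable_snd gm])
      show "integrable lebesgue (\<lambda>s. \<integral>x. norm (case (s, x) of (s, x) \<Rightarrow>
          (indicator {0..1} s * h s) * (indicator {0..1} x * g x)) \<partial>lebesgue)"
        using integrable_abs[OF hi] by (simp add: abs_mult)
      show "AE s in lebesgue. integrable lebesgue (\<lambda>x. case (s, x) of (s, x) \<Rightarrow>
          (indicator {0..1} s * h s) * (indicator {0..1} x * g x))"
        using gi by simp
    qed
    show "AE z in lebesgue \<Otimes>\<^sub>M lebesgue. norm (case z of (s, x) \<Rightarrow> k s x) \<le>
        norm (case z of (s, x) \<Rightarrow> (indicator {0..1} s * h s) * (indicator {0..1} x * g x))"
      unfolding case_prod_beta norm_mult by (intro always_eventually allI kbound[unfolded norm_mult])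
  qed
  have fub: "(\<integral>x. (\<integral>s. k s x \<partial>lebesgue) \<partial>lebesgue) = (\<integral>s. (\<integral>x. k s x \<partial>lebesgue) \<partial>lebesgue)"
    by (rule LL.Fubini_integral[OF kint])
  have inner1: "(\<integral>x. k s x \<partial>lebesgue) = indicator {0..1} s * (h s * (G 1 - G s))" for s
  proof (cases "s \<in> {0..1}")
    case True
    have "(\<integral>x. k s x \<partial>lebesgue) = (\<integral>x. h s * (indicator {s..1} x * g x) \<partial>lebesgue)"
      by (rule Bochner_Integration.integral_cong) (use True in \<open>auto simp: k_def indicator_def\<close>)
    also have "\<dots> = h s * set_lebesgue_integral lebesgue {s..1} g"
      by (simp add: set_lebesgue_integral_def)
    also have "set_lebesgue_integral lebesgue {s..1} g = G 1 - G s"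
      unfolding g_def by (rule FTC_01_eq[OF G]) (use True in auto)
    finally show ?thesis using True by simp
  qed (simp add: k_def)
  have inner2: "(\<integral>s. k s x \<partial>lebesgue) = indicator {0..1} x * ((U x - U 0) * g x)" for x
  proof (cases "x \<in> {0..1}")
    case True
    have "(\<integral>s. k s x \<partial>lebesgue) = (\<integral>s. g x * (indicator {0..x} s * h s) \<partial>lebesgue)"
      by (rule Bochner_Integration.integral_cong) (use True in \<open>auto simp: k_def indicator_def\<close>)
    also have "\<dots> = g x * set_lebesgue_integral lebesgue {0..x} h"
      by (simp add: set_lebesgue_integral_def)
    also have "set_lebesgue_integral lebesgue {0..x} h = U x - U 0"
      using U[OF True] by simp
    finally show ?thesis using True by simp
  qed (simp add: k_def)
  have hG: "set_integrable lebesgue {0..1} (\<lambda>x. h x * (G 1 - G x))"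
    using LL.integrable_fst[OF kint] inner1 by (simp add: set_integrable_def)
  have "set_lebesgue_integral lebesgue {0..1} (\<lambda>x. h x * (G 1 - G x))
      = set_lebesgue_integral lebesgue {0..1} (\<lambda>x. (U x - U 0) * g x)"
    using fub unfolding inner1 inner2 set_lebesgue_integral_def by simp
  also have "\<dots> = set_lebesgue_integral lebesgue {0..1} (\<lambda>x. U x * g x - U 0 * g x)"
    by (simp add: algebra_simps)
  also have "\<dots> = set_lebesgue_integral lebesgue {0..1} (\<lambda>x. U x * g x) - U 0 * (G 1 - G 0)"
    using UG cont_set_integrable[OF gc] FTC_01_eq[OF G, of 0 1]
    by (subst set_integral_diff) (auto simp: g_def)
  finally have 1: "set_lebesgue_integral lebesgue {0..1} (\<lambda>x. h x * (G 1 - G x))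
      = set_lebesgue_integral lebesgue {0..1} (\<lambda>x. U x * g x) - U 0 * (G 1 - G 0)" .
  have "set_lebesgue_integral lebesgue {0..1} (\<lambda>x. h x * G x) =
     set_lebesgue_integral lebesgue {0..1} (\<lambda>x. G 1 * h x - h x * (G 1 - G x))"
    by (simp add: algebra_simps)
  also have "\<dots> = G 1 * set_lebesgue_integral lebesgue {0..1} h
      - set_lebesgue_integral lebesgue {0..1} (\<lambda>x. h x * (G 1 - G x))"
    using h hG by (subst set_integral_diff) auto
  also have "\<dots> = G 1 * (U 1 - U 0) - (set_lebesgue_integral lebesgue {0..1} (\<lambda>x. U x * g x) - U 0 * (G 1 - G 0))"
    unfolding 1 using U[of 1] by simp
  finally show ?thesis unfolding g_def by (simp add: algebra_simps)
qed

locale weight =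
  fixes r :: "real \<Rightarrow> real"
  assumes r_cont: "continuous_on {0..1} r" and r_pos: "\<And>x. x \<in> {0..1} \<Longrightarrow> 0 < r x"
begin

lemma L2_cont: "continuous_on {0..1} f \<Longrightarrow> f \<in> L2 r"
  by (rule L2_continuous[OF r_cont])

lemma r_measurable: "(\<lambda>x. indicator {0..1} x * r x) \<in> borel_measurable lebesgue"
  using cont_set_integrable[OF r_cont] by (simp add: set_integrable_def borel_measurable_integrable)

lemma L2_measurable: "f \<in> L2 r \<Longrightarrow> (\<lambda>x. indicator {0..1} x * f x) \<in> borel_measurable lebesgue"
  by (simp add: L2_def set_borel_measurable_def)

lemma ip_integrable:
  assumes "u \<in> L2 r" "v \<in> L2 r"
  shows "set_integrable lebesgue {0..1} (\<lambda>x. r x * u x * v x)"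
proof (rule set_integrable_bound)
  show "set_integrable lebesgue {0..1} (\<lambda>x. r x * (u x)\<^sup>2 + r x * (v x)\<^sup>2)"
    using assms by (auto simp: L2_def)
  have "(\<lambda>x. (indicator {0..1} x * r x) * (indicator {0..1} x * u x) * (indicator {0..1} x * v x))
      \<in> borel_measurable lebesgue"
    by (intro borel_measurable_times r_measurable L2_measurable assms)
  moreover have "(\<lambda>x. (indicator {0..1} x * r x) * (indicator {0..1} x * u x) * (indicator {0..1} x * v x))
     = (\<lambda>x. indicator {0..1} x * (r x * u x * v x))"
    by (auto simp: indicator_def)
  ultimately show "set_borel_measurable lebesgue {0..1} (\<lambda>x. r x * u x * v x)"
    by (simp add: set_borel_measurable_def)
  have "\<bar>r x * u x * v x\<bar> \<le> \<bar>r x * (u x)\<^sup>2 + r x * (v x)\<^sup>2\<bar>" if "x \<in> {0..1}" for x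
  proof -
    have "\<bar>u x * v x\<bar> \<le> (u x)\<^sup>2 + (v x)\<^sup>2"
      using sum_squares_bound[of "\<bar>u x\<bar>" "\<bar>v x\<bar>"] mult_nonneg_nonneg[OF abs_ge_zero[of "u x"] abs_ge_zero[of "v x"]]
      unfolding abs_mult power2_abs by linarith
    then have "r x * \<bar>u x * v x\<bar> \<le> r x * ((u x)\<^sup>2 + (v x)\<^sup>2)"
      using r_pos[OF that] by (intro mult_left_mono) auto
    moreover have "\<bar>r x * u x * v x\<bar> = r x * \<bar>u x * v x\<bar>"
      using r_pos[OF that] by (simp add: abs_mult)
    ultimately show ?thesis by (simp add: distrib_left)
  qed
  then show "AE x in lebesgue. x \<in> {0..1} \<longrightarrow> norm (r x * u x * v x) \<le> norm (r x * (u x)\<^sup>2 + r x * (v x)\<^sup>2)"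
    by simp
qed

lemma L2_lincomb:
  assumes "u \<in> L2 r" "v \<in> L2 r"
  shows "(\<lambda>x. a * u x + b * v x) \<in> L2 r"
proof -
  have "(\<lambda>x. a * (indicator {0..1} x * u x) + b * (indicator {0..1} x * v x)) \<in> borel_measurable lebesgue"
    by (intro borel_measurable_add borel_measurable_times borel_measurable_const L2_measurable assms)
  then have 1: "set_borel_measurable lebesgue {0..1} (\<lambda>x. a * u x + b * v x)"
    by (simp add: set_borel_measurable_def algebra_simps)
  have "set_integrable lebesgue {0..1} (\<lambda>x. a\<^sup>2 * (r x * u x * u x) + 2 * a * b * (r x * u x * v x)
      + b\<^sup>2 * (r x * v x * v x))"
    by (intro set_integral_add set_integrable_mult_right ip_integrable assms)
  then have "set_integrable lebesgue {0..1} (\<lambda>x. r x * (a * u x + b * v x)\<^sup>2)"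
    by (rule back_subst[where P = "set_integrable lebesgue {0..1}"])
       (auto simp: power2_eq_square algebra_simps)
  with 1 show ?thesis by (simp add: L2_def)
qed

lemma L2_zero: "(\<lambda>x. 0) \<in> L2 r" by (simp add: L2_cont)

lemma L2_add: "u \<in> L2 r \<Longrightarrow> v \<in> L2 r \<Longrightarrow> (\<lambda>x. u x + v x) \<in> L2 r"
  using L2_lincomb[of u v 1 1] by simp

lemma L2_diff: "u \<in> L2 r \<Longrightarrow> v \<in> L2 r \<Longrightarrow> (\<lambda>x. u x - v x) \<in> L2 r"
  using L2_lincomb[of u v 1 "-1"] by simp

lemma L2_scale: "u \<in> L2 r \<Longrightarrow> (\<lambda>x. c * u x) \<in> L2 r"
  using L2_lincomb[of u u c 0] by simp

lemma L2_sum: "finite I \<Longrightarrow> (\<And>i. i \<in> I \<Longrightarrow> f i \<in> L2 r) \<Longrightarrow> (\<lambda>x. \<Sum>i\<in>I. a i * f i x) \<in> L2 r"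
  by (induction I rule: finite_induct) (auto simp: L2_zero intro!: L2_add L2_scale)

lemmas L2_intros = L2_zero L2_add L2_diff L2_scale L2_sum finite_atLeastAtMost

lemma ip_commute: "ip r u v = ip r v u"
  by (simp add: ip_def mult.assoc mult.left_commute mult.commute)

lemma ip_lincomb:
  assumes "u \<in> L2 r" "v \<in> L2 r" "w \<in> L2 r"
  shows "ip r w (\<lambda>x. a * u x + b * v x) = a * ip r w u + b * ip r w v"
proof -
  have "ip r w (\<lambda>x. a * u x + b * v x)
     = set_lebesgue_integral lebesgue {0..1} (\<lambda>x. a * (r x * w x * u x) + b * (r x * w x * v x))"
    unfolding ip_def by (simp add: algebra_simps)
  also have "\<dots> = a * ip r w u + b * ip r w v"
    unfolding ip_def using assms
    by (subst set_integral_add) (auto intro!: set_integrable_mult_right ip_integrable)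
  finally show ?thesis .
qed

lemma ip_zero: "ip r w (\<lambda>x. 0) = 0" by (simp add: ip_def)

lemma ip_add: "w \<in> L2 r \<Longrightarrow> u \<in> L2 r \<Longrightarrow> v \<in> L2 r \<Longrightarrow> ip r w (\<lambda>x. u x + v x) = ip r w u + ip r w v"
  using ip_lincomb[of u v w 1 1] by simp

lemma ip_diff: "w \<in> L2 r \<Longrightarrow> u \<in> L2 r \<Longrightarrow> v \<in> L2 r \<Longrightarrow> ip r w (\<lambda>x. u x - v x) = ip r w u - ip r w v"
  using ip_lincomb[of u v w 1 "-1"] by simp

lemma ip_scale: "w \<in> L2 r \<Longrightarrow> u \<in> L2 r \<Longrightarrow> ip r w (\<lambda>x. c * u x) = c * ip r w u"
  using ip_lincomb[of u u w c 0] by simp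

lemma ip_sum:
  assumes "finite I" "\<And>i. i \<in> I \<Longrightarrow> f i \<in> L2 r" "w \<in> L2 r"
  shows "ip r w (\<lambda>x. \<Sum>i\<in>I. a i * f i x) = (\<Sum>i\<in>I. a i * ip r w (f i))"
  using assms
proof (induction I rule: finite_induct)
  case (insert i I)
  then have "ip r w (\<lambda>x. a i * f i x + (\<Sum>i\<in>I. a i * f i x))
     = ip r w (\<lambda>x. a i * f i x) + ip r w (\<lambda>x. \<Sum>i\<in>I. a i * f i x)"
    by (intro ip_add L2_sum L2_scale) auto
  then show ?case using insert by (simp add: ip_scale)
qed (simp add: ip_zero)

lemma ip_left:
  "w \<in> L2 r \<Longrightarrow> u \<in> L2 r \<Longrightarrow> v \<in> L2 r \<Longrightarrow> ip r (\<lambda>x. u x + v x) w = ip r u w + ip r v w"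
  "w \<in> L2 r \<Longrightarrow> u \<in> L2 r \<Longrightarrow> v \<in> L2 r \<Longrightarrow> ip r (\<lambda>x. u x - v x) w = ip r u w - ip r v w"
  "w \<in> L2 r \<Longrightarrow> u \<in> L2 r \<Longrightarrow> ip r (\<lambda>x. c * u x) w = c * ip r u w"
  "finite I \<Longrightarrow> (\<And>i. i \<in> I \<Longrightarrow> f i \<in> L2 r) \<Longrightarrow> w \<in> L2 r \<Longrightarrow>
     ip r (\<lambda>x. \<Sum>i\<in>I. a i * f i x) w = (\<Sum>i\<in>I. a i * ip r (f i) w)"
  by (simp_all add: ip_commute[of _ w] ip_add ip_diff ip_scale ip_sum)

lemma ip_self_nonneg: "0 \<le> ip r u u"
proof -
  have "0 \<le> r x * u x * u x" if "x \<in> {0..1}" for x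
    using r_pos[OF that] by (metis less_imp_le mult.assoc mult_nonneg_nonneg zero_le_square)
  then show ?thesis unfolding ip_def set_lebesgue_integral_def
    by (intro Bochner_Integration.integral_nonneg) (auto simp: indicator_def)
qed

lemma nrm_nonneg: "0 \<le> nrm r u" by (simp add: nrm_def ip_self_nonneg)

lemma nrm_sq: "(nrm r u)\<^sup>2 = ip r u u" by (simp add: nrm_def ip_self_nonneg)

lemma Cauchy_Schwarz:
  assumes u: "u \<in> L2 r" and v: "v \<in> L2 r"
  shows "\<bar>ip r u v\<bar> \<le> nrm r u * nrm r v"
proof -
  have q: "0 \<le> a\<^sup>2 * ip r u u + 2 * a * b * ip r u v + b\<^sup>2 * ip r v v" for a b
  proof -
    let ?w = "\<lambda>x. a * u x + b * v x"
    have w: "?w \<in> L2 r" by (rule L2_lincomb[OF u v])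
    have "ip r ?w ?w = a * ip r ?w u + b * ip r ?w v" by (rule ip_lincomb[OF u v w])
    also have "ip r ?w u = a * ip r u u + b * ip r u v"
      using ip_lincomb[OF u v u] by (simp add: ip_commute[of ?w])
    also have "ip r ?w v = a * ip r u v + b * ip r v v"
      using ip_lincomb[OF u v v] by (simp add: ip_commute[of ?w] ip_commute[of v u])
    finally show ?thesis using ip_self_nonneg[of ?w] by (simp add: power2_eq_square algebra_simps)
  qed
  have "(ip r u v)\<^sup>2 \<le> ip r u u * ip r v v"
  proof (cases "ip r v v = 0")
    case True
    have "ip r u v = 0"
    proof (rule ccontr)
      assume ne: "ip r u v \<noteq> 0"
      have "0 \<le> ip r u u + 2 * (-(ip r u u + 1) / (2 * ip r u v)) * ip r u v"
        using q[of 1 "-(ip r u u + 1) / (2 * ip r u v)"] True by simp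
      also have "\<dots> = -1" using ne by (simp add: field_simps)
      finally show False by simp
    qed
    then show ?thesis using True by simp
  next
    case False
    then have pos: "ip r v v > 0" using ip_self_nonneg[of v] by simp
    have "0 \<le> ip r v v * (ip r v v * ip r u u - (ip r u v)\<^sup>2)"
      using q[of "ip r v v" "- ip r u v"] by (simp add: power2_eq_square algebra_simps)
    then show ?thesis using pos by (simp add: zero_le_mult_iff mult.commute)
  qed
  then have "sqrt ((ip r u v)\<^sup>2) \<le> sqrt (ip r u u * ip r v v)" by (rule real_sqrt_le_mono)
  then show ?thesis by (simp add: nrm_def real_sqrt_mult)
qed

lemma nrm_scale:
  assumes "u \<in> L2 r" shows "nrm r (\<lambda>x. c * u x) = \<bar>c\<bar> * nrm r u"
  using assms by (simp add: nrm_def ip_scale ip_left L2_scale real_sqrt_mult power2_eq_square[symmetric]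
      mult.assoc[symmetric])

lemma nrm_triangle:
  assumes u: "u \<in> L2 r" and v: "v \<in> L2 r"
  shows "nrm r (\<lambda>x. u x + v x) \<le> nrm r u + nrm r v"
proof (rule power2_le_imp_le)
  have "(nrm r (\<lambda>x. u x + v x))\<^sup>2 = ip r u u + 2 * ip r u v + ip r v v"
    unfolding nrm_sq using u v by (simp add: ip_add ip_left L2_add ip_commute[of v u])
  also have "\<dots> \<le> (nrm r u)\<^sup>2 + 2 * (nrm r u * nrm r v) + (nrm r v)\<^sup>2"
    using Cauchy_Schwarz[OF u v] by (simp add: nrm_sq)
  finally show "(nrm r (\<lambda>x. u x + v x))\<^sup>2 \<le> (nrm r u + nrm r v)\<^sup>2"
    by (simp add: power2_eq_square algebra_simps)
qed (simp add: nrm_nonneg)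

lemma nrm_triangle_sum:
  assumes "finite I" "\<And>i. i \<in> I \<Longrightarrow> f i \<in> L2 r"
  shows "nrm r (\<lambda>x. \<Sum>i\<in>I. a i * f i x) \<le> (\<Sum>i\<in>I. \<bar>a i\<bar> * nrm r (f i))"
  using assms
proof (induction I rule: finite_induct)
  case (insert i I)
  then have "nrm r (\<lambda>x. a i * f i x + (\<Sum>i\<in>I. a i * f i x))
     \<le> nrm r (\<lambda>x. a i * f i x) + nrm r (\<lambda>x. \<Sum>i\<in>I. a i * f i x)"
    by (intro nrm_triangle L2_sum L2_scale) auto
  then show ?case using insert by (simp add: nrm_scale)
qed (simp add: nrm_def ip_zero)

lemma ip_cong:
  assumes "\<And>x. x \<in> {0..1} \<Longrightarrow> u x = u' x" "\<And>x. x \<in> {0..1} \<Longrightarrow> v x = v' x"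
  shows "ip r u v = ip r u' v'"
  unfolding ip_def by (rule set_lebesgue_integral_cong) (use assms in auto)

lemma nrm_cong: "(\<And>x. x \<in> {0..1} \<Longrightarrow> u x = u' x) \<Longrightarrow> nrm r u = nrm r u'"
  unfolding nrm_def by (subst ip_cong[of u u' u u']) auto

lemma L2_cong_AE:
  assumes "u \<in> L2 r" "AE x in lebesgue. x \<in> {0..1} \<longrightarrow> u x = v x"
  shows "v \<in> L2 r"
proof -
  have m: "(\<lambda>x. indicator {0..1} x * v x) \<in> borel_measurable lebesgue"
    by (rule borel_measurable_AE[OF L2_measurable[OF assms(1)]])
       (use assms(2) in eventually_elim, auto simp: indicator_def)
  have "(\<lambda>x. (indicator {0..1} x * r x) * (indicator {0..1} x * v x)\<^sup>2) \<in> borel_measurable lebesgue"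
    by (intro borel_measurable_times[OF r_measurable] borel_measurable_power m)
  then have m': "(\<lambda>x. indicator {0..1} x * (r x * (v x)\<^sup>2)) \<in> borel_measurable lebesgue"
    by (rule back_subst[where P = "\<lambda>f. f \<in> borel_measurable lebesgue"]) (auto simp: indicator_def)
  have "integrable lebesgue (\<lambda>x. indicator {0..1} x * (r x * (v x)\<^sup>2))"
    by (rule integrable_cong_AE_imp[where g = "\<lambda>x. indicator {0..1} x * (r x * (u x)\<^sup>2)"])
       (use assms m' in \<open>auto simp: L2_def set_integrable_def indicator_def elim!: eventually_mono\<close>)
  then show ?thesis using m by (simp add: L2_def set_borel_measurable_def set_integrable_def)
qed

lemma ip_cong_AE:
  assumes "u \<in> L2 r" "v \<in> L2 r" "AE x in lebesgue. x \<in> {0..1} \<longrightarrow> v x = v' x"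
  shows "ip r u v = ip r u v'"
proof -
  have v': "v' \<in> L2 r" by (rule L2_cong_AE[OF assms(2,3)])
  show ?thesis unfolding ip_def set_lebesgue_integral_def
  proof (rule integral_cong_AE)
    show "(\<lambda>x. indicat_real {0..1} x *\<^sub>R (r x * u x * v x)) \<in> borel_measurable lebesgue"
      using ip_integrable[OF assms(1,2)] by (simp add: set_integrable_def borel_measurable_integrable)
    show "(\<lambda>x. indicat_real {0..1} x *\<^sub>R (r x * u x * v' x)) \<in> borel_measurable lebesgue"
      using ip_integrable[OF assms(1) v'] by (simp add: set_integrable_def borel_measurable_integrable)
  qed (use assms(3) in \<open>auto simp: indicator_def elim!: eventually_mono\<close>)
qed

lemma ip_continuous_eq:
  assumes "continuous_on {0..1} u" "continuous_on {0..1} v"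
  shows "ip r u v = integral {0..1} (\<lambda>x. r x * u x * v x)"
  unfolding ip_def by (rule cont_set_integral) (intro continuous_intros r_cont assms)

lemma nrm_mult_le:
  assumes u: "u \<in> L2 r" and gu: "(\<lambda>x. g x * u x) \<in> L2 r"
    and b: "\<And>x. x \<in> {0..1} \<Longrightarrow> \<bar>g x\<bar> \<le> B" and B: "0 \<le> B"
  shows "nrm r (\<lambda>x. g x * u x) \<le> B * nrm r u"
proof (rule power2_le_imp_le)
  have "ip r (\<lambda>x. g x * u x) (\<lambda>x. g x * u x)
      \<le> set_lebesgue_integral lebesgue {0..1} (\<lambda>x. B\<^sup>2 * (r x * u x * u x))"
    unfolding ip_def
  proof (rule set_integral_mono)
    show "r x * (g x * u x) * (g x * u x) \<le> B\<^sup>2 * (r x * u x * u x)" if "x \<in> {0..1}" for x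
    proof -
      have "(g x)\<^sup>2 \<le> B\<^sup>2" using b[OF that] B by (metis abs_le_square_iff abs_of_nonneg)
      then have "(g x)\<^sup>2 * (r x * (u x)\<^sup>2) \<le> B\<^sup>2 * (r x * (u x)\<^sup>2)"
        using r_pos[OF that] by (intro mult_right_mono) auto
      then show ?thesis by (simp add: power2_eq_square mult_ac)
    qed
  qed (intro ip_integrable set_integrable_mult_right u gu)+
  then show "(nrm r (\<lambda>x. g x * u x))\<^sup>2 \<le> (B * nrm r u)\<^sup>2"
    by (simp add: nrm_sq power_mult_distrib ip_def[of r u])
qed (simp add: B nrm_nonneg)

lemma nrm_le_sup:
  assumes "u \<in> L2 r" "\<And>x. x \<in> {0..1} \<Longrightarrow> \<bar>u x\<bar> \<le> e" "0 \<le> e"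
  shows "nrm r u \<le> e * nrm r (\<lambda>_. 1)"
  using nrm_mult_le[of "\<lambda>_. 1" u e] assms by (simp add: L2_cont)

lemma nrm_zero_imp:
  assumes "continuous_on {0..1} u" "nrm r u = 0" "x \<in> {0..1}"
  shows "u x = 0"
proof -
  have c: "continuous_on {0..1} (\<lambda>x. r x * u x * u x)" by (intro continuous_intros r_cont assms)
  have nn: "0 \<le> r x * u x * u x" if "x \<in> {0..1}" for x
    using r_pos[OF that] by (metis less_imp_le mult.assoc mult_nonneg_nonneg zero_le_square)
  have "integral {0..1} (\<lambda>x. r x * u x * u x) = 0"
    using ip_continuous_eq[OF assms(1,1)] nrm_sq[of u] assms(2) by simp
  then have "((\<lambda>x. r x * u x * u x) has_integral 0) (cbox 0 1)"
    using integrable_continuous_real[OF c] by (simp add: has_integral_iff)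
  then have "r x * u x * u x = 0"
    by (rule has_integral_0_cbox_imp_0[of 0 1, rotated 2]) (use c nn assms(3) in auto)
  then show ?thesis using r_pos[OF assms(3)] by simp
qed

text \<open>Cauchy--Schwarz against the constant function 1 controls integrals over subintervals.\<close>

lemma integral_le_nrm:
  assumes f: "continuous_on {0..1} f" and "0 \<le> a" "a \<le> b" "b \<le> 1"
  shows "\<bar>integral {a..b} (\<lambda>x. r x * f x)\<bar> \<le> nrm r (\<lambda>_. 1) * nrm r f"
proof -
  have c: "continuous_on {0..1} (\<lambda>x. r x * f x)" by (intro continuous_intros r_cont f)
  have ca: "continuous_on {0..1} (\<lambda>x. \<bar>f x\<bar>)" by (intro continuous_intros f)
  have c1: "continuous_on {0..1} (\<lambda>x. r x * 1 * \<bar>f x\<bar>)" by (intro continuous_intros r_cont f)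
  have "norm (integral {a..b} (\<lambda>x. r x * f x)) \<le> integral {a..b} (\<lambda>x. r x * 1 * \<bar>f x\<bar>)"
  proof (rule integral_norm_bound_integral)
    show "(\<lambda>x. r x * f x) integrable_on {a..b}" "(\<lambda>x. r x * 1 * \<bar>f x\<bar>) integrable_on {a..b}"
      using assms continuous_on_subset[OF c] continuous_on_subset[OF c1]
      by (auto intro!: integrable_continuous_real)
    show "norm (r x * f x) \<le> r x * 1 * \<bar>f x\<bar>" if "x \<in> {a..b}" for x
      using r_pos[of x] that assms by (auto simp: abs_mult)
  qed
  also have "\<dots> \<le> integral {0..1} (\<lambda>x. r x * 1 * \<bar>f x\<bar>)"
  proof (rule integral_subset_le)
    show "(\<lambda>x. r x * 1 * \<bar>f x\<bar>) integrable_on {a..b}" "(\<lambda>x. r x * 1 * \<bar>f x\<bar>) integrable_on {0..1}"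
      using assms continuous_on_subset[OF c1] c1
      by (auto intro!: integrable_continuous_real)
    show "\<forall>x\<in>{0..1}. 0 \<le> r x * 1 * \<bar>f x\<bar>" using r_pos by (simp add: less_imp_le)
  qed (use assms in auto)
  also have "\<dots> = ip r (\<lambda>_. 1) (\<lambda>x. \<bar>f x\<bar>)" by (subst ip_continuous_eq) (auto intro: ca)
  also have "\<dots> \<le> nrm r (\<lambda>_. 1) * nrm r (\<lambda>x. \<bar>f x\<bar>)"
    using Cauchy_Schwarz[OF L2_cont[OF continuous_on_const] L2_cont[OF ca], of 1] by simp
  also have "nrm r (\<lambda>x. \<bar>f x\<bar>) = nrm r f" by (simp add: nrm_def ip_def mult.assoc)
  finally show ?thesis by simp
qed

end

locale onb = weight +
  fixes phi :: "nat \<Rightarrow> real \<Rightarrow> real"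
  assumes onb: "orthonormal_basis r phi"
begin

lemma phi_L2: "n \<ge> 1 \<Longrightarrow> phi n \<in> L2 r"
  using onb by (simp add: orthonormal_basis_def)

lemma phi_orth: "n \<ge> 1 \<Longrightarrow> m \<ge> 1 \<Longrightarrow> ip r (phi n) (phi m) = (if n = m then 1 else 0)"
  using onb by (simp add: orthonormal_basis_def)

lemma expansion:
  assumes "f \<in> L2 r"
  shows "(\<lambda>k. nrm r (\<lambda>x. f x - (\<Sum>n=1..k. ip r (phi n) f * phi n x))) \<longlonglongrightarrow> 0"
  using onb assms by (simp add: orthonormal_basis_def)

lemma Parseval:
  assumes f: "f \<in> L2 r" and g: "g \<in> L2 r"
  shows "(\<lambda>k. ip r (phi (Suc k)) f * ip r (phi (Suc k)) g) sums ip r f g"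
proof -
  define S where "S k x = (\<Sum>n=1..k. ip r (phi n) f * phi n x)" for k x
  have S: "S k \<in> L2 r" for k unfolding S_def by (intro L2_sum phi_L2) auto
  have e: "ip r f g - (\<Sum>n=1..k. ip r (phi n) f * ip r (phi n) g) = ip r (\<lambda>x. f x - S k x) g" for k
    unfolding ip_left(2)[OF g f S]
    unfolding S_def by (subst ip_left(4)) (auto intro: phi_L2 g)
  have "(\<lambda>k. ip r f g - (\<Sum>n=1..k. ip r (phi n) f * ip r (phi n) g)) \<longlonglongrightarrow> 0"
  proof (rule Lim_null_comparison)
    show "\<forall>\<^sub>F k in sequentially. norm (ip r f g - (\<Sum>n=1..k. ip r (phi n) f * ip r (phi n) g))
        \<le> nrm r (\<lambda>x. f x - S k x) * nrm r g"
      unfolding e using Cauchy_Schwarz[OF L2_diff[OF f S] g] by simp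
    show "(\<lambda>k. nrm r (\<lambda>x. f x - S k x) * nrm r g) \<longlonglongrightarrow> 0"
      using tendsto_mult_left_zero[OF expansion[OF f]] unfolding S_def by simp
  qed
  then have "(\<lambda>k. \<Sum>n=1..k. ip r (phi n) f * ip r (phi n) g) \<longlonglongrightarrow> ip r f g"
    using tendsto_diff[OF tendsto_const[of "ip r f g"]] by fastforce
  moreover have "(\<Sum>n=1..k. ip r (phi n) f * ip r (phi n) g)
      = (\<Sum>n<k. ip r (phi (Suc n)) f * ip r (phi (Suc n)) g)" for k
    by (metis (no_types, lifting) One_nat_def atLeast1_atMost_eq_remove0 lessThan_Suc_atMost
        sum.atLeast1_atMost_eq sum.cong)
  ultimately show ?thesis by (simp add: sums_def)
qed

lemma Parseval_tail:
  assumes f: "f \<in> L2 r" and g: "g \<in> L2 r"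
  shows "(\<lambda>k. ip r (phi (N + 1 + k)) f * ip r (phi (N + 1 + k)) g)
    sums (ip r f g - (\<Sum>n=1..N. ip r (phi n) f * ip r (phi n) g))"
proof -
  have "(\<Sum>n=1..N. ip r (phi n) f * ip r (phi n) g)
      = (\<Sum>n<N. ip r (phi (Suc n)) f * ip r (phi (Suc n)) g)"
    by (metis (no_types, lifting) One_nat_def atLeast1_atMost_eq_remove0 lessThan_Suc_atMost
        sum.atLeast1_atMost_eq sum.cong)
  then show ?thesis
    using sums_split_initial_segment[OF Parseval[OF f g], of N] by (simp add: add.commute)
qed

lemma coeff_sum:
  assumes "m \<ge> 1"
  shows "ip r (phi m) (\<lambda>x. \<Sum>n=1..k. a n * phi n x) = (if m \<le> k then a m else 0)"
proof -
  have "ip r (phi m) (\<lambda>x. \<Sum>n=1..k. a n * phi n x) = (\<Sum>n=1..k. a n * (if m = n then 1 else 0))"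
    using assms by (subst ip_sum) (auto intro!: phi_L2 sum.cong simp: phi_orth)
  also have "\<dots> = (\<Sum>n=1..k. if n = m then a n else 0)" by (intro sum.cong) auto
  finally show ?thesis using assms by simp
qed

lemma coeff_bound: "n \<ge> 1 \<Longrightarrow> f \<in> L2 r \<Longrightarrow> \<bar>ip r (phi n) f\<bar> \<le> nrm r f"
  using Cauchy_Schwarz[OF phi_L2, of n f] phi_orth[of n n] by (simp add: nrm_def)

end

section \<open>The Sturm--Liouville operator\<close>

lemma H2_01D:
  assumes "f \<in> H2_01"
  shows "f \<in> C1_01" "deriv01 (deriv01 f) \<in> L2 (\<lambda>_. 1)"
    "AE x in lebesgue. x \<in> {0..1} \<longrightarrow> deriv01 f differentiable (at x within {0..1})"
    "\<And>x. x \<in> {0..1} \<Longrightarrow>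
       deriv01 f x = deriv01 f 0 + set_lebesgue_integral lebesgue {0..x} (deriv01 (deriv01 f))"
  using assms unfolding H2_01_def by blast+

lemma uniform_limit_integral_tendsto:
  fixes f :: "nat \<Rightarrow> real \<Rightarrow> real"
  assumes "uniform_limit {a..b} f g sequentially" "\<And>n. continuous_on {a..b} (f n)"
  shows "(\<lambda>n. integral {a..b} (f n)) \<longlonglongrightarrow> integral {a..b} g"
proof -
  obtain I J where I: "\<And>n. (f n has_integral I n) {a..b}" "(g has_integral J) {a..b}" "I \<longlonglongrightarrow> J"
    using uniform_limit_integral[OF assms] by auto
  have "I = (\<lambda>n. integral {a..b} (f n))" "J = integral {a..b} g"
    using integral_unique[OF I(1)] integral_unique[OF I(2)] by auto
  then show ?thesis using I(3) by simp
qed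

context weight
begin

lemma nrm_triangle_diff:
  assumes u: "u \<in> L2 r" and v: "v \<in> L2 r"
  shows "nrm r (\<lambda>x. u x - v x) \<le> nrm r u + nrm r v"
  using nrm_triangle[OF u L2_scale[OF v, of "-1"]] nrm_scale[OF v, of "-1"] by simp

lemma nrm_uniform_limit:
  assumes u: "uniform_limit {0..1} F f sequentially" and F: "\<And>k. continuous_on {0..1} (F k)"
    and f: "continuous_on {0..1} f"
  shows "(\<lambda>k. nrm r (\<lambda>x. F k x - f x)) \<longlonglongrightarrow> 0"
proof (rule tendstoI)
  fix e :: real assume e: "0 < e"
  define N1 where "N1 = nrm r (\<lambda>_. 1)"
  have N1: "0 \<le> N1" by (simp add: N1_def nrm_nonneg)
  define d where "d = e / (N1 + 1)"
  have d: "0 < d" "d * N1 < e" using e N1 by (auto simp: d_def field_simps)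
  show "\<forall>\<^sub>F k in sequentially. dist (nrm r (\<lambda>x. F k x - f x)) 0 < e"
    using uniform_limitD[OF u d(1)]
  proof eventually_elim
    case (elim k)
    have "nrm r (\<lambda>x. F k x - f x) \<le> d * N1" unfolding N1_def
      by (rule nrm_le_sup)
         (use elim d in \<open>auto simp: dist_real_def intro: less_imp_le intro!: L2_cont continuous_on_diff f F\<close>)
    then show ?case using d(2) nrm_nonneg[of "\<lambda>x. F k x - f x"] by simp
  qed
qed

lemma set_integrable_mult_cont:
  fixes f g :: "real \<Rightarrow> real"
  assumes g: "continuous_on {0..1} g" and f: "set_integrable lebesgue {0..1} f"
  shows "set_integrable lebesgue {0..1} (\<lambda>x. g x * f x)"
proof -
  obtain B where B0: "0 < B" and B: "\<And>x. x \<in> {0..1} \<Longrightarrow> \<bar>g x\<bar> \<le> B"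
    using continuous_interval_bound[OF g] by blast
  have gm: "(\<lambda>x. indicator {0..1} x * g x) \<in> borel_measurable lebesgue"
    using cont_set_integrable[OF g] by (simp add: set_integrable_def borel_measurable_integrable)
  have fm: "(\<lambda>x. indicator {0..1} x * f x) \<in> borel_measurable lebesgue"
    using f by (simp add: set_integrable_def borel_measurable_integrable)
  show ?thesis
  proof (rule set_integrable_bound)
    show "set_integrable lebesgue {0..1} (\<lambda>x. B * f x)" using f by simp
    have "(\<lambda>x. (indicator {0..1} x * g x) * (indicator {0..1} x * f x)) \<in> borel_measurable lebesgue"
      by (rule borel_measurable_times[OF gm fm])
    then show "set_borel_measurable lebesgue {0..1} (\<lambda>x. g x * f x)"
      unfolding set_borel_measurable_def
      by (rule back_subst[where P = "\<lambda>f. f \<in> borel_measurable lebesgue"]) (auto simp: indicator_def)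
    have "\<bar>g x * f x\<bar> \<le> \<bar>B * f x\<bar>" if "x \<in> {0..1}" for x
      using B[OF that] B0 by (simp add: abs_mult mult_right_mono)
    then show "AE x in lebesgue. x \<in> {0..1} \<longrightarrow> norm (g x * f x) \<le> norm (B * f x)" by simp
  qed
qed

lemma L2_of_unweighted:
  assumes "f \<in> L2 (\<lambda>_. 1)" shows "f \<in> L2 r"
  using assms set_integrable_mult_cont[OF r_cont, of "\<lambda>x. (f x)\<^sup>2"] by (simp add: L2_def)

lemma L2_mult_cont:
  fixes f g :: "real \<Rightarrow> real"
  assumes g: "continuous_on {0..1} g" and f: "f \<in> L2 r"
  shows "(\<lambda>x. g x * f x) \<in> L2 r"
proof -
  have gm: "(\<lambda>x. indicator {0..1} x * g x) \<in> borel_measurable lebesgue"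
    using cont_set_integrable[OF g] by (simp add: set_integrable_def borel_measurable_integrable)
  have "(\<lambda>x. (indicator {0..1} x * g x) * (indicator {0..1} x * f x)) \<in> borel_measurable lebesgue"
    by (rule borel_measurable_times[OF gm L2_measurable[OF f]])
  then have 1: "set_borel_measurable lebesgue {0..1} (\<lambda>x. g x * f x)"
    unfolding set_borel_measurable_def
    by (rule back_subst[where P = "\<lambda>f. f \<in> borel_measurable lebesgue"]) (auto simp: indicator_def)
  have "set_integrable lebesgue {0..1} (\<lambda>x. (g x)\<^sup>2 * (r x * (f x)\<^sup>2))"
    by (rule set_integrable_mult_cont) (use f in \<open>auto simp: L2_def intro!: continuous_intros g\<close>)
  then show ?thesis using 1 by (simp add: L2_def power_mult_distrib mult_ac)
qed

lemma unweighted_integrable: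
  assumes f: "f \<in> L2 r" shows "set_integrable lebesgue {0..1} f"
proof -
  have ri: "continuous_on {0..1} (\<lambda>x. inverse (r x))"
    by (intro continuous_intros r_cont) (use r_pos in force)
  have "set_integrable lebesgue {0..1} (\<lambda>x. inverse (r x) * (r x * 1 * f x))"
    by (intro set_integrable_mult_cont[OF ri] ip_integrable f L2_cont continuous_intros)
  moreover have "(\<lambda>x. indicator {0..1} x *\<^sub>R (inverse (r x) * (r x * 1 * f x)))
      = (\<lambda>x. indicator {0..1} x *\<^sub>R f x)"
  proof
    fix x
    show "indicator {0..1} x *\<^sub>R (inverse (r x) * (r x * 1 * f x)) = indicator {0..1} x *\<^sub>R f x"
      using r_pos[of x] by (cases "x \<in> {0..1}") auto
  qed
  ultimately show ?thesis unfolding set_integrable_def by metis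
qed

end

lemma boundary_det:
  fixes a1 :: real
  assumes "a1\<^sup>2 + a2\<^sup>2 = 1" "a1 * u + a2 * u' = 0" "a1 * v + a2 * v' = 0"
  shows "u * v' = u' * v"
proof -
  have "a1 * (u * v' - u' * v) = 0" "a2 * (u * v' - u' * v) = 0"
    using assms(2,3) by algebra+
  then show ?thesis using assms(1) by auto
qed

locale sturm_liouville = weight r for r +
  fixes p q :: "real \<Rightarrow> real" and a1 a2 b1 b2 :: real
    and lam :: "nat \<Rightarrow> real" and phi :: "nat \<Rightarrow> real \<Rightarrow> real"
  assumes p_C1: "p \<in> C1_01" and p_pos: "\<And>x. x \<in> {0..1} \<Longrightarrow> p x > 0"
    and q_cont: "continuous_on {0..1} q"
    and bc_nz: "a1\<^sup>2 + a2\<^sup>2 = 1" "b1\<^sup>2 + b2\<^sup>2 = 1"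
    and eigen: "SL_eigensystem p r q a1 a2 b1 b2 lam phi"
begin

abbreviation A :: "(real \<Rightarrow> real) \<Rightarrow> real \<Rightarrow> real" where "A \<equiv> SL_op p r q"
abbreviation D :: "(real \<Rightarrow> real) set" where "D \<equiv> SL_dom a1 a2 b1 b2"

sublocale onb r phi
  by unfold_locales (use eigen in \<open>simp add: SL_eigensystem_def\<close>)

lemma phi_C2: "n \<ge> 1 \<Longrightarrow> phi n \<in> C2_01"
  and phi_D: "n \<ge> 1 \<Longrightarrow> phi n \<in> D"
  and phi_eig: "n \<ge> 1 \<Longrightarrow> x \<in> {0..1} \<Longrightarrow> A (phi n) x = lam n * phi n x"
  using eigen by (auto simp: SL_eigensystem_def)

lemma phi_cont: "n \<ge> 1 \<Longrightarrow> continuous_on {0..1} (phi n)"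
  using phi_C2 C2_01D(1) C1_01_continuous by blast

lemma lam_mono: "1 \<le> n \<Longrightarrow> n \<le> m \<Longrightarrow> lam n \<le> lam m"
  using eigen unfolding SL_eigensystem_def strict_mono_on_def
  by (metis atLeast_iff dual_order.trans le_less)

definition flux :: "(real \<Rightarrow> real) \<Rightarrow> real \<Rightarrow> real" where "flux f x = p x * deriv01 f x"

lemma flux_C1: "f \<in> C2_01 \<Longrightarrow> flux f \<in> C1_01"
  unfolding flux_def[abs_def] by (intro C1_01_mult p_C1 C2_01D)

lemma flux_deriv:
  assumes "x \<in> {0..1}" shows "deriv01 (flux f) x = q x * f x - r x * A f x"
  using r_pos[OF assms] by (simp add: SL_op_def flux_def[abs_def] field_simps)

lemma A_eq: "x \<in> {0..1} \<Longrightarrow> A f x = (q x * f x - deriv01 (flux f) x) / r x"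
  using r_pos[of x] by (simp add: flux_deriv)

lemma A_cont: 
  assumes "f \<in> C2_01" shows "continuous_on {0..1} (A f)"
proof -
  have "continuous_on {0..1} (\<lambda>x. (q x * f x - deriv01 (flux f) x) / r x)"
    by (intro continuous_intros q_cont r_cont C1_01_continuous[OF C2_01D(1)[OF assms]]
        C1_01_deriv_continuous[OF flux_C1[OF assms]]) (use r_pos in force)
  moreover have "continuous_on {0..1} (A f) \<longleftrightarrow>
      continuous_on {0..1} (\<lambda>x. (q x * f x - deriv01 (flux f) x) / r x)"
    by (rule continuous_on_cong[OF refl A_eq])
  ultimately show ?thesis by blast
qed

lemma A_lincomb:
  assumes f: "f \<in> C2_01" and g: "g \<in> C2_01" and x: "x \<in> {0..1}"
  shows "A (\<lambda>x. a * f x + b * g x) x = a * A f x + b * A g x"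
proof -
  have "flux (\<lambda>x. a * f x + b * g x) y = a * flux f y + b * flux g y" if "y \<in> {0..1}" for y
    unfolding flux_def using C1_01_lincomb(2)[OF C2_01D(1)[OF f] C2_01D(1)[OF g] that]
    by (simp add: algebra_simps)
  then have "deriv01 (flux (\<lambda>x. a * f x + b * g x)) x = deriv01 (\<lambda>x. a * flux f x + b * flux g x) x"
    by (rule deriv01_cong[OF _ x])
  also have "\<dots> = a * deriv01 (flux f) x + b * deriv01 (flux g) x"
    by (rule C1_01_lincomb(2)[OF flux_C1[OF f] flux_C1[OF g] x])
  finally show ?thesis using x r_pos[OF x] by (simp add: A_eq field_simps)
qed

lemma A_sum:
  assumes "finite I" "\<And>i. i \<in> I \<Longrightarrow> f i \<in> C2_01" and x: "x \<in> {0..1}"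
  shows "A (\<lambda>x. \<Sum>i\<in>I. a i * f i x) x = (\<Sum>i\<in>I. a i * A (f i) x)"
  using assms(1,2)
proof (induction I rule: finite_induct)
  case (insert i I)
  then show ?case
    using A_lincomb[of "f i" "\<lambda>x. \<Sum>i\<in>I. a i * f i x" x "a i" 1, OF _ C2_01_sum x] by simp
next
  case empty
  show ?case using A_lincomb[OF zero_C2_01 zero_C2_01 x, of 0 0] by simp
qed

lemma eigenfunction_sum:
  shows "(\<lambda>x. \<Sum>n=1..k. c n * phi n x) \<in> C2_01"
    and "x \<in> {0..1} \<Longrightarrow> A (\<lambda>x. \<Sum>n=1..k. c n * phi n x) x = (\<Sum>n=1..k. lam n * c n * phi n x)"
    and "x \<in> {0..1} \<Longrightarrow> deriv01 (\<lambda>x. \<Sum>n=1..k. c n * phi n x) x = (\<Sum>n=1..k. c n * deriv01 (phi n) x)"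
proof -
  show "(\<lambda>x. \<Sum>n=1..k. c n * phi n x) \<in> C2_01" by (intro C2_01_sum phi_C2) auto
  show "x \<in> {0..1} \<Longrightarrow> A (\<lambda>x. \<Sum>n=1..k. c n * phi n x) x = (\<Sum>n=1..k. lam n * c n * phi n x)"
    by (subst A_sum) (auto intro!: phi_C2 sum.cong simp: phi_eig)
  show "x \<in> {0..1} \<Longrightarrow> deriv01 (\<lambda>x. \<Sum>n=1..k. c n * phi n x) x = (\<Sum>n=1..k. c n * deriv01 (phi n) x)"
    by (intro deriv01_sum C2_01D phi_C2) auto
qed

subsection \<open>The operator on its domain\<close>

lemma D_D: "f \<in> D \<Longrightarrow> f \<in> C1_01" "f \<in> D \<Longrightarrow> continuous_on {0..1} f" "f \<in> D \<Longrightarrow> f \<in> L2 r"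
  by (auto simp: SL_dom_def dest!: H2_01D(1) intro: C1_01_continuous L2_cont)

text \<open>The function \<open>f\<close> is twice differentiable almost everywhere only, and elsewhere the value of \<open>A f\<close> has no
  meaning. The left-hand side, unlike \<open>A f\<close>, is visibly in \<open>L\<^sub>r\<^sup>2\<close>.\<close>

lemma A_AE:
  assumes "f \<in> H2_01"
  shows "AE x in lebesgue. x \<in> {0..1} \<longrightarrow>
    (q x * f x - (p x * deriv01 (deriv01 f) x + deriv01 p x * deriv01 f x)) / r x = A f x"
proof -
  have "AE x in lebesgue. x \<in> {0..1} \<longrightarrow> deriv01 f differentiable (at x within {0..1})"
    by (rule H2_01D(3)[OF assms])
  then show ?thesis
  proof eventually_elim
    case (elim x)
    show ?case
    proof
      assume x: "x \<in> {0..1}"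
      then obtain d where d: "(deriv01 f has_real_derivative d) (at x within {0..1})"
        using elim unfolding real_differentiable_def by blast
      have "(flux f has_real_derivative p x * d + deriv01 p x * deriv01 f x) (at x within {0..1})"
        unfolding flux_def[abs_def] using d C1_01_deriv[OF p_C1 x] by (auto intro!: derivative_eq_intros)
      then have "deriv01 (flux f) x = p x * deriv01 (deriv01 f) x + deriv01 p x * deriv01 f x"
        using deriv01_eqI[OF _ x] d by metis
      then show "(q x * f x - (p x * deriv01 (deriv01 f) x + deriv01 p x * deriv01 f x)) / r x = A f x"
        using A_eq[OF x] by simp
    qed
  qed
qed

lemma A_L2_aux:
  assumes "f \<in> H2_01"
  shows "(\<lambda>x. (q x * f x - (p x * deriv01 (deriv01 f) x + deriv01 p x * deriv01 f x)) / r x) \<in> L2 r"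
proof -
  have f: "f \<in> C1_01" "deriv01 (deriv01 f) \<in> L2 r"
    using H2_01D[OF assms] L2_of_unweighted by auto
  have ri: "continuous_on {0..1} (\<lambda>x. inverse (r x))"
    by (intro continuous_intros r_cont) (use r_pos in force)
  have "(\<lambda>x. inverse (r x) * (q x * f x - (p x * deriv01 (deriv01 f) x + deriv01 p x * deriv01 f x))) \<in> L2 r"
    by (intro L2_mult_cont[OF ri] L2_diff L2_add)
       (intro L2_mult_cont q_cont L2_cont C1_01_continuous C1_01_deriv_continuous f p_C1)+
  then show ?thesis by (simp add: divide_inverse mult.commute)
qed

lemma A_L2: "f \<in> H2_01 \<Longrightarrow> A f \<in> L2 r"
  using L2_cong_AE[OF A_L2_aux A_AE] .

text \<open>Two integrations by parts; the boundary terms cancel because two functions that satisfy the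
  same homogeneous boundary conditions have a vanishing Wronskian at the end points.\<close>

lemma A_coeff:
  assumes f: "f \<in> D" and n: "n \<ge> 1"
  shows "ip r (phi n) (A f) = lam n * ip r (phi n) f"
proof -
  let ?h = "deriv01 (deriv01 f)" and ?I = "set_lebesgue_integral lebesgue {0..1::real}"
  let ?G = "\<lambda>x. phi n x * p x" and ?H = "flux (phi n)"
  have H2: "f \<in> H2_01" and f1: "f \<in> C1_01" using f H2_01D(1) by (auto simp: SL_dom_def)
  have hL2: "?h \<in> L2 r" using H2_01D(2)[OF H2] L2_of_unweighted by auto
  have h: "set_integrable lebesgue {0..1} ?h" using unweighted_integrable[OF hL2] .
  have ph: "phi n \<in> C1_01" using phi_C2[OF n] C2_01D by blast
  have G: "?G \<in> C1_01" by (intro C1_01_mult ph p_C1)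
  have H: "?H \<in> C1_01" by (rule flux_C1[OF phi_C2[OF n]])
  note cont = C1_01_continuous C1_01_deriv_continuous
  have "ip r (phi n) (A f) = ip r (phi n) (\<lambda>x. (q x * f x - (p x * ?h x + deriv01 p x * deriv01 f x)) / r x)"
    using ip_cong_AE[OF phi_L2[OF n] A_L2_aux[OF H2] A_AE[OF H2]] by simp
  also have "\<dots> = ?I (\<lambda>x. (phi n x * q x * f x - phi n x * deriv01 p x * deriv01 f x) - ?h x * ?G x)"
    unfolding ip_def
  proof (rule set_lebesgue_integral_cong)
    show "\<forall>x. x \<in> {0..1} \<longrightarrow> r x * phi n x * ((q x * f x - (p x * ?h x + deriv01 p x * deriv01 f x)) / r x)
      = (phi n x * q x * f x - phi n x * deriv01 p x * deriv01 f x) - ?h x * ?G x"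
    proof (intro allI impI)
      fix x :: real assume "x \<in> {0..1}"
      then have "r x \<noteq> 0" using r_pos by force
      then show "r x * phi n x * ((q x * f x - (p x * ?h x + deriv01 p x * deriv01 f x)) / r x)
      = (phi n x * q x * f x - phi n x * deriv01 p x * deriv01 f x) - ?h x * ?G x"
        by (simp add: field_simps)
    qed
  qed simp
  also have "\<dots> = ?I (\<lambda>x. phi n x * q x * f x - phi n x * deriv01 p x * deriv01 f x) - ?I (\<lambda>x. ?h x * ?G x)"
  proof (rule set_integral_diff(2))
    show "set_integrable lebesgue {0..1} (\<lambda>x. phi n x * q x * f x - phi n x * deriv01 p x * deriv01 f x)"
      by (intro cont_set_integrable continuous_intros cont ph q_cont p_C1 f1)
    show "set_integrable lebesgue {0..1} (\<lambda>x. ?h x * ?G x)"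
      using set_integrable_mult_cont[OF C1_01_continuous[OF G] h] by (simp add: mult.commute)
  qed
  also have "?I (\<lambda>x. ?h x * ?G x) = deriv01 f 1 * ?G 1 - deriv01 f 0 * ?G 0 - ?I (\<lambda>x. deriv01 f x * deriv01 ?G x)"
  proof (rule integration_by_parts_L1[OF h G])
    show "\<And>x. x \<in> {0..1} \<Longrightarrow> deriv01 f x = deriv01 f 0 + set_lebesgue_integral lebesgue {0..x} ?h"
      by (rule H2_01D(4)[OF H2])
    show "set_integrable lebesgue {0..1} (\<lambda>x. deriv01 f x * deriv01 ?G x)"
      by (intro cont_set_integrable continuous_intros cont f1 G)
  qed
  also have "?I (\<lambda>x. deriv01 f x * deriv01 ?G x)
      = ?I (\<lambda>x. phi n x * deriv01 p x * deriv01 f x + deriv01 f x * ?H x)"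
    by (rule set_lebesgue_integral_cong, simp, intro allI impI, subst C1_01_mult(2)[OF ph p_C1])
       (simp_all add: flux_def distrib_left mult_ac)
  also have "\<dots> = ?I (\<lambda>x. phi n x * deriv01 p x * deriv01 f x) + ?I (\<lambda>x. deriv01 f x * ?H x)"
    by (rule set_integral_add(2)) (intro cont_set_integrable continuous_intros cont ph p_C1 f1 H)+
  also have "?I (\<lambda>x. phi n x * q x * f x - phi n x * deriv01 p x * deriv01 f x)
     = ?I (\<lambda>x. phi n x * q x * f x) - ?I (\<lambda>x. phi n x * deriv01 p x * deriv01 f x)"
    by (rule set_integral_diff(2)) (intro cont_set_integrable continuous_intros cont ph p_C1 f1 q_cont)+
  also have "?I (\<lambda>x. deriv01 f x * ?H x) = f 1 * ?H 1 - f 0 * ?H 0 - ?I (\<lambda>x. f x * deriv01 ?H x)"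
  proof -
    have "?I (deriv01 (\<lambda>x. f x * ?H x)) = f 1 * ?H 1 - f 0 * ?H 0"
      by (rule FTC_01_eq[OF C1_01_mult(1)[OF f1 H]]) auto
    moreover have "?I (deriv01 (\<lambda>x. f x * ?H x)) = ?I (\<lambda>x. f x * deriv01 ?H x + deriv01 f x * ?H x)"
      by (rule set_lebesgue_integral_cong) (auto simp: C1_01_mult(2)[OF f1 H])
    moreover have "\<dots> = ?I (\<lambda>x. f x * deriv01 ?H x) + ?I (\<lambda>x. deriv01 f x * ?H x)"
      by (rule set_integral_add(2)) (intro cont_set_integrable continuous_intros cont f1 H)+
    ultimately show ?thesis by simp
  qed
  also have "?I (\<lambda>x. f x * deriv01 ?H x) = ?I (\<lambda>x. phi n x * q x * f x - lam n * (r x * phi n x * f x))"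
    by (rule set_lebesgue_integral_cong) (auto simp: flux_deriv phi_eig[OF n] algebra_simps)
  also have "\<dots> = ?I (\<lambda>x. phi n x * q x * f x) - ?I (\<lambda>x. lam n * (r x * phi n x * f x))"
    by (rule set_integral_diff(2)) (intro cont_set_integrable continuous_intros cont ph q_cont r_cont f1)+
  also have "?I (\<lambda>x. lam n * (r x * phi n x * f x)) = lam n * ip r (phi n) f"
    by (simp add: ip_def)
  finally have main: "ip r (phi n) (A f) = lam n * ip r (phi n) f
     + p 1 * (f 1 * deriv01 (phi n) 1 - deriv01 f 1 * phi n 1)
     - p 0 * (f 0 * deriv01 (phi n) 0 - deriv01 f 0 * phi n 0)"
    by (simp add: flux_def algebra_simps)
  have "f 1 * deriv01 (phi n) 1 = deriv01 f 1 * phi n 1"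
    by (rule boundary_det[OF bc_nz(1)]) (use f phi_D[OF n] in \<open>auto simp: SL_dom_def\<close>)
  moreover have "f 0 * deriv01 (phi n) 0 = deriv01 f 0 * phi n 0"
    by (rule boundary_det[OF bc_nz(2)]) (use f phi_D[OF n] in \<open>auto simp: SL_dom_def\<close>)
  ultimately show ?thesis using main by simp
qed

subsection \<open>An a priori bound and closedness\<close>

lemma flux_diff:
  assumes f: "f \<in> C2_01" and "0 \<le> a" "a \<le> b" "b \<le> 1"
  shows "flux f b - flux f a = integral {a..b} (\<lambda>x. r x * (q x / r x * f x - A f x))"
proof -
  have "flux f b - flux f a = integral {a..b} (deriv01 (flux f))"
    using FTC_01[OF flux_C1[OF f] assms(2-4)] by (simp add: integral_unique)
  also have "\<dots> = integral {a..b} (\<lambda>x. r x * (q x / r x * f x - A f x))"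
  proof (rule Henstock_Kurzweil_Integration.integral_cong)
    fix x assume "x \<in> {a..b}"
    then have x: "x \<in> {0..1}" using assms by auto
    then show "deriv01 (flux f) x = r x * (q x / r x * f x - A f x)"
      using r_pos[OF x] by (simp add: flux_deriv field_simps)
  qed
  finally show ?thesis .
qed

text \<open>The mean value theorem provides a point where \<open>\<bar>f'\<bar> \<le> 2 sup \<bar>f\<bar>\<close>. From there the flux \<open>p f'\<close> changes by
  at most the integral of \<open>q f - r A f\<close>, which \<open>sup \<bar>f\<bar>\<close> and the \<open>L\<^sub>r\<^sup>2\<close>-norm of \<open>A f\<close> control.\<close>

lemma deriv_bound:
  obtains C where "0 < C" "\<And>f e x. f \<in> C2_01 \<Longrightarrow> (\<And>x. x \<in> {0..1} \<Longrightarrow> \<bar>f x\<bar> \<le> e) \<Longrightarrow> x \<in> {0..1} \<Longrightarrow>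
    \<bar>deriv01 f x\<bar> \<le> C * (e + nrm r (A f))"
proof -
  obtain P where P: "0 < P" "\<And>x. x \<in> {0..1} \<Longrightarrow> \<bar>p x\<bar> \<le> P"
    using continuous_interval_bound[OF C1_01_continuous[OF p_C1]] by metis
  obtain P' where P': "0 < P'" "\<And>x. x \<in> {0..1} \<Longrightarrow> \<bar>inverse (p x)\<bar> \<le> P'"
    using continuous_interval_bound[OF C1_01_continuous[OF C1_01_inverse[OF p_C1 p_pos]]] by metis
  have qr: "continuous_on {0..1} (\<lambda>x. q x / r x)"
    by (intro continuous_intros q_cont r_cont) (use r_pos in force)
  obtain Q where Q: "0 < Q" "\<And>x. x \<in> {0..1} \<Longrightarrow> \<bar>q x / r x\<bar> \<le> Q"
    using continuous_interval_bound[OF qr] by metis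
  define N1 where "N1 = nrm r (\<lambda>_. 1)"
  have N1: "0 \<le> N1" by (simp add: N1_def nrm_nonneg)
  define C where "C = P' * (2 * P + N1 * Q * N1 + N1)"
  have "\<bar>deriv01 f x\<bar> \<le> C * (e + nrm r (A f))"
    if f: "f \<in> C2_01" and e: "\<And>x. x \<in> {0..1} \<Longrightarrow> \<bar>f x\<bar> \<le> e" and x: "x \<in> {0..1}" for f e x
  proof -
    have e0: "0 \<le> e" using e[of 0] by simp
    have f1: "f \<in> C1_01" using f C2_01D by blast
    let ?g = "\<lambda>x. q x / r x * f x - A f x"
    have gc: "continuous_on {0..1} ?g"
      by (intro continuous_on_diff A_cont f continuous_on_mult[OF qr] C1_01_continuous f1)
    have qf: "(\<lambda>x. q x / r x * f x) \<in> L2 r"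
      by (intro L2_mult_cont[OF qr] L2_cont C1_01_continuous f1)
    have Af: "A f \<in> L2 r" by (intro L2_cont A_cont f)
    have "nrm r ?g \<le> nrm r (\<lambda>x. q x / r x * f x) + nrm r (A f)"
      by (rule nrm_triangle_diff[OF qf Af])
    also have "nrm r (\<lambda>x. q x / r x * f x) \<le> Q * e * N1"
      unfolding N1_def
      by (rule nrm_le_sup[OF qf]) (use Q e e0 in \<open>auto simp del: abs_divide times_divide_eq_left intro!: mult_mono
          simp: abs_mult[of "q x / r x" for x]\<close>)
    finally have g: "nrm r ?g \<le> Q * e * N1 + nrm r (A f)" by simp
    have osc: "\<bar>flux f b - flux f a\<bar> \<le> N1 * (Q * e * N1 + nrm r (A f))"
      if "0 \<le> a" "a \<le> b" "b \<le> 1" for a b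
      using flux_diff[OF f that] integral_le_nrm[OF gc that] mult_left_mono[OF g N1] by (simp add: N1_def)
    have "\<exists>\<xi>\<in>{0<..<1}. f 1 - f 0 = deriv01 f \<xi> * (1 - 0)"
      by (rule mvt_simple) (use C1_01_deriv[OF f1] in \<open>auto simp: has_field_derivative_def\<close>)
    then obtain \<xi> where "\<xi> \<in> {0<..<1}" "f 1 - f 0 = deriv01 f \<xi> * (1 - 0)" ..
    then have xi: "\<xi> \<in> {0..1}" "deriv01 f \<xi> = f 1 - f 0" by simp_all
    have "\<bar>flux f \<xi>\<bar> = \<bar>p \<xi>\<bar> * \<bar>f 1 - f 0\<bar>" by (simp add: flux_def xi abs_mult)
    also have "\<dots> \<le> P * (2 * e)"
      using P(2)[OF xi(1)] P(1) e[of 0] e[of 1] by (intro mult_mono) auto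
    finally have "\<bar>flux f x\<bar> \<le> 2 * P * e + N1 * (Q * e * N1 + nrm r (A f))"
      using osc[of \<xi> x] osc[of x \<xi>] xi x by (cases "\<xi> \<le> x") auto
    also have "\<dots> \<le> (2 * P + N1 * Q * N1 + N1) * (e + nrm r (A f))"
      using P(1) Q(1) N1 e0 nrm_nonneg[of "A f"] by (simp add: algebra_simps)
    finally have fl: "\<bar>flux f x\<bar> \<le> (2 * P + N1 * Q * N1 + N1) * (e + nrm r (A f))" .
    have "\<bar>deriv01 f x\<bar> = \<bar>inverse (p x)\<bar> * \<bar>flux f x\<bar>"
      using p_pos[OF x] by (simp add: flux_def abs_mult)
    also have "\<dots> \<le> P' * ((2 * P + N1 * Q * N1 + N1) * (e + nrm r (A f)))"
      by (intro mult_mono P' x fl) (use P' in auto)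
    finally show ?thesis by (simp add: C_def mult.assoc)
  qed
  moreover have "0 < C" unfolding C_def using P P' Q N1 by (intro mult_pos_pos add_pos_nonneg) auto
  ultimately show thesis using that by blast
qed

text \<open>By \<open>deriv_bound\<close> the derivatives are uniformly Cauchy. The limit is identified by passing to the
  limit in the integrated identity \<open>p F\<^sub>k' = p(0) F\<^sub>k'(0) + \<integral> (q F\<^sub>k - r A F\<^sub>k)\<close>, for which convergence of
  \<open>A F\<^sub>k\<close> in \<open>L\<^sub>r\<^sup>2\<close> is enough; continuity of \<open>g\<close> then makes the limit twice continuously
  differentiable.\<close>

lemma A_closed:
  assumes F: "\<And>k. F k \<in> C2_01" and u: "uniform_limit {0..1} F f sequentially"
    and g: "continuous_on {0..1} g" and n: "(\<lambda>k. nrm r (\<lambda>x. A (F k) x - g x)) \<longlonglongrightarrow> 0"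
  shows "f \<in> C2_01" and "\<And>x. x \<in> {0..1} \<Longrightarrow> A f x = g x"
    and "\<And>x. x \<in> {0..1} \<Longrightarrow> (\<lambda>k. deriv01 (F k) x) \<longlonglongrightarrow> deriv01 f x"
proof -
  have F1: "F k \<in> C1_01" for k using F C2_01D by blast
  have AF: "A (F k) \<in> L2 r" for k by (intro L2_cont A_cont F)
  have gL: "g \<in> L2 r" by (intro L2_cont g)
  obtain C where C: "0 < C" "\<And>f e x. f \<in> C2_01 \<Longrightarrow> (\<And>x. x \<in> {0..1} \<Longrightarrow> \<bar>f x\<bar> \<le> e) \<Longrightarrow> x \<in> {0..1} \<Longrightarrow>
    \<bar>deriv01 f x\<bar> \<le> C * (e + nrm r (A f))" using deriv_bound by metis
  have "uniformly_convergent_on {0..1} (\<lambda>k. deriv01 (F k))"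
  proof (rule Cauchy_uniformly_convergent, rule uniformly_Cauchy_onI)
    fix \<epsilon> :: real assume "0 < \<epsilon>"
    define d where "d = \<epsilon> / (8 * C)"
    have d: "0 < d" using \<open>0 < \<epsilon>\<close> C by (simp add: d_def)
    have "\<forall>\<^sub>F k in sequentially. (\<forall>x\<in>{0..1}. dist (F k x) (f x) < d) \<and> nrm r (\<lambda>x. A (F k) x - g x) < d"
      using uniform_limitD[OF u d] order_tendstoD(2)[OF n d] by eventually_elim auto
    then obtain M where M: "\<And>k. k \<ge> M \<Longrightarrow> (\<forall>x\<in>{0..1}. dist (F k x) (f x) < d)"
      "\<And>k. k \<ge> M \<Longrightarrow> nrm r (\<lambda>x. A (F k) x - g x) < d"
      by (auto simp: eventually_sequentially)
    show "\<exists>M. \<forall>x\<in>{0..1}. \<forall>m\<ge>M. \<forall>n\<ge>M. dist (deriv01 (F m) x) (deriv01 (F n) x) < \<epsilon>"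
    proof (intro exI ballI allI impI)
      fix x :: real and k l assume x: "x \<in> {0..1}" and kl: "k \<ge> M" "l \<ge> M"
      let ?h = "\<lambda>x. 1 * F k x + (-1) * F l x"
      have h: "?h \<in> C2_01" by (rule C2_01_lincomb[OF F F])
      have b: "\<bar>?h y\<bar> \<le> 2 * d" if "y \<in> {0..1}" for y
        using M(1)[OF kl(1)] M(1)[OF kl(2)] that unfolding dist_real_def by force
      have "nrm r (A ?h) = nrm r (\<lambda>x. (A (F k) x - g x) - (A (F l) x - g x))"
        by (rule nrm_cong, subst A_lincomb[OF F F]) simp_all
      also have "\<dots> \<le> nrm r (\<lambda>x. A (F k) x - g x) + nrm r (\<lambda>x. A (F l) x - g x)"
        by (intro nrm_triangle_diff L2_diff AF gL)
      finally have nb: "nrm r (A ?h) \<le> 2 * d" using M(2)[OF kl(1)] M(2)[OF kl(2)] by simp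
      have "\<bar>deriv01 ?h x\<bar> \<le> C * (2 * d + nrm r (A ?h))" by (rule C(2)[OF h b x])
      also have "\<dots> \<le> C * (2 * d + 2 * d)" using nb C by (intro mult_left_mono) auto
      also have "\<dots> < \<epsilon>" using C \<open>0 < \<epsilon>\<close> by (simp add: d_def)
      finally show "dist (deriv01 (F k) x) (deriv01 (F l) x) < \<epsilon>"
        unfolding C1_01_lincomb(2)[OF F1 F1 x] by (simp add: dist_real_def)
    qed
  qed
  then obtain W where W: "uniform_limit {0..1} (\<lambda>k. deriv01 (F k)) W sequentially"
    by (auto simp: uniformly_convergent_on_def)
  have Wc: "continuous_on {0..1} W"
    by (rule uniform_limit_theorem[OF _ W]) (auto intro!: always_eventually C1_01_deriv_continuous F1)
  have pw: "(\<lambda>k. F k x) \<longlonglongrightarrow> f x" if "x \<in> {0..1}" for x using tendsto_uniform_limitI[OF u that] .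
  have pW: "(\<lambda>k. deriv01 (F k) x) \<longlonglongrightarrow> W x" if "x \<in> {0..1}" for x using tendsto_uniform_limitI[OF W that] .
  have fc: "continuous_on {0..1} f"
    by (rule uniform_limit_theorem[OF _ u]) (auto intro!: always_eventually C1_01_continuous F1)
  have fint: "f x = f 0 + integral {0..x} W" if x: "x \<in> {0..1}" for x
  proof -
    have sub: "{0..x} \<subseteq> {0..1}" using x by auto
    have "(\<lambda>k. integral {0..x} (deriv01 (F k))) \<longlonglongrightarrow> integral {0..x} W"
      by (rule uniform_limit_integral_tendsto[OF uniform_limit_on_subset[OF W sub]])
         (rule continuous_on_subset[OF C1_01_deriv_continuous[OF F1] sub])
    moreover have "integral {0..x} (deriv01 (F k)) = F k x - F k 0" for k
      using FTC_01[OF F1, of 0 x] x by (simp add: integral_unique)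
    moreover have "(\<lambda>k. F k x - F k 0) \<longlonglongrightarrow> f x - f 0" using pw x by (intro tendsto_diff) auto
    ultimately show ?thesis using LIMSEQ_unique by fastforce
  qed
  have f1: "f \<in> C1_01" and fd: "deriv01 f x = W x" if "x \<in> {0..1}" for x
    using C1_01_from_integral[OF Wc fint] that by auto
  then show dl: "(\<lambda>k. deriv01 (F k) x) \<longlonglongrightarrow> deriv01 f x" if "x \<in> {0..1}" for x
    using pW[OF that] that by simp
  have f1: "f \<in> C1_01" using C1_01_from_integral[OF Wc fint] by auto
  have rg: "continuous_on {0..1} (\<lambda>x. q x * f x - r x * g x)"
    by (intro continuous_intros q_cont r_cont g fc)
  have qr: "continuous_on {0..1} (\<lambda>x. q x / r x)"
    by (intro continuous_intros q_cont r_cont) (use r_pos in force)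
  obtain Q where Q: "0 < Q" "\<And>x. x \<in> {0..1} \<Longrightarrow> \<bar>q x / r x\<bar> \<le> Q"
    using continuous_interval_bound[OF qr] by metis
  define N1 where "N1 = nrm r (\<lambda>_. 1)"
  define G where "G k x = q x / r x * (F k x - f x) - (A (F k) x - g x)" for k x
  have Gc: "continuous_on {0..1} (G k)" for k unfolding G_def[abs_def]
    by (intro continuous_on_diff continuous_on_mult[OF qr] C1_01_continuous F1 fc g A_cont F)
  have nG: "(\<lambda>k. nrm r (G k)) \<longlonglongrightarrow> 0"
  proof (rule Lim_null_comparison)
    have "nrm r (G k) \<le> Q * nrm r (\<lambda>x. F k x - f x) + nrm r (\<lambda>x. A (F k) x - g x)" for k
    proof -
      have L: "(\<lambda>x. F k x - f x) \<in> L2 r" by (intro L2_cont continuous_on_diff C1_01_continuous F1 fc)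
      have "nrm r (G k) \<le> nrm r (\<lambda>x. q x / r x * (F k x - f x)) + nrm r (\<lambda>x. A (F k) x - g x)"
        unfolding G_def[abs_def] by (intro nrm_triangle_diff L2_mult_cont[OF qr L] L2_diff AF gL)
      also have "nrm r (\<lambda>x. q x / r x * (F k x - f x)) \<le> Q * nrm r (\<lambda>x. F k x - f x)"
        by (rule nrm_mult_le[OF L L2_mult_cont[OF qr L] Q(2)]) (use Q(1) in auto)
      finally show ?thesis by simp
    qed
    then show "\<forall>\<^sub>F k in sequentially. norm (nrm r (G k))
        \<le> Q * nrm r (\<lambda>x. F k x - f x) + nrm r (\<lambda>x. A (F k) x - g x)"
      using nrm_nonneg by simp
    have "(\<lambda>k. nrm r (\<lambda>x. F k x - f x)) \<longlonglongrightarrow> 0"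
      by (intro nrm_uniform_limit u C1_01_continuous F1 fc)
    then show "(\<lambda>k. Q * nrm r (\<lambda>x. F k x - f x) + nrm r (\<lambda>x. A (F k) x - g x)) \<longlonglongrightarrow> 0"
      using tendsto_add[OF tendsto_mult_right_zero[of _ _ Q] n] by simp
  qed
  have flint: "flux f x = flux f 0 + integral {0..x} (\<lambda>x. q x * f x - r x * g x)" if x: "x \<in> {0..1}" for x
  proof -
    have sub: "{0..x} \<subseteq> {0..1}" using x by auto
    have "(\<lambda>k. integral {0..x} (\<lambda>x. r x * G k x)) \<longlonglongrightarrow> 0"
    proof (rule Lim_null_comparison)
      show "\<forall>\<^sub>F k in sequentially. norm (integral {0..x} (\<lambda>x. r x * G k x)) \<le> N1 * nrm r (G k)"
        using integral_le_nrm[OF Gc, of 0 x] x by (auto simp: N1_def)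
      show "(\<lambda>k. N1 * nrm r (G k)) \<longlonglongrightarrow> 0" using tendsto_mult_right_zero[OF nG] by simp
    qed
    moreover have "integral {0..x} (\<lambda>x. r x * G k x)
       = flux (F k) x - flux (F k) 0 - integral {0..x} (\<lambda>x. q x * f x - r x * g x)" for k
    proof -
      have c1: "continuous_on {0..1} (\<lambda>x. r x * (q x / r x * F k x - A (F k) x))"
        by (intro continuous_on_mult[OF r_cont] continuous_on_diff A_cont F continuous_on_mult[OF qr]
            C1_01_continuous F1)
      have "integral {0..x} (\<lambda>x. r x * (q x / r x * F k x - A (F k) x))
            - integral {0..x} (\<lambda>x. q x * f x - r x * g x)
          = integral {0..x} (\<lambda>x. r x * (q x / r x * F k x - A (F k) x) - (q x * f x - r x * g x))"
        by (rule Henstock_Kurzweil_Integration.integral_diff[symmetric])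
           (intro integrable_continuous_real continuous_on_subset[OF c1 sub] continuous_on_subset[OF rg sub])+
      also have "\<dots> = integral {0..x} (\<lambda>x. r x * G k x)"
      proof (rule Henstock_Kurzweil_Integration.integral_cong)
        fix y assume "y \<in> {0..x}"
        then have "r y > 0" using sub r_pos by blast
        then show "r y * (q y / r y * F k y - A (F k) y) - (q y * f y - r y * g y) = r y * G k y"
          by (simp add: G_def field_simps)
      qed
      finally show ?thesis using flux_diff[OF F, of 0 x k] x by simp
    qed
    moreover have "(\<lambda>k. flux (F k) x - flux (F k) 0 - integral {0..x} (\<lambda>x. q x * f x - r x * g x))
        \<longlonglongrightarrow> flux f x - flux f 0 - integral {0..x} (\<lambda>x. q x * f x - r x * g x)"
      unfolding flux_def using x by (intro tendsto_intros dl) auto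
    ultimately show ?thesis using LIMSEQ_unique by fastforce
  qed
  have fl1: "flux f \<in> C1_01" and fld: "\<And>x. x \<in> {0..1} \<Longrightarrow> deriv01 (flux f) x = q x * f x - r x * g x"
    using C1_01_from_integral[OF rg flint] by auto
  have "deriv01 f \<in> C1_01"
    by (rule C1_01_cong[OF _ C1_01_mult(1)[OF C1_01_inverse[OF p_C1 p_pos] fl1]])
       (use p_pos in \<open>force simp: flux_def\<close>)+
  then show "f \<in> C2_01" using f1 by (simp add: C2_01_def)
  show "A f x = g x" if "x \<in> {0..1}" for x
    using r_pos[OF that] by (simp add: A_eq[OF that] fld[OF that])
qed

end

section \<open>The Lyapunov inequality\<close>

lemma abs_le_sum_of_prod_bound:
  fixes z X Y :: real
  assumes "z\<^sup>2 \<le> 4 * X * Y" "0 \<le> X" "0 \<le> Y"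
  shows "\<bar>z\<bar> \<le> X + Y"
proof (rule power2_le_imp_le)
  have "(X + Y)\<^sup>2 - 4 * X * Y = (X - Y)\<^sup>2" by (simp add: power2_eq_square algebra_simps)
  then show "\<bar>z\<bar>\<^sup>2 \<le> (X + Y)\<^sup>2" using assms(1) zero_le_power2[of "X - Y"]
    unfolding power2_abs by linarith
qed (use assms in auto)

context onb
begin

abbreviation cf :: "nat \<Rightarrow> (real \<Rightarrow> real) \<Rightarrow> real" where "cf n w \<equiv> ip r (phi n) w"

lemma Pop_L2: "Pop r phi N w \<in> L2 r"
  unfolding Pop_def[abs_def] by (intro L2_sum phi_L2) auto

lemma cf_Pop: "m \<ge> 1 \<Longrightarrow> cf m (Pop r phi N w) = (if m \<le> N then cf m w else 0)"
  unfolding Pop_def[abs_def] by (rule coeff_sum)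

lemma ip_Pop_left: "z \<in> L2 r \<Longrightarrow> ip r (Pop r phi N w) z = (\<Sum>n=1..N. cf n w * cf n z)"
  unfolding Pop_def[abs_def] by (subst ip_left(4)) (auto intro: phi_L2)

lemma ip_tail:
  assumes w: "w \<in> L2 r" and z: "z \<in> L2 r"
  shows "ip r (\<lambda>x. w x - Pop r phi N w x) z = ip r w z - (\<Sum>n=1..N. cf n w * cf n z)"
    and "ip r (\<lambda>x. w x - Pop r phi N w x) (\<lambda>x. z x - Pop r phi N z x)
       = ip r w z - (\<Sum>n=1..N. cf n w * cf n z)"
proof -
  have 1: "ip r (\<lambda>x. w x - Pop r phi N w x) z = ip r w z - (\<Sum>n=1..N. cf n w * cf n z)"
    if "z \<in> L2 r" for z
    using ip_left(2)[OF that w Pop_L2] ip_Pop_left[OF that] by simp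
  show "ip r (\<lambda>x. w x - Pop r phi N w x) z = ip r w z - (\<Sum>n=1..N. cf n w * cf n z)"
    by (rule 1[OF z])
  have "ip r (\<lambda>x. w x - Pop r phi N w x) (Pop r phi N z) = 0"
    unfolding 1[OF Pop_L2] ip_commute[of w] ip_Pop_left[OF w]
    by (simp add: cf_Pop mult.commute)
  then show "ip r (\<lambda>x. w x - Pop r phi N w x) (\<lambda>x. z x - Pop r phi N z x)
       = ip r w z - (\<Sum>n=1..N. cf n w * cf n z)"
    using ip_diff[OF L2_diff[OF w Pop_L2] z Pop_L2] 1[OF z] by simp
qed

lemma nrm_tail_sq: "w \<in> L2 r \<Longrightarrow>
   (nrm r (\<lambda>x. w x - Pop r phi N w x))\<^sup>2 = (nrm r w)\<^sup>2 - (\<Sum>n=1..N. (cf n w)\<^sup>2)"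
  unfolding nrm_sq using ip_tail(2) by (simp add: power2_eq_square)

lemma Bessel: "w \<in> L2 r \<Longrightarrow> (\<Sum>n=1..N. (cf n w)\<^sup>2) \<le> (nrm r w)\<^sup>2"
  using nrm_tail_sq[of w N] zero_le_power2 by (metis diff_ge_0_iff_ge)

lemma tail_product_bound:
  assumes w: "w \<in> L2 r" and z: "z \<in> L2 r"
  shows "(ip r w z - (\<Sum>n=1..N. cf n w * cf n z))\<^sup>2
    \<le> ((nrm r w)\<^sup>2 - (\<Sum>n=1..N. (cf n w)\<^sup>2)) * ((nrm r z)\<^sup>2 - (\<Sum>n=1..N. (cf n z)\<^sup>2))"
proof -
  have "\<bar>ip r w z - (\<Sum>n=1..N. cf n w * cf n z)\<bar>
     \<le> nrm r (\<lambda>x. w x - Pop r phi N w x) * nrm r (\<lambda>x. z x - Pop r phi N z x)"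
    unfolding ip_tail(2)[OF w z, symmetric] by (intro Cauchy_Schwarz L2_diff Pop_L2 w z)
  then have "\<bar>ip r w z - (\<Sum>n=1..N. cf n w * cf n z)\<bar>\<^sup>2
     \<le> (nrm r (\<lambda>x. w x - Pop r phi N w x) * nrm r (\<lambda>x. z x - Pop r phi N z x))\<^sup>2"
    by (rule power_mono) simp
  then show ?thesis by (simp add: power_mult_distrib nrm_tail_sq w z)
qed

lemma ip_Gop:
  assumes z: "z \<in> L2 r"
  shows "ip r (Gop r phi N R w) z = (\<Sum>n=1..N. \<Sum>m=1..N. R n m * cf n w * cf m z)"
proof -
  have 1: "Gop r phi N R w = (\<lambda>x. \<Sum>n=1..N. cf n w * (\<Sum>m=1..N. R n m * phi m x))"
    unfolding Gop_def[abs_def] by (auto simp: sum_distrib_left mult_ac)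
  have "ip r (Gop r phi N R w) z = (\<Sum>n=1..N. cf n w * ip r (\<lambda>x. \<Sum>m=1..N. R n m * phi m x) z)"
    unfolding 1 by (rule ip_left(4)) (auto intro!: L2_sum phi_L2 z)
  also have "\<dots> = (\<Sum>n=1..N. cf n w * (\<Sum>m=1..N. R n m * cf m z))"
    by (intro sum.cong refl arg_cong2[where f = "(*)"] ip_left(4)) (auto intro: phi_L2 z)
  finally show ?thesis by (simp add: sum_distrib_left mult_ac)
qed

text \<open>The bilinear form whose diagonal is twice the part of \<open>V\<close> that depends on \<open>w\<close>.\<close>

definition Vform :: "nat \<Rightarrow> rmat \<Rightarrow> real \<Rightarrow> (real \<Rightarrow> real) \<Rightarrow> (real \<Rightarrow> real) \<Rightarrow> real" where
  "Vform N R \<gamma> w z = (\<Sum>n=1..N. \<Sum>m=1..N. R n m * cf n w * cf m z)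
     + \<gamma> * (ip r w z - (\<Sum>n=1..N. cf n w * cf n z))"

lemma Vfun_eq:
  fixes j :: nat
  shows "w \<in> L2 r \<Longrightarrow> Vfun r phi N R \<gamma> j \<omega> w y = 1/2 * Vform N R \<gamma> w w + 1/2 * (\<Sum>i=1..j. \<omega> i * (y i)\<^sup>2)"
  unfolding Vfun_def Vform_def by (simp add: ip_Gop nrm_sq ip_tail(2) algebra_simps)

text \<open>In \<open>Vdot\<close> both arguments of the second inner product are projected onto the modes beyond \<open>N\<close>;
  projecting one of them is enough, so the right-hand side \<open>z\<close> of the differential equation may be
  inserted into \<open>Vform\<close> as it stands.\<close>

lemma Vdot_eq:
  fixes j :: nat
  assumes w: "w \<in> L2 r" and Aw: "SL_op p r q w \<in> L2 r" and v: "\<And>i. i \<in> {1..j} \<Longrightarrow> vphi i \<in> L2 r"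
  shows "Vdot p r q phi vphi N R \<gamma> j \<omega> \<mu> w y v =
     Vform N R \<gamma> w (\<lambda>x. - SL_op p r q w x - (\<Sum>i=1..j. v i * vphi i x))
     + (\<Sum>i=1..j. \<omega> i * y i * (v i - \<mu> i * y i))"
proof -
  define z where "z x = - SL_op p r q w x - (\<Sum>i=1..j. v i * vphi i x)" for x
  define A0 where "A0 = SL_op p r q w"
  have A0: "A0 \<in> L2 r" using Aw by (simp add: A0_def)
  have A1: "(\<lambda>x. - 1 * A0 x) \<in> L2 r" by (rule L2_scale[OF A0])
  have vL: "(\<lambda>x. \<Sum>i=1..j. v i * vphi i x) \<in> L2 r" by (intro L2_sum v) auto
  have z: "z \<in> L2 r" unfolding z_def[abs_def] using L2_diff[OF A1 vL] by (simp add: A0_def)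
  have cz: "cf n z = - cf n A0 - (\<Sum>i=1..j. v i * cf n (vphi i))" if "n \<ge> 1" for n
  proof -
    have "cf n z = cf n (\<lambda>x. -1 * A0 x) - cf n (\<lambda>x. \<Sum>i=1..j. v i * vphi i x)"
      unfolding z_def[abs_def] A0_def[symmetric] using ip_diff[OF phi_L2[OF that] A1 vL] by simp
    also have "cf n (\<lambda>x. -1 * A0 x) = - cf n A0" using ip_scale[OF phi_L2[OF that] A0, of "-1"] by simp
    also have "cf n (\<lambda>x. \<Sum>i=1..j. v i * vphi i x) = (\<Sum>i=1..j. v i * cf n (vphi i))"
      by (rule ip_sum) (auto intro: v phi_L2 that)
    finally show ?thesis .
  qed
  have "- A0 x + Pop r phi N A0 x - (\<Sum>i=1..j. v i * vphi i x) + (\<Sum>i=1..j. v i * Pop r phi N (vphi i) x)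
     = z x - Pop r phi N z x" for x
  proof -
    have "Pop r phi N z x = (\<Sum>n=1..N. (- cf n A0 - (\<Sum>i=1..j. v i * cf n (vphi i))) * phi n x)"
      unfolding Pop_def by (rule sum.cong) (auto simp: cz)
    also have "\<dots> = - Pop r phi N A0 x - (\<Sum>n=1..N. \<Sum>i=1..j. v i * (cf n (vphi i) * phi n x))"
      unfolding Pop_def
      by (simp add: left_diff_distrib right_diff_distrib sum_subtractf sum_negf
          sum_distrib_right sum_distrib_left mult_ac)
    also have "(\<Sum>n=1..N. \<Sum>i=1..j. v i * (cf n (vphi i) * phi n x)) = (\<Sum>i=1..j. v i * Pop r phi N (vphi i) x)"
      unfolding Pop_def sum_distrib_left by (rule sum.swap)
    finally show ?thesis unfolding z_def[of x] A0_def by simp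
  qed
  then have "ip r (\<lambda>x. w x - Pop r phi N w x) (\<lambda>x. - A0 x + Pop r phi N A0 x
        - (\<Sum>i=1..j. v i * vphi i x) + (\<Sum>i=1..j. v i * Pop r phi N (vphi i) x))
      = ip r w z - (\<Sum>n=1..N. cf n w * cf n z)"
    using ip_tail(2)[OF w z, of N] by simp
  then show ?thesis
    unfolding Vdot_def A0_def[symmetric]
    using ip_Gop[OF z, of N R w]
    by (simp add: Vform_def z_def[abs_def] A0_def sum_subtractf right_diff_distrib power2_eq_square mult_ac)
qed

end

context sturm_liouville
begin

text \<open>By Parseval's identity the right-hand side is the sum of \<open>\<lambda>\<^sub>n c\<^sub>n\<^sup>2\<close> over \<open>n > N\<close>. Each \<open>\<lambda>\<^sub>n\<close> is at least
  \<open>\<lambda>\<^sub>N\<^sub>+\<^sub>1\<close>, and for \<open>n > M\<close> it exceeds this value by at least the gap.\<close>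

lemma tail_energy:
  assumes w: "w \<in> D" and NM: "N \<le> M"
  shows "lam (N + 1) * ((nrm r w)\<^sup>2 - (\<Sum>n=1..N. (cf n w)\<^sup>2))
     + (lam (M + 1) - lam (N + 1)) * ((nrm r w)\<^sup>2 - (\<Sum>n=1..M. (cf n w)\<^sup>2))
     \<le> ip r w (A w) - (\<Sum>n=1..N. cf n w * cf n (A w))"
proof -
  have wL: "w \<in> L2 r" by (rule D_D(3)[OF w])
  have AL: "A w \<in> L2 r" using w by (auto simp: SL_dom_def intro: A_L2)
  let ?u = "\<lambda>k. cf (N + 1 + k) w * cf (N + 1 + k) w"
  let ?X = "(ip r w (A w) - (\<Sum>n=1..N. cf n w * cf n (A w))) - lam (N + 1) * (ip r w w - (\<Sum>n=1..N. cf n w * cf n w))"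
  have 1: "?u sums (ip r w w - (\<Sum>n=1..N. cf n w * cf n w))" by (rule Parseval_tail[OF wL wL])
  have "(\<lambda>k. cf (N + 1 + k) w * cf (N + 1 + k) (A w)) sums (ip r w (A w) - (\<Sum>n=1..N. cf n w * cf n (A w)))"
    by (rule Parseval_tail[OF wL AL])
  then have 2: "(\<lambda>k. cf (N + 1 + k) w * cf (N + 1 + k) (A w) - lam (N + 1) * ?u k) sums ?X"
    by (intro sums_diff sums_mult 1)
  have e: "cf (N + 1 + k) w * cf (N + 1 + k) (A w) - lam (N + 1) * ?u k = (lam (N + 1 + k) - lam (N + 1)) * ?u k" for k
    by (simp add: A_coeff[OF w] algebra_simps)
  let ?g = "\<lambda>k. (lam (N + 1 + k) - lam (N + 1)) * ?u k"
  have 3: "?g sums ?X" using 2 unfolding e .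
  have 4: "(\<lambda>k. ?g (k + (M - N))) sums (?X - (\<Sum>k<M - N. ?g k))"
    by (rule sums_split_initial_segment[OF 3])
  have g0: "0 \<le> ?g k" for k using lam_mono[of "N + 1" "N + 1 + k"] by (simp add: mult_nonneg_nonneg)
  have 5: "(\<lambda>k. (lam (M + 1) - lam (N + 1)) * (cf (M + 1 + k) w * cf (M + 1 + k) w))
      sums ((lam (M + 1) - lam (N + 1)) * (ip r w w - (\<Sum>n=1..M. cf n w * cf n w)))"
    by (intro sums_mult Parseval_tail wL)
  have "(lam (M + 1) - lam (N + 1)) * (ip r w w - (\<Sum>n=1..M. cf n w * cf n w)) \<le> ?X - (\<Sum>k<M - N. ?g k)"
  proof (rule sums_le[OF _ 5 4])
    fix k
    have idx: "N + 1 + (k + (M - N)) = M + 1 + k" using NM by simp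
    show "(lam (M + 1) - lam (N + 1)) * (cf (M + 1 + k) w * cf (M + 1 + k) w) \<le> ?g (k + (M - N))"
      unfolding idx by (intro mult_right_mono) (use lam_mono[of "M + 1" "M + 1 + k"] in auto)
  qed
  moreover have "0 \<le> (\<Sum>k<M - N. ?g k)" by (intro sum_nonneg g0)
  ultimately show ?thesis unfolding nrm_sq power2_eq_square[of "cf _ _"] by linarith
qed

end

lemma qform_lyapunov:
  assumes R: "\<And>n m. n \<in> {1..N} \<Longrightarrow> m \<in> {1..N} \<Longrightarrow> R n m = R m n"
  shows "qform N (\<lambda>n m. mmul N R S n m + mmul N (mtransp S) R n m) \<xi>
    = 2 * (\<Sum>n=1..N. \<Sum>k=1..N. R n k * \<xi> n * (\<Sum>m=1..N. S k m * \<xi> m))"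
proof -
  let ?X = "\<Sum>n=1..N. \<Sum>m=1..N. \<Sum>k=1..N. \<xi> n * R n k * S k m * \<xi> m"
  have a: "(\<Sum>n=1..N. \<Sum>m=1..N. \<Sum>k=1..N. \<xi> n * S k n * R k m * \<xi> m) = ?X"
  proof -
    have "(\<Sum>n=1..N. \<Sum>m=1..N. \<Sum>k=1..N. \<xi> n * S k n * R k m * \<xi> m)
       = (\<Sum>m=1..N. \<Sum>n=1..N. \<Sum>k=1..N. \<xi> n * S k n * R k m * \<xi> m)" by (rule sum.swap)
    also have "\<dots> = ?X" by (intro sum.cong refl) (auto simp: R mult_ac)
    finally show ?thesis .
  qed
  have b: "(\<Sum>n=1..N. \<Sum>k=1..N. R n k * \<xi> n * (\<Sum>m=1..N. S k m * \<xi> m)) = ?X"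
  proof (rule sum.cong[OF refl])
    fix n
    have "(\<Sum>k=1..N. R n k * \<xi> n * (\<Sum>m=1..N. S k m * \<xi> m))
       = (\<Sum>k=1..N. \<Sum>m=1..N. \<xi> n * R n k * S k m * \<xi> m)"
      by (simp add: sum_distrib_left mult_ac)
    also have "\<dots> = (\<Sum>m=1..N. \<Sum>k=1..N. \<xi> n * R n k * S k m * \<xi> m)" by (rule sum.swap)
    finally show "(\<Sum>k=1..N. R n k * \<xi> n * (\<Sum>m=1..N. S k m * \<xi> m))
       = (\<Sum>m=1..N. \<Sum>k=1..N. \<xi> n * R n k * S k m * \<xi> m)" .
  qed
  have "qform N (\<lambda>n m. mmul N R S n m + mmul N (mtransp S) R n m) \<xi>
     = ?X + (\<Sum>n=1..N. \<Sum>m=1..N. \<Sum>k=1..N. \<xi> n * S k n * R k m * \<xi> m)"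
    unfolding qform_def mmul_def mtransp_def
    by (simp add: sum.distrib[symmetric] sum_distrib_left sum_distrib_right distrib_left distrib_right mult_ac)
  then show ?thesis unfolding a b by simp
qed

lemma qform_scaled_identity:
  "qform N (\<lambda>n m. a * (if n = m then 1 else 0)) \<xi> = a * (\<Sum>n=1..N. (\<xi> n)\<^sup>2)"
proof -
  have "(\<Sum>m=1..N. \<xi> n * (a * (if n = m then 1 else 0)) * \<xi> m) = a * (\<xi> n)\<^sup>2" if "n \<in> {1..N}" for n
  proof -
    have "(\<Sum>m=1..N. \<xi> n * (a * (if n = m then 1 else 0)) * \<xi> m) = (\<Sum>m=1..N. if m = n then a * (\<xi> n)\<^sup>2 else 0)"
      by (intro sum.cong) (auto simp: power2_eq_square)
    then show ?thesis using that by simp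
  qed
  then show ?thesis unfolding qform_def by (simp add: sum_distrib_left)
qed

locale lyapunov_setting = sturm_liouville r p q a1 a2 b1 b2 lam phi
  for r p q a1 a2 b1 b2 lam phi +
  fixes N j :: nat and \<mu> :: "nat \<Rightarrow> real" and vphi :: "nat \<Rightarrow> real \<Rightarrow> real"
    and K R :: "nat \<Rightarrow> nat \<Rightarrow> real" and \<sigma> \<gamma> :: real and \<omega> :: "nat \<Rightarrow> real"
  assumes lamN: "lam (N + 1) > 0" and j1: "j \<ge> 1"
    and mu_pos: "\<And>i. i \<in> {1..j} \<Longrightarrow> \<mu> i > 0"
    and vphi_C2: "\<And>i. i \<in> {1..j} \<Longrightarrow> vphi i \<in> C2_01"
    and sig: "\<sigma> > 0" and R_spd: "sym_pos_def N R"
    and LMI: "loewner_le N (\<lambda>n m. mmul N R (closed_loop_mat r lam phi vphi j K) n m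
               + mmul N (mtransp (closed_loop_mat r lam phi vphi j K)) R n m)
               (\<lambda>n m. - 2 * \<sigma> * (if n = m then 1 else 0))"
    and om_pos: "\<And>i. i \<in> {1..j} \<Longrightarrow> \<omega> i > 0" and gam: "\<gamma> > 0"
    and small1: "\<And>i. i \<in> {1..j} \<Longrightarrow> \<sigma> * \<mu> i \<ge> 2 * real j * \<omega> i * (L2_set (K i) {1..N})\<^sup>2"
    and small2: "\<sigma> * lam (N + 1)
          \<ge> 2 * real j * \<gamma> * (\<Sum>i=1..j. (nrm r (vphi i))\<^sup>2 * (L2_set (K i) {1..N})\<^sup>2)"
begin

abbreviation V :: "(real \<Rightarrow> real) \<Rightarrow> (nat \<Rightarrow> real) \<Rightarrow> real"
  where "V \<equiv> Vfun r phi N R \<gamma> j \<omega>"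
abbreviation VD :: "(real \<Rightarrow> real) \<Rightarrow> (nat \<Rightarrow> real) \<Rightarrow> (nat \<Rightarrow> real) \<Rightarrow> real"
  where "VD \<equiv> Vdot p r q phi vphi N R \<gamma> j \<omega> \<mu>"
abbreviation fb :: "(nat \<Rightarrow> real) \<Rightarrow> nat \<Rightarrow> (real \<Rightarrow> real) \<Rightarrow> (nat \<Rightarrow> real) \<Rightarrow> nat \<Rightarrow> real"
  where "fb \<equiv> feedback r phi vphi N R K \<gamma> \<omega>"

lemma R_sym: "n \<in> {1..N} \<Longrightarrow> m \<in> {1..N} \<Longrightarrow> R n m = R m n"
  using R_spd by (auto simp: sym_pos_def_def)

lemma vphi_cont: "i \<in> {1..j} \<Longrightarrow> continuous_on {0..1} (vphi i)"
  using vphi_C2 C2_01D C1_01_continuous by blast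

lemma vphi_L2: "i \<in> {1..j} \<Longrightarrow> vphi i \<in> L2 r"
  using vphi_cont L2_cont by blast

text \<open>The quantity multiplying \<open>L\<^sub>i\<close> in the feedback law. Its negative is the coefficient of \<open>v\<^sub>i\<close> in
  \<open>Vdot\<close>, except that the modes beyond \<open>M\<close> are left out.\<close>

definition gain :: "nat \<Rightarrow> (real \<Rightarrow> real) \<Rightarrow> (nat \<Rightarrow> real) \<Rightarrow> nat \<Rightarrow> real" where
  "gain M w y i = (\<Sum>n=1..N. \<Sum>m=1..N. R n m * cf n w * cf m (vphi i))
     + \<gamma> * (\<Sum>n=N+1..M. cf n (vphi i) * cf n w) - \<omega> i * y i"

lemma feedback_eq:
  assumes w: "w \<in> L2 r" and i: "i \<in> {1..j}"
  shows "fb L M w y i = (\<Sum>n=1..N. K i n * cf n w) + L i * gain M w y i"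
proof -
  have b: "ip r (\<lambda>z. \<Sum>m=1..N. R n m * phi m z) (vphi i) = (\<Sum>m=1..N. R n m * cf m (vphi i))" for n
    by (rule ip_left(4)) (auto intro: phi_L2 vphi_L2 i)
  have k: "kfun r phi vphi N R K \<gamma> L M i = (\<lambda>x.
     (\<Sum>n=1..N. (K i n + L i * (\<Sum>m=1..N. R n m * cf m (vphi i))) * phi n x)
     + (\<gamma> * L i) * (\<Sum>n=N+1..M. cf n (vphi i) * phi n x))"
    unfolding kfun_def[abs_def] b by (simp add: mult.assoc)
  have 1: "(\<lambda>x. \<Sum>n=1..N. (K i n + L i * (\<Sum>m=1..N. R n m * cf m (vphi i))) * phi n x) \<in> L2 r"
    and 2: "(\<lambda>x. \<Sum>n=N+1..M. cf n (vphi i) * phi n x) \<in> L2 r"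
    by (intro L2_sum phi_L2; auto)+
  have "ip r (kfun r phi vphi N R K \<gamma> L M i) w
     = (\<Sum>n=1..N. (K i n + L i * (\<Sum>m=1..N. R n m * cf m (vphi i))) * cf n w)
       + (\<gamma> * L i) * (\<Sum>n=N+1..M. cf n (vphi i) * cf n w)"
    unfolding k ip_left(1)[OF w 1 L2_scale[OF 2]] ip_left(3)[OF w 2]
    by (intro arg_cong2[where f = "(+)"] arg_cong2[where f = "(*)"] refl ip_left(4))
       (auto intro!: phi_L2 w)
  then show ?thesis
    by (simp add: feedback_def gain_def distrib_right sum.distrib sum_distrib_left algebra_simps)
qed

text \<open>The matrix inequality, read as a statement on the first \<open>N\<close> modes driven by the inputs
  \<open>K\<^sub>i\<^sup>T \<xi>\<close> alone.\<close>

lemma LMI_form: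
  "(\<Sum>n=1..N. \<Sum>k=1..N. R n k * \<xi> n * (- lam k * \<xi> k - (\<Sum>i=1..j. (\<Sum>m=1..N. K i m * \<xi> m) * cf k (vphi i))))
     \<le> - \<sigma> * (\<Sum>n=1..N. (\<xi> n)\<^sup>2)"
proof -
  let ?S = "closed_loop_mat r lam phi vphi j K"
  have S: "(\<Sum>m=1..N. ?S k m * \<xi> m) = - lam k * \<xi> k - (\<Sum>i=1..j. (\<Sum>m=1..N. K i m * \<xi> m) * cf k (vphi i))"
    if "k \<in> {1..N}" for k
  proof -
    have "(\<Sum>m=1..N. ?S k m * \<xi> m)
       = (\<Sum>m=1..N. Cmat lam k m * \<xi> m) + (\<Sum>m=1..N. \<Sum>i=1..j. Bvec r phi vphi i k * K i m * \<xi> m)"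
      by (simp add: closed_loop_mat_def distrib_right sum.distrib sum_distrib_right)
    also have "(\<Sum>m=1..N. Cmat lam k m * \<xi> m) = (\<Sum>m=1..N. if m = k then - lam k * \<xi> k else 0)"
      by (intro sum.cong) (auto simp: Cmat_def)
    also have "\<dots> = - lam k * \<xi> k" using that by simp
    also have "(\<Sum>m=1..N. \<Sum>i=1..j. Bvec r phi vphi i k * K i m * \<xi> m)
       = (\<Sum>i=1..j. \<Sum>m=1..N. Bvec r phi vphi i k * K i m * \<xi> m)" by (rule sum.swap)
    also have "\<dots> = - (\<Sum>i=1..j. (\<Sum>m=1..N. K i m * \<xi> m) * cf k (vphi i))"
      by (simp add: Bvec_def ip_commute[of "vphi _"] sum_negf sum_distrib_left sum_distrib_right mult_ac)
    finally show ?thesis by simp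
  qed
  have "2 * (\<Sum>n=1..N. \<Sum>k=1..N. R n k * \<xi> n * (\<Sum>m=1..N. ?S k m * \<xi> m)) \<le> - 2 * \<sigma> * (\<Sum>n=1..N. (\<xi> n)\<^sup>2)"
    using LMI R_sym unfolding loewner_le_def qform_scaled_identity
    by (subst (asm) qform_lyapunov) auto
  moreover have "(\<Sum>n=1..N. \<Sum>k=1..N. R n k * \<xi> n * (\<Sum>m=1..N. ?S k m * \<xi> m))
     = (\<Sum>n=1..N. \<Sum>k=1..N. R n k * \<xi> n * (- lam k * \<xi> k - (\<Sum>i=1..j. (\<Sum>m=1..N. K i m * \<xi> m) * cf k (vphi i))))"
    by (intro sum.cong refl) (simp only: S)
  ultimately show ?thesis by simp
qed

text \<open>The estimate for one input channel: the cross terms are absorbed by the arithmetic--geometric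
  mean inequality with weights dictated by the two smallness conditions, and the \<open>L\<^sub>i\<close>-term is
  a square up to the contribution of the modes beyond \<open>M\<close>.\<close>

lemma channel_estimate:
  fixes cc e2 F2 K2 \<kappa> \<theta> T s l y om m :: real
  assumes k: "\<kappa>\<^sup>2 \<le> K2 * cc" and th: "\<theta>\<^sup>2 \<le> F2 * e2" and "0 \<le> K2" "0 \<le> cc" "0 \<le> F2" "0 \<le> e2"
    and l: "0 \<le> l" and om: "0 < om" and m: "0 < m" and sm: "\<sigma> * m \<ge> 2 * real j * om * K2"
  shows "- \<gamma> * \<kappa> * \<theta> + om * y * \<kappa> - l * s * (s + \<gamma> * T) - om * m * y\<^sup>2
     \<le> \<sigma> / (2 * real j) * cc + \<gamma>\<^sup>2 * real j / \<sigma> * (F2 * K2) * e2 - 1/2 * (om * m * y\<^sup>2) + \<gamma>\<^sup>2 / 4 * (l * T\<^sup>2)"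
proof -
  have jp: "0 < real j" using j1 by simp
  let ?X = "\<sigma> / (4 * real j) * cc"
  have X: "0 \<le> ?X" using sig jp assms by simp
  have "\<bar>\<gamma> * \<kappa> * \<theta>\<bar> \<le> ?X + \<gamma>\<^sup>2 * real j / \<sigma> * (F2 * K2) * e2"
  proof (rule abs_le_sum_of_prod_bound[OF _ X])
    have "\<kappa>\<^sup>2 * \<theta>\<^sup>2 \<le> (K2 * cc) * (F2 * e2)" by (intro mult_mono k th) (use assms in auto)
    then have "\<gamma>\<^sup>2 * (\<kappa>\<^sup>2 * \<theta>\<^sup>2) \<le> \<gamma>\<^sup>2 * ((K2 * cc) * (F2 * e2))" by (intro mult_left_mono) auto
    then show "(\<gamma> * \<kappa> * \<theta>)\<^sup>2 \<le> 4 * ?X * (\<gamma>\<^sup>2 * real j / \<sigma> * (F2 * K2) * e2)"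
      using sig jp by (simp add: power_mult_distrib mult_ac)
    show "0 \<le> \<gamma>\<^sup>2 * real j / \<sigma> * (F2 * K2) * e2" using sig assms by simp
  qed
  moreover have "\<bar>om * y * \<kappa>\<bar> \<le> ?X + 1/2 * (om * m * y\<^sup>2)"
  proof (rule abs_le_sum_of_prod_bound[OF _ X])
    have "om * (2 * real j * om * K2) * y\<^sup>2 * cc \<le> om * (\<sigma> * m) * y\<^sup>2 * cc"
      using sm om assms by (intro mult_right_mono mult_left_mono) auto
    then have "om\<^sup>2 * y\<^sup>2 * (K2 * cc) \<le> \<sigma> * om * m * y\<^sup>2 * cc / (2 * real j)"
      using jp by (simp add: field_simps power2_eq_square)
    moreover have "om\<^sup>2 * y\<^sup>2 * \<kappa>\<^sup>2 \<le> om\<^sup>2 * y\<^sup>2 * (K2 * cc)" by (intro mult_left_mono k) simp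
    ultimately show "(om * y * \<kappa>)\<^sup>2 \<le> 4 * ?X * (1/2 * (om * m * y\<^sup>2))"
      by (simp add: power_mult_distrib mult_ac)
    show "0 \<le> 1/2 * (om * m * y\<^sup>2)" using om m by simp
  qed
  moreover have "- l * s * (s + \<gamma> * T) \<le> \<gamma>\<^sup>2 / 4 * (l * T\<^sup>2)"
  proof -
    have "0 \<le> l * (s + \<gamma> * T / 2)\<^sup>2" using l by simp
    then show ?thesis by (simp add: power2_eq_square algebra_simps)
  qed
  moreover have "2 * ?X = \<sigma> / (2 * real j) * cc" by simp
  ultimately show ?thesis by linarith
qed

text \<open>The matrix inequality disposes of the first \<open>N\<close> modes, \<open>tail_energy\<close> bounds the dissipation of the
  others, and \<open>channel_estimate\<close> is summed over the inputs. The terms in \<open>\<tau> i\<close>, the modes between \<open>N\<close>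
  and \<open>M\<close>, are part of \<open>s i\<close>, so only the tail \<open>T i\<close> beyond \<open>M\<close> survives next to the square of \<open>s i\<close>; it
  is bounded by the Cauchy--Schwarz inequality and absorbed by the gap condition.\<close>

lemma Vdot_le:
  assumes L: "\<And>i. i \<in> {1..j} \<Longrightarrow> L i \<ge> 0" and NM: "N + 1 \<le> M"
    and gap: "4 * (lam (M + 1) - lam (N + 1)) \<ge> \<gamma> * (\<Sum>i=1..j. L i * (\<Sum>k. (cf (M + 1 + k) (vphi i))\<^sup>2))"
    and w: "w \<in> D"
  shows "VD w y (fb L M w y) \<le> - (1/2) * (\<Sum>i=1..j. \<omega> i * \<mu> i * (y i)\<^sup>2)
               - min (\<gamma> * lam (N + 1)) \<sigma> / 2 * (nrm r w)\<^sup>2"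
proof -
  define v where "v = fb L M w y"
  define z where "z = (\<lambda>x. - A w x - (\<Sum>i=1..j. v i * vphi i x))"
  have wL: "w \<in> L2 r" by (rule D_D(3)[OF w])
  have AL: "A w \<in> L2 r" using w by (auto simp: SL_dom_def intro: A_L2)
  have A1: "(\<lambda>x. - 1 * A w x) \<in> L2 r" by (rule L2_scale[OF AL])
  have vL: "(\<lambda>x. \<Sum>i=1..j. v i * vphi i x) \<in> L2 r" by (intro L2_sum vphi_L2) auto
  have ipz: "ip r u z = - ip r u (A w) - (\<Sum>i=1..j. v i * ip r u (vphi i))" if "u \<in> L2 r" for u
  proof -
    have "ip r u z = ip r u (\<lambda>x. -1 * A w x) - ip r u (\<lambda>x. \<Sum>i=1..j. v i * vphi i x)"
      unfolding z_def using ip_diff[OF that A1 vL] by simp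
    also have "ip r u (\<lambda>x. -1 * A w x) = - ip r u (A w)" using ip_scale[OF that AL, of "-1"] by simp
    also have "ip r u (\<lambda>x. \<Sum>i=1..j. v i * vphi i x) = (\<Sum>i=1..j. v i * ip r u (vphi i))"
      by (rule ip_sum) (auto intro: vphi_L2 that)
    finally show ?thesis .
  qed
  define c where "c n = cf n w" for n
  define d where "d i n = cf n (vphi i)" for i n
  \<comment> \<open>The input is \<open>v i = \<kappa> i + L i * s i\<close>. The state is paired with the \<open>i\<close>-th profile in the first
     \<open>N\<close> modes, through \<open>R\<close>, in \<open>\<beta> i\<close>, in the modes from \<open>N+1\<close> to \<open>M\<close> in \<open>\<tau> i\<close>, in all modes beyond
     \<open>N\<close> in \<open>\<theta> i\<close>, and in those beyond \<open>M\<close> in \<open>T i\<close>.\<close>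
  define \<kappa> where "\<kappa> i = (\<Sum>n=1..N. K i n * c n)" for i
  define s where "s i = gain M w y i" for i
  define \<beta> where "\<beta> i = (\<Sum>n=1..N. \<Sum>m=1..N. R n m * c n * d i m)" for i
  define \<tau> where "\<tau> i = (\<Sum>n=N+1..M. d i n * c n)" for i
  define \<theta> where "\<theta> i = ip r w (vphi i) - (\<Sum>n=1..N. c n * d i n)" for i
  define T where "T i = ip r w (vphi i) - (\<Sum>n=1..M. c n * d i n)" for i
  define cc where "cc = (\<Sum>n=1..N. (c n)\<^sup>2)"
  define e2 where "e2 = (nrm r w)\<^sup>2 - (\<Sum>n=1..N. (c n)\<^sup>2)"
  define f2 where "f2 = (nrm r w)\<^sup>2 - (\<Sum>n=1..M. (c n)\<^sup>2)"
  define E where "E = ip r w (A w) - (\<Sum>n=1..N. c n * cf n (A w))"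
  define F2 where "F2 i = (nrm r (vphi i))\<^sup>2" for i
  define K2 where "K2 i = (L2_set (K i) {1..N})\<^sup>2" for i
  define D2 where "D2 i = (\<Sum>k. (cf (M + 1 + k) (vphi i))\<^sup>2)" for i
  have jp: "0 < real j" using j1 by simp
  have v_eq: "v i = \<kappa> i + L i * s i" if "i \<in> {1..j}" for i
    unfolding v_def feedback_eq[OF wL that] by (simp add: \<kappa>_def s_def c_def)
  have s_eq: "s i = \<beta> i + \<gamma> * \<tau> i - \<omega> i * y i" for i
    by (simp add: s_def gain_def \<beta>_def \<tau>_def c_def d_def)
  have th_eq: "\<theta> i = \<tau> i + T i" for i
  proof -
    have "{1..M} = {1..N} \<union> {N+1..M}" using NM by auto
    then have "(\<Sum>n=1..M. c n * d i n) = (\<Sum>n=1..N. c n * d i n) + (\<Sum>n=N+1..M. c n * d i n)"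
      by (simp add: sum.union_disjoint)
    then show ?thesis by (simp add: \<theta>_def T_def \<tau>_def mult.commute)
  qed
  have nn: "0 \<le> cc" "0 \<le> e2" "0 \<le> f2" "0 \<le> F2 i" "0 \<le> K2 i" for i
    using Bessel[OF wL] by (auto simp: cc_def e2_def f2_def F2_def K2_def c_def sum_nonneg)
  have k_bd: "(\<kappa> i)\<^sup>2 \<le> K2 i * cc" for i
    unfolding \<kappa>_def K2_def cc_def L2_set_def using Cauchy_Schwarz_ineq_sum[of "K i" c "{1..N}"]
    by (simp add: sum_nonneg)
  have th_bd: "(\<theta> i)\<^sup>2 \<le> F2 i * e2" if i: "i \<in> {1..j}" for i
  proof -
    have "(\<theta> i)\<^sup>2 \<le> e2 * ((nrm r (vphi i))\<^sup>2 - (\<Sum>n=1..N. (cf n (vphi i))\<^sup>2))"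
      using tail_product_bound[OF wL vphi_L2[OF i], of N] by (simp add: \<theta>_def e2_def c_def d_def)
    also have "\<dots> \<le> e2 * F2 i" unfolding F2_def by (intro mult_left_mono nn) (simp add: sum_nonneg)
    finally show ?thesis by (simp add: mult.commute)
  qed
  have T_bd: "(T i)\<^sup>2 \<le> D2 i * f2" if i: "i \<in> {1..j}" for i
  proof -
    have "D2 i = (nrm r (vphi i))\<^sup>2 - (\<Sum>n=1..M. (cf n (vphi i))\<^sup>2)"
      unfolding D2_def nrm_sq power2_eq_square[of "cf _ _"]
      by (rule sums_unique[OF Parseval_tail[OF vphi_L2[OF i] vphi_L2[OF i]], symmetric])
    then show ?thesis
      using tail_product_bound[OF wL vphi_L2[OF i], of M] by (simp add: T_def f2_def c_def d_def mult.commute)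
  qed
  have E_bd: "lam (N + 1) * e2 + (lam (M + 1) - lam (N + 1)) * f2 \<le> E"
    using tail_energy[OF w, of N M] NM by (simp add: e2_def f2_def E_def c_def)
  have lmi: "(\<Sum>n=1..N. \<Sum>m=1..N. R n m * c n * (- lam m * c m - (\<Sum>i=1..j. \<kappa> i * d i m))) \<le> - \<sigma> * cc"
    using LMI_form[of c] by (simp add: \<kappa>_def d_def cc_def)
  have cz: "cf m z = (- lam m * c m - (\<Sum>i=1..j. \<kappa> i * d i m)) - (\<Sum>i=1..j. L i * s i * d i m)" if "m \<ge> 1" for m
  proof -
    have "(\<Sum>i=1..j. v i * d i m) = (\<Sum>i=1..j. \<kappa> i * d i m) + (\<Sum>i=1..j. L i * s i * d i m)"
      unfolding sum.distrib[symmetric] by (intro sum.cong) (auto simp: v_eq algebra_simps)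
    then show ?thesis using ipz[OF phi_L2[OF that]] A_coeff[OF w that] by (simp add: c_def d_def)
  qed
  have part1: "(\<Sum>n=1..N. \<Sum>m=1..N. R n m * c n * cf m z)
     = (\<Sum>n=1..N. \<Sum>m=1..N. R n m * c n * (- lam m * c m - (\<Sum>i=1..j. \<kappa> i * d i m)))
       - (\<Sum>i=1..j. L i * s i * \<beta> i)"
  proof -
    have "(\<Sum>n=1..N. \<Sum>m=1..N. R n m * c n * cf m z)
       = (\<Sum>n=1..N. \<Sum>m=1..N. R n m * c n * (- lam m * c m - (\<Sum>i=1..j. \<kappa> i * d i m))
            - R n m * c n * (\<Sum>i=1..j. L i * s i * d i m))"
      by (intro sum.cong refl) (simp add: cz right_diff_distrib)
    also have "\<dots> = (\<Sum>n=1..N. \<Sum>m=1..N. R n m * c n * (- lam m * c m - (\<Sum>i=1..j. \<kappa> i * d i m)))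
       - (\<Sum>n=1..N. \<Sum>m=1..N. R n m * c n * (\<Sum>i=1..j. L i * s i * d i m))"
      by (simp add: sum_subtractf)
    also have "(\<Sum>n=1..N. \<Sum>m=1..N. R n m * c n * (\<Sum>i=1..j. L i * s i * d i m))
       = (\<Sum>n=1..N. \<Sum>m=1..N. \<Sum>i=1..j. L i * s i * (R n m * c n * d i m))"
      by (simp add: sum_distrib_left mult_ac)
    also have "\<dots> = (\<Sum>n=1..N. \<Sum>i=1..j. \<Sum>m=1..N. L i * s i * (R n m * c n * d i m))"
      by (intro sum.cong refl sum.swap)
    also have "\<dots> = (\<Sum>i=1..j. \<Sum>n=1..N. \<Sum>m=1..N. L i * s i * (R n m * c n * d i m))"
      by (rule sum.swap)
    also have "\<dots> = (\<Sum>i=1..j. L i * s i * \<beta> i)" by (simp add: \<beta>_def sum_distrib_left)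
    finally show ?thesis .
  qed
  have part2: "ip r w z - (\<Sum>n=1..N. c n * cf n z) = - E - (\<Sum>i=1..j. v i * \<theta> i)"
  proof -
    have "(\<Sum>n=1..N. c n * cf n z) = (\<Sum>n=1..N. - (c n * cf n (A w)) - (\<Sum>i=1..j. v i * (c n * d i n)))"
    proof (intro sum.cong refl)
      fix n assume "n \<in> {1..N}"
      then have "n \<ge> 1" by simp
      then show "c n * cf n z = - (c n * cf n (A w)) - (\<Sum>i=1..j. v i * (c n * d i n))"
        by (simp add: ipz[OF phi_L2] d_def right_diff_distrib sum_distrib_left mult_ac)
    qed
    also have "\<dots> = - (\<Sum>n=1..N. c n * cf n (A w)) - (\<Sum>n=1..N. \<Sum>i=1..j. v i * (c n * d i n))"
      by (simp add: sum_subtractf sum_negf)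
    also have "(\<Sum>n=1..N. \<Sum>i=1..j. v i * (c n * d i n)) = (\<Sum>i=1..j. v i * (\<Sum>n=1..N. c n * d i n))"
      unfolding sum_distrib_left by (rule sum.swap)
    finally show ?thesis
      unfolding E_def \<theta>_def ipz[OF wL] by (simp add: right_diff_distrib sum_subtractf)
  qed
  have "VD w y v = Vform N R \<gamma> w z + (\<Sum>i=1..j. \<omega> i * y i * (v i - \<mu> i * y i))"
    unfolding z_def by (rule Vdot_eq[OF wL AL vphi_L2])
  also have "Vform N R \<gamma> w z = (\<Sum>n=1..N. \<Sum>m=1..N. R n m * c n * cf m z) + \<gamma> * (ip r w z - (\<Sum>n=1..N. c n * cf n z))"
    by (simp add: Vform_def c_def)
  finally have VD_eq: "VD w y v = (\<Sum>n=1..N. \<Sum>m=1..N. R n m * c n * (- lam m * c m - (\<Sum>i=1..j. \<kappa> i * d i m)))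
      - \<gamma> * E + ((\<Sum>i=1..j. \<omega> i * y i * (v i - \<mu> i * y i)) - (\<Sum>i=1..j. L i * s i * \<beta> i)
          - \<gamma> * (\<Sum>i=1..j. v i * \<theta> i))"
    unfolding part1 part2 by (simp add: algebra_simps)
  have "(\<Sum>i=1..j. \<omega> i * y i * (v i - \<mu> i * y i)) - (\<Sum>i=1..j. L i * s i * \<beta> i) - \<gamma> * (\<Sum>i=1..j. v i * \<theta> i)
      = (\<Sum>i=1..j. - \<gamma> * \<kappa> i * \<theta> i + \<omega> i * y i * \<kappa> i - L i * s i * (s i + \<gamma> * T i) - \<omega> i * \<mu> i * (y i)\<^sup>2)"
    unfolding sum_distrib_left sum_subtractf[symmetric]
  proof (intro sum.cong refl)
    fix i assume i: "i \<in> {1..j}"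
    have be: "\<beta> i = s i - \<gamma> * \<tau> i + \<omega> i * y i" using s_eq[of i] by simp
    show "\<omega> i * y i * (v i - \<mu> i * y i) - L i * s i * \<beta> i - \<gamma> * (v i * \<theta> i)
       = - \<gamma> * \<kappa> i * \<theta> i + \<omega> i * y i * \<kappa> i - L i * s i * (s i + \<gamma> * T i) - \<omega> i * \<mu> i * (y i)\<^sup>2"
      unfolding v_eq[OF i] be th_eq by (simp add: power2_eq_square algebra_simps)
  qed
  also have "\<dots> \<le> (\<Sum>i=1..j. \<sigma> / (2 * real j) * cc + \<gamma>\<^sup>2 * real j / \<sigma> * (F2 i * K2 i) * e2
      - 1/2 * (\<omega> i * \<mu> i * (y i)\<^sup>2) + \<gamma>\<^sup>2 / 4 * (L i * (T i)\<^sup>2))"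
    by (intro sum_mono channel_estimate k_bd th_bd nn L om_pos mu_pos small1[folded K2_def]) auto
  also have "\<dots> = \<sigma> / 2 * cc + \<gamma>\<^sup>2 * real j / \<sigma> * (\<Sum>i=1..j. F2 i * K2 i) * e2
      - 1/2 * (\<Sum>i=1..j. \<omega> i * \<mu> i * (y i)\<^sup>2) + \<gamma>\<^sup>2 / 4 * (\<Sum>i=1..j. L i * (T i)\<^sup>2)"
    using jp by (simp add: sum.distrib sum_subtractf sum_distrib_left sum_distrib_right)
  finally have channels: "(\<Sum>i=1..j. \<omega> i * y i * (v i - \<mu> i * y i)) - (\<Sum>i=1..j. L i * s i * \<beta> i)
        - \<gamma> * (\<Sum>i=1..j. v i * \<theta> i)
      \<le> \<sigma> / 2 * cc + \<gamma>\<^sup>2 * real j / \<sigma> * (\<Sum>i=1..j. F2 i * K2 i) * e2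
      - 1/2 * (\<Sum>i=1..j. \<omega> i * \<mu> i * (y i)\<^sup>2) + \<gamma>\<^sup>2 / 4 * (\<Sum>i=1..j. L i * (T i)\<^sup>2)" .
  have main: "VD w y v \<le> - \<sigma> * cc - \<gamma> * E + (\<sigma> / 2 * cc + \<gamma>\<^sup>2 * real j / \<sigma> * (\<Sum>i=1..j. F2 i * K2 i) * e2
      - 1/2 * (\<Sum>i=1..j. \<omega> i * \<mu> i * (y i)\<^sup>2) + \<gamma>\<^sup>2 / 4 * (\<Sum>i=1..j. L i * (T i)\<^sup>2))"
    using lmi channels unfolding VD_eq by linarith
  have low: "\<gamma>\<^sup>2 * real j / \<sigma> * (\<Sum>i=1..j. F2 i * K2 i) * e2 \<le> \<gamma> * lam (N + 1) / 2 * e2"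
  proof (rule mult_right_mono[OF _ nn(2)])
    have "\<gamma> * (2 * real j * \<gamma> * (\<Sum>i=1..j. F2 i * K2 i)) \<le> \<gamma> * (\<sigma> * lam (N + 1))"
      using small2 gam by (intro mult_left_mono) (auto simp: F2_def K2_def)
    then show "\<gamma>\<^sup>2 * real j / \<sigma> * (\<Sum>i=1..j. F2 i * K2 i) \<le> \<gamma> * lam (N + 1) / 2"
      using sig by (simp add: field_simps power2_eq_square)
  qed
  have high: "\<gamma>\<^sup>2 / 4 * (\<Sum>i=1..j. L i * (T i)\<^sup>2) \<le> \<gamma> * (lam (M + 1) - lam (N + 1)) * f2"
  proof -
    have "(\<Sum>i=1..j. L i * (T i)\<^sup>2) \<le> (\<Sum>i=1..j. L i * (D2 i * f2))"
      by (intro sum_mono mult_left_mono T_bd L) auto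
    also have "\<dots> = (\<Sum>i=1..j. L i * D2 i) * f2" by (simp add: sum_distrib_right mult.assoc)
    finally have "\<gamma>\<^sup>2 / 4 * (\<Sum>i=1..j. L i * (T i)\<^sup>2) \<le> \<gamma>\<^sup>2 / 4 * ((\<Sum>i=1..j. L i * D2 i) * f2)"
      by (intro mult_left_mono) auto
    also have "\<dots> = \<gamma> / 4 * (\<gamma> * (\<Sum>i=1..j. L i * D2 i)) * f2" by (simp add: power2_eq_square)
    also have "\<dots> \<le> \<gamma> / 4 * (4 * (lam (M + 1) - lam (N + 1))) * f2"
      using gap gam nn by (intro mult_right_mono mult_left_mono) (auto simp: D2_def)
    finally show ?thesis by (simp add: mult_ac)
  qed
  have "\<gamma> * (lam (N + 1) * e2 + (lam (M + 1) - lam (N + 1)) * f2) \<le> \<gamma> * E"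
    using E_bd gam by (intro mult_left_mono) auto
  then have "VD w y v \<le> - \<sigma> / 2 * cc - \<gamma> * lam (N + 1) / 2 * e2 - 1/2 * (\<Sum>i=1..j. \<omega> i * \<mu> i * (y i)\<^sup>2)"
    using main low high by (simp add: algebra_simps)
  moreover have "min (\<gamma> * lam (N + 1)) \<sigma> / 2 * cc \<le> \<sigma> / 2 * cc"
    "min (\<gamma> * lam (N + 1)) \<sigma> / 2 * e2 \<le> \<gamma> * lam (N + 1) / 2 * e2"
    by (intro mult_right_mono nn; simp)+
  moreover have "(nrm r w)\<^sup>2 = cc + e2" by (simp add: cc_def e2_def)
  ultimately show ?thesis unfolding v_def[symmetric] by (simp add: distrib_left)
qed

end

section \<open>Differentiating the functional along solutions\<close>

lemma leibniz_halfline: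
  fixes f f' :: "real \<Rightarrow> real \<Rightarrow> real"
  assumes d: "\<And>t x. 0 < t \<Longrightarrow> x \<in> {0..1} \<Longrightarrow> ((\<lambda>s. f s x) has_real_derivative f' t x) (at t)"
    and c: "\<And>t. 0 < t \<Longrightarrow> continuous_on {0..1} (f t)"
    and c': "continuous_on ({0<..} \<times> {0..1}) (\<lambda>(t, x). f' t x)" and t: "0 < t"
  shows "((\<lambda>t. integral {0..1} (f t)) has_real_derivative integral {0..1} (f' t)) (at t)"
proof -
  have "((\<lambda>t. integral (cbox 0 1) (f t)) has_real_derivative integral (cbox 0 1) (f' t)) (at t within {0<..})"
  proof (rule leibniz_rule_field_derivative)
    show "((\<lambda>s. f s x) has_real_derivative f' s x) (at s within {0<..})"
      if "s \<in> {0<..}" "x \<in> cbox 0 1" for s x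
      using d[of s x] that by (auto intro: has_field_derivative_at_within)
    show "f s integrable_on cbox 0 1" if "s \<in> {0<..}" for s
      using c[of s] that by (auto intro: integrable_continuous_real)
    show "continuous_on ({0<..} \<times> cbox 0 1) (\<lambda>(t, x). f' t x)" using c' by simp
  qed (use t in auto)
  moreover have "at t within {0<..} = at t" using t by (intro at_within_open) auto
  ultimately show ?thesis by simp
qed

lemma continuous_on_strip_slice:
  assumes "continuous_on (S \<times> {0..1::real}) (\<lambda>(t, x). f t x)" "t \<in> S"
  shows "continuous_on {0..1} (f t)"
proof -
  have "continuous_on {0..1} (\<lambda>x. (\<lambda>(t, x). f t x) (t, x))"
    by (rule continuous_on_compose2[OF assms(1)]) (use assms(2) in \<open>auto intro!: continuous_intros\<close>)
  then show ?thesis by simp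
qed

definition time_deriv :: "(real \<Rightarrow> real \<Rightarrow> real) \<Rightarrow> real \<Rightarrow> real \<Rightarrow> real" where
  "time_deriv w t x = vector_derivative (\<lambda>s. w s x) (at t)"

lemma C1_strip_time:
  assumes w: "w \<in> C1_strip"
  shows "\<And>t x. 0 < t \<Longrightarrow> x \<in> {0..1} \<Longrightarrow> ((\<lambda>s. w s x) has_real_derivative time_deriv w t x) (at t)"
    and "continuous_on ({0<..} \<times> {0..1}) (\<lambda>(t, x). time_deriv w t x)"
    and "\<And>t. 0 < t \<Longrightarrow> continuous_on {0..1} (time_deriv w t)"
proof -
  show "((\<lambda>s. w s x) has_real_derivative time_deriv w t x) (at t)" if "0 < t" "x \<in> {0..1}" for t x
    using w that unfolding C1_strip_def time_deriv_def has_real_derivative_iff_has_vector_derivative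
    by (simp add: vector_derivative_works)
  show c: "continuous_on ({0<..} \<times> {0..1}) (\<lambda>(t, x). time_deriv w t x)"
    using w by (simp add: C1_strip_def time_deriv_def)
  show "continuous_on {0..1} (time_deriv w t)" if "0 < t" for t
    by (rule continuous_on_strip_slice[OF c]) (use that in auto)
qed

lemma C0_strip_slice: "w \<in> C0_strip \<Longrightarrow> 0 \<le> t \<Longrightarrow> continuous_on {0..1} (w t)"
  unfolding C0_strip_def by (rule continuous_on_strip_slice[of "{0..}"]) auto

lemma continuous_on_strip_weight:
  assumes "continuous_on {0..1} g"
  shows "continuous_on (S \<times> {0..1::real}) (\<lambda>z. g (snd z))"
  by (rule continuous_on_compose2[OF assms]) (auto intro!: continuous_intros)

context weight
begin

lemma ip_time_deriv:
  assumes w0: "w \<in> C0_strip" and w: "w \<in> C1_strip" and g: "continuous_on {0..1} g" and t: "0 < t"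
  shows "((\<lambda>s. ip r g (w s)) has_real_derivative ip r g (time_deriv w t)) (at t)"
proof -
  note W = C1_strip_time[OF w]
  have "((\<lambda>s. integral {0..1} (\<lambda>x. r x * g x * w s x)) has_real_derivative
      integral {0..1} (\<lambda>x. r x * g x * time_deriv w t x)) (at t)"
  proof (rule leibniz_halfline[OF _ _ _ t])
    show "((\<lambda>s. r x * g x * w s x) has_real_derivative r x * g x * time_deriv w t x) (at t)"
      if "0 < t" "x \<in> {0..1}" for t x
      using W(1)[OF that] by (auto intro!: derivative_eq_intros)
    show "continuous_on {0..1} (\<lambda>x. r x * g x * w t x)" if "0 < t" for t
      using C0_strip_slice[OF w0] that by (intro continuous_intros r_cont g) auto
    show "continuous_on ({0<..} \<times> {0..1}) (\<lambda>(t, x). r x * g x * time_deriv w t x)"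
      using W(2) unfolding case_prod_beta
      by (intro continuous_on_mult continuous_on_strip_weight r_cont g) auto
  qed
  then have "((\<lambda>s. integral {0..1} (\<lambda>x. r x * g x * w s x)) has_real_derivative ip r g (time_deriv w t)) (at t)"
    using ip_continuous_eq[OF g W(3)[OF t]] by simp
  then show ?thesis
  proof (rule has_field_derivative_transform_within_open)
    show "integral {0..1} (\<lambda>x. r x * g x * w s x) = ip r g (w s)" if "s \<in> {0<..}" for s
      using ip_continuous_eq[OF g C0_strip_slice[OF w0]] that by simp
  qed (use t in auto)
qed

lemma ip_self_time_deriv:
  assumes w0: "w \<in> C0_strip" and w: "w \<in> C1_strip" and t: "0 < t"
  shows "((\<lambda>s. ip r (w s) (w s)) has_real_derivative 2 * ip r (w t) (time_deriv w t)) (at t)"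
proof -
  note W = C1_strip_time[OF w] and S = C0_strip_slice[OF w0]
  have wc: "continuous_on ({0<..} \<times> {0..1}) (\<lambda>(t, x). w t x)"
    using w0 unfolding C0_strip_def by (auto intro: continuous_on_subset)
  have "((\<lambda>s. integral {0..1} (\<lambda>x. r x * w s x * w s x)) has_real_derivative
      integral {0..1} (\<lambda>x. 2 * (r x * w t x * time_deriv w t x))) (at t)"
  proof (rule leibniz_halfline[OF _ _ _ t])
    show "((\<lambda>s. r x * w s x * w s x) has_real_derivative 2 * (r x * w t x * time_deriv w t x)) (at t)"
      if "0 < t" "x \<in> {0..1}" for t x
      using W(1)[OF that] by (auto intro!: derivative_eq_intros)
    show "continuous_on {0..1} (\<lambda>x. r x * w t x * w t x)" if "0 < t" for t
      using S that by (intro continuous_intros r_cont) auto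
    show "continuous_on ({0<..} \<times> {0..1}) (\<lambda>(t, x). 2 * (r x * w t x * time_deriv w t x))"
      using W(2) wc unfolding case_prod_beta
      by (intro continuous_on_mult continuous_on_strip_weight r_cont continuous_on_const) auto
  qed
  then have "((\<lambda>s. integral {0..1} (\<lambda>x. r x * w s x * w s x)) has_real_derivative 2 * ip r (w t) (time_deriv w t)) (at t)"
    using ip_continuous_eq[OF S W(3)[OF t]] t by simp
  then show ?thesis
  proof (rule has_field_derivative_transform_within_open)
    show "integral {0..1} (\<lambda>x. r x * w s x * w s x) = ip r (w s) (w s)" if "s \<in> {0<..}" for s
      using ip_continuous_eq[OF S S] that by simp
  qed (use t in auto)
qed

lemma ip_time_continuous:
  assumes w0: "w \<in> C0_strip" and g: "continuous_on {0..1} g"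
  shows "continuous_on {0..} (\<lambda>t. ip r g (w t))" and "continuous_on {0..} (\<lambda>t. ip r (w t) (w t))"
proof -
  note S = C0_strip_slice[OF w0]
  have wc: "continuous_on ({0..} \<times> {0..1}) (\<lambda>z. w (fst z) (snd z))"
    using w0 unfolding C0_strip_def by (simp add: case_prod_beta)
  have "continuous_on {0..} (\<lambda>t. integral (cbox 0 1) (\<lambda>x. r x * g x * w t x))"
    by (rule integral_continuous_on_param)
       (use wc in \<open>auto simp: case_prod_beta intro!: continuous_on_mult continuous_on_strip_weight r_cont g\<close>)
  moreover have "integral (cbox 0 1) (\<lambda>x. r x * g x * w t x) = ip r g (w t)" if "t \<in> {0..}" for t
    using ip_continuous_eq[OF g S] that by simp
  ultimately show "continuous_on {0..} (\<lambda>t. ip r g (w t))"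
    using continuous_on_cong[OF refl, of "{0..}"] by (metis (no_types, lifting))
  have "continuous_on {0..} (\<lambda>t. integral (cbox 0 1) (\<lambda>x. r x * w t x * w t x))"
    by (rule integral_continuous_on_param)
       (use wc in \<open>auto simp: case_prod_beta intro!: continuous_on_mult continuous_on_strip_weight r_cont\<close>)
  moreover have "integral (cbox 0 1) (\<lambda>x. r x * w t x * w t x) = ip r (w t) (w t)" if "t \<in> {0..}" for t
    using ip_continuous_eq[OF S S] that by simp
  ultimately show "continuous_on {0..} (\<lambda>t. ip r (w t) (w t))"
    using continuous_on_cong[OF refl, of "{0..}"] by (metis (no_types, lifting))
qed

end

lemma C1_halfline_deriv:
  assumes "g \<in> C1_halfline" "0 < t"
  shows "(g has_real_derivative vector_derivative g (at t)) (at t)"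
proof -
  have "g differentiable (at t within {0..})"
    using assms by (auto simp: C1_halfline_def differentiable_on_def)
  moreover have "at t within {0..} = at t"
    using assms(2) by (intro at_within_interior) auto
  ultimately show ?thesis
    by (simp add: has_real_derivative_iff_has_vector_derivative vector_derivative_works)
qed

lemma C1_halfline_continuous: "g \<in> C1_halfline \<Longrightarrow> continuous_on {0..} g"
  by (auto simp: C1_halfline_def intro: differentiable_imp_continuous_on)

lemma AE_interior01: "(\<And>x. x \<in> {0<..<1} \<Longrightarrow> P x) \<Longrightarrow> AE x in lebesgue. x \<in> {0..1::real} \<longrightarrow> P x"
proof -
  assume P: "\<And>x. x \<in> {0<..<1} \<Longrightarrow> P x"
  have "{0, 1::real} \<in> null_sets lebesgue"
    by (simp add: negligible_iff_null_sets[symmetric] negligible_finite)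
  then have "AE x in lebesgue. x \<notin> {0, 1::real}" by (rule AE_not_in)
  then show ?thesis by eventually_elim (use P in auto)
qed

context lyapunov_setting
begin

lemma solution_D:
  assumes sol: "is_solution p r q a1 a2 b1 b2 vphi j \<mu> v w y"
  shows "w \<in> C0_strip" "w \<in> C1_strip" "\<And>i. i \<in> {1..j} \<Longrightarrow> (\<lambda>t. y t i) \<in> C1_halfline"
    "\<And>t. 0 < t \<Longrightarrow> w t \<in> D" "\<And>t. 0 < t \<Longrightarrow> w t \<in> C2_01"
    "\<And>t x. 0 < t \<Longrightarrow> x \<in> {0<..<1} \<Longrightarrow> time_deriv w t x = - A (w t) x - (\<Sum>i=1..j. v t i * vphi i x)"
    "\<And>t i. 0 < t \<Longrightarrow> i \<in> {1..j} \<Longrightarrow> ((\<lambda>t. y t i) has_real_derivative - \<mu> i * y t i + v t i) (at t)"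
proof -
  show 1: "w \<in> C0_strip" "w \<in> C1_strip" "\<And>i. i \<in> {1..j} \<Longrightarrow> (\<lambda>t. y t i) \<in> C1_halfline"
    "\<And>t. 0 < t \<Longrightarrow> w t \<in> D" "\<And>t. 0 < t \<Longrightarrow> w t \<in> C2_01"
    using sol unfolding is_solution_def by blast+
  show "time_deriv w t x = - A (w t) x - (\<Sum>i=1..j. v t i * vphi i x)" if "0 < t" "x \<in> {0<..<1}" for t x
    using sol that unfolding is_solution_def time_deriv_def by (simp add: mult.commute)
  show "((\<lambda>t. y t i) has_real_derivative - \<mu> i * y t i + v t i) (at t)" if "0 < t" "i \<in> {1..j}" for t i
    using C1_halfline_deriv[OF 1(3)[OF that(2)] that(1)] sol that unfolding is_solution_def by simp
qed

text \<open>Differentiation under the integral sign, the equation for the time derivative, and the symmetry of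
  \<open>R\<close>. The equation holds in the open interval only, which does not affect inner products.\<close>

lemma V_deriv:
  assumes sol: "is_solution p r q a1 a2 b1 b2 vphi j \<mu> v w y" and t: "0 < t"
  shows "((\<lambda>s. V (w s) (y s)) has_real_derivative VD (w t) (y t) (v t)) (at t)"
proof -
  note S = solution_D[OF sol]
  define z where "z = (\<lambda>x. - A (w t) x - (\<Sum>i=1..j. v t i * vphi i x))"
  define wt where "wt = time_deriv w t"
  have wtL: "wt \<in> L2 r" unfolding wt_def using C1_strip_time(3)[OF S(2) t] by (rule L2_cont)
  have wL: "w s \<in> L2 r" if "0 < s" for s using S(4)[OF that] D_D(3) by blast
  have AL: "A (w t) \<in> L2 r" using S(4)[OF t] by (auto simp: SL_dom_def intro: A_L2)
  have ae: "AE x in lebesgue. x \<in> {0..1} \<longrightarrow> wt x = z x"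
    by (rule AE_interior01) (use S(6)[OF t] in \<open>simp add: wt_def z_def\<close>)
  have eq: "ip r u wt = ip r u z" if "u \<in> L2 r" for u by (rule ip_cong_AE[OF that wtL ae])
  have dc: "((\<lambda>s. cf n (w s)) has_real_derivative cf n z) (at t)" if "n \<in> {1..N}" for n
    using ip_time_deriv[OF S(1,2) phi_cont t, of n] that eq[OF phi_L2, of n] by (simp add: wt_def)
  have dq: "((\<lambda>s. ip r (w s) (w s)) has_real_derivative 2 * ip r (w t) z) (at t)"
    using ip_self_time_deriv[OF S(1,2) t] eq[OF wL[OF t]] by (simp add: wt_def)
  have d: "((\<lambda>s. 1/2 * Vform N R \<gamma> (w s) (w s) + 1/2 * (\<Sum>i=1..j. \<omega> i * (y s i)\<^sup>2)) has_real_derivative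
     1/2 * ((\<Sum>n=1..N. \<Sum>m=1..N. R n m * (cf n z * cf m (w t) + cf n (w t) * cf m z))
       + \<gamma> * (2 * ip r (w t) z - (\<Sum>n=1..N. 2 * (cf n (w t) * cf n z))))
     + 1/2 * (\<Sum>i=1..j. \<omega> i * (2 * y t i * (- \<mu> i * y t i + v t i)))) (at t)"
    unfolding Vform_def
    by (rule derivative_eq_intros refl dc dq S(7)[OF t] | assumption |
        (simp add: algebra_simps; fail))+
  have sw: "(\<Sum>n=1..N. \<Sum>m=1..N. R n m * (cf n z * cf m (w t))) = (\<Sum>n=1..N. \<Sum>m=1..N. R n m * cf n (w t) * cf m z)"
  proof -
    have "(\<Sum>n=1..N. \<Sum>m=1..N. R n m * (cf n z * cf m (w t))) = (\<Sum>m=1..N. \<Sum>n=1..N. R n m * (cf n z * cf m (w t)))"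
      by (rule sum.swap)
    also have "\<dots> = (\<Sum>n=1..N. \<Sum>m=1..N. R n m * cf n (w t) * cf m z)"
      by (intro sum.cong refl) (auto simp: R_sym mult_ac)
    finally show ?thesis .
  qed
  have "1/2 * ((\<Sum>n=1..N. \<Sum>m=1..N. R n m * (cf n z * cf m (w t) + cf n (w t) * cf m z))
       + \<gamma> * (2 * ip r (w t) z - (\<Sum>n=1..N. 2 * (cf n (w t) * cf n z))))
     = Vform N R \<gamma> (w t) z"
    using sw by (simp add: Vform_def distrib_left sum.distrib sum_distrib_left[symmetric] right_diff_distrib mult.assoc)
  moreover have "1/2 * (\<Sum>i=1..j. \<omega> i * (2 * y t i * (- \<mu> i * y t i + v t i)))
      = (\<Sum>i=1..j. \<omega> i * y t i * (v t i - \<mu> i * y t i))"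
    unfolding sum_distrib_left by (intro sum.cong refl) (simp add: algebra_simps)
  moreover have "VD (w t) (y t) (v t) = Vform N R \<gamma> (w t) z
      + (\<Sum>i=1..j. \<omega> i * y t i * (v t i - \<mu> i * y t i))"
    unfolding z_def by (rule Vdot_eq[OF wL[OF t] AL vphi_L2])
  ultimately have "((\<lambda>s. 1/2 * Vform N R \<gamma> (w s) (w s) + 1/2 * (\<Sum>i=1..j. \<omega> i * (y s i)\<^sup>2)) has_real_derivative
     VD (w t) (y t) (v t)) (at t)"
    using d by simp
  then show ?thesis
  proof (rule has_field_derivative_transform_within_open)
    show "1/2 * Vform N R \<gamma> (w s) (w s) + 1/2 * (\<Sum>i=1..j. \<omega> i * (y s i)\<^sup>2) = V (w s) (y s)" if "s \<in> {0<..}" for s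
      using Vfun_eq[OF wL] that by simp
  qed (use t in auto)
qed

end

section \<open>Exponential decay\<close>

text \<open>A positive definite form attains a positive minimum on the compact unit sphere, the vectors
  being normalized to vanish outside the index range.\<close>

lemma sym_pos_def_lower_bound:
  assumes "sym_pos_def N X"
  obtains \<rho> where "0 < \<rho>" "\<And>\<xi>. \<rho> * (\<Sum>n=1..N. (\<xi> n)\<^sup>2) \<le> qform N X \<xi>"
proof -
  define B where "B = PiE UNIV (\<lambda>n. if n \<in> {1..N} then {-1..1::real} else {0})"
  define S where "S = B \<inter> {\<xi>. (\<Sum>n=1..N. (\<xi> n)\<^sup>2) = 1}"
  have "compactin (product_topology (\<lambda>_::nat. euclidean :: real topology) UNIV) B"
    unfolding B_def by (subst compactin_PiE) auto
  then have "compact B" by (simp add: euclidean_product_topology)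
  moreover have "closed {\<xi>::nat \<Rightarrow> real. (\<Sum>n=1..N. (\<xi> n)\<^sup>2) = 1}"
    by (intro closed_Collect_eq continuous_intros continuous_on_product_coordinates)
  ultimately have cS: "compact S" unfolding S_def by (rule compact_Int_closed)
  have cq: "continuous_on S (qform N X)"
    unfolding qform_def[abs_def]
    by (intro continuous_intros continuous_on_subset[OF continuous_on_product_coordinates]) auto
  have pos: "0 < qform N X \<xi>" if "\<xi> \<in> S" for \<xi>
  proof -
    have "\<exists>n\<in>{1..N}. \<xi> n \<noteq> 0"
    proof (rule ccontr)
      assume "\<not> ?thesis"
      then have "(\<Sum>n=1..N. (\<xi> n)\<^sup>2) = 0" by simp
      then show False using that by (simp add: S_def)
    qed
    then show ?thesis using assms by (simp add: sym_pos_def_def)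
  qed
  obtain \<rho> where \<rho>: "0 < \<rho>" "\<And>\<xi>. \<xi> \<in> S \<Longrightarrow> \<rho> \<le> qform N X \<xi>"
  proof (cases "S = {}")
    case True
    then show ?thesis using that[of 1] by auto
  next
    case False
    then obtain m where "m \<in> S" "\<And>\<xi>. \<xi> \<in> S \<Longrightarrow> qform N X m \<le> qform N X \<xi>"
      using continuous_attains_inf[OF cS _ cq] by blast
    then show ?thesis using that[of "qform N X m"] pos by blast
  qed
  have "\<rho> * (\<Sum>n=1..N. (\<xi> n)\<^sup>2) \<le> qform N X \<xi>" for \<xi>
  proof (cases "(\<Sum>n=1..N. (\<xi> n)\<^sup>2) = 0")
    case True
    then have "\<xi> n = 0" if "n \<in> {1..N}" for n
      using that by (simp add: sum_nonneg_eq_0_iff)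
    then have "qform N X \<xi> = 0" by (simp add: qform_def)
    then show ?thesis using True by simp
  next
    case False
    define s where "s = (\<Sum>n=1..N. (\<xi> n)\<^sup>2)"
    have s: "0 < s" using False sum_nonneg[of "{1..N}" "\<lambda>n. (\<xi> n)\<^sup>2"] by (simp add: s_def)
    define \<eta> where "\<eta> n = (if n \<in> {1..N} then \<xi> n / sqrt s else 0)" for n
    have sq: "(\<eta> n)\<^sup>2 = (\<xi> n)\<^sup>2 / s" if "n \<in> {1..N}" for n
      using that s by (simp add: \<eta>_def power_divide)
    have one: "(\<Sum>n=1..N. (\<eta> n)\<^sup>2) = 1"
    proof -
      have "(\<Sum>n=1..N. (\<eta> n)\<^sup>2) = (\<Sum>n=1..N. (\<xi> n)\<^sup>2 / s)" by (intro sum.cong refl sq)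
      also have "\<dots> = s / s" unfolding s_def sum_divide_distrib ..
      finally show ?thesis using s by simp
    qed
    have le1: "\<bar>\<eta> n\<bar> \<le> 1" if "n \<in> {1..N}" for n
    proof -
      have "(\<eta> n)\<^sup>2 \<le> (\<Sum>n=1..N. (\<eta> n)\<^sup>2)" by (rule member_le_sum) (use that in auto)
      then show ?thesis unfolding one by (simp add: abs_square_le_1)
    qed
    have "\<eta> n \<in> (if n \<in> {1..N} then {-1..1} else {0})" for n
      using le1[of n] by (cases "n \<in> {1..N}") (auto simp: abs_le_iff, auto simp: \<eta>_def)
    then have "\<eta> \<in> S" unfolding S_def B_def using one by blast
    then have "\<rho> \<le> qform N X \<eta>" by (rule \<rho>(2))
    also have "qform N X \<eta> = qform N X \<xi> / s"
      unfolding qform_def sum_divide_distrib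
      by (intro sum.cong refl) (use s in \<open>simp add: \<eta>_def field_simps\<close>)
    finally have "\<rho> * s \<le> qform N X \<xi>" using s by (simp add: field_simps)
    then show ?thesis unfolding s_def .
  qed
  then show thesis using that \<rho>(1) by blast
qed

text \<open>The product \<open>exp (a t) f t\<close> is nonincreasing.\<close>

lemma exponential_decay:
  fixes f f' :: "real \<Rightarrow> real"
  assumes c: "continuous_on {0..} f" and d: "\<And>t. 0 < t \<Longrightarrow> (f has_real_derivative f' t) (at t)"
    and le: "\<And>t. 0 < t \<Longrightarrow> f' t \<le> - a * f t" and t: "0 \<le> t"
  shows "f t \<le> exp (- a * t) * f 0"
proof -
  have "exp (a * t) * f t \<le> exp (a * 0) * f 0"
  proof (rule DERIV_nonpos_imp_decreasing_open[OF t])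
    fix s assume s: "0 < s" "s < t"
    have "((\<lambda>s. exp (a * s) * f s) has_real_derivative exp (a * s) * (f' s + a * f s)) (at s)"
      using d[OF s(1)] by (auto intro!: derivative_eq_intros simp: algebra_simps)
    moreover have "exp (a * s) * (f' s + a * f s) \<le> 0"
      using le[OF s(1)] by (intro mult_nonneg_nonpos) auto
    ultimately show "\<exists>y. ((\<lambda>s. exp (a * s) * f s) has_real_derivative y) (at s) \<and> y \<le> 0" by blast
  next
    show "continuous_on {0..t} (\<lambda>s. exp (a * s) * f s)"
      by (intro continuous_intros continuous_on_subset[OF c]) auto
  qed
  then show ?thesis by (simp add: exp_minus field_simps)
qed

context lyapunov_setting
begin

lemma V_bounds:
  obtains c1 c2 where "0 < c1" "0 < c2"
    "\<And>w y. w \<in> L2 r \<Longrightarrow> c1 * ((nrm r w)\<^sup>2 + (L2_set y {1..j})\<^sup>2) \<le> V w y"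
    "\<And>w y. w \<in> L2 r \<Longrightarrow> V w y \<le> c2 * ((nrm r w)\<^sup>2 + (L2_set y {1..j})\<^sup>2)"
proof -
  obtain \<rho> where \<rho>: "0 < \<rho>" "\<And>\<xi>. \<rho> * (\<Sum>n=1..N. (\<xi> n)\<^sup>2) \<le> qform N R \<xi>"
    using sym_pos_def_lower_bound[OF R_spd] by metis
  define om where "om = Min (\<omega> ` {1..j})"
  have om: "0 < om" "\<And>i. i \<in> {1..j} \<Longrightarrow> om \<le> \<omega> i"
    using j1 om_pos by (auto simp: om_def)
  define c1 where "c1 = min (min \<rho> \<gamma>) om / 2"
  define R1 where "R1 = (\<Sum>n=1..N. \<Sum>m=1..N. \<bar>R n m\<bar>)"
  define c2 where "c2 = (R1 + \<gamma> + (\<Sum>i=1..j. \<omega> i)) / 2"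
  have R1: "0 \<le> R1" by (simp add: R1_def sum_nonneg)
  have omS: "0 \<le> (\<Sum>i=1..j. \<omega> i)" 
    by (intro sum_nonneg less_imp_le om_pos)
  have y2: "(L2_set y {1..j})\<^sup>2 = (\<Sum>i=1..j. (y i)\<^sup>2)" for y by (simp add: L2_set_def sum_nonneg)
  have Veq: "V w y = 1/2 * (qform N R (\<lambda>n. cf n w)
      + \<gamma> * ((nrm r w)\<^sup>2 - (\<Sum>n=1..N. (cf n w)\<^sup>2)) + (\<Sum>i=1..j. \<omega> i * (y i)\<^sup>2))" if "w \<in> L2 r" for w y
    unfolding Vfun_eq[OF that] Vform_def qform_def nrm_sq
    by (simp add: power2_eq_square mult_ac distrib_left)
  have lower: "c1 * ((nrm r w)\<^sup>2 + (L2_set y {1..j})\<^sup>2) \<le> V w y" if w: "w \<in> L2 r" for w y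
  proof -
    let ?c = "\<Sum>n=1..N. (cf n w)\<^sup>2"
    have "2 * c1 * ?c \<le> \<rho> * ?c" by (intro mult_right_mono sum_nonneg) (auto simp: c1_def)
    also have "\<dots> \<le> qform N R (\<lambda>n. cf n w)" by (rule \<rho>(2))
    finally have 1: "2 * c1 * ?c \<le> qform N R (\<lambda>n. cf n w)" .
    have 2: "2 * c1 * ((nrm r w)\<^sup>2 - ?c) \<le> \<gamma> * ((nrm r w)\<^sup>2 - ?c)"
      using Bessel[OF w, of N] by (intro mult_right_mono) (auto simp: c1_def)
    have 3: "2 * c1 * (\<Sum>i=1..j. (y i)\<^sup>2) \<le> (\<Sum>i=1..j. \<omega> i * (y i)\<^sup>2)"
      unfolding sum_distrib_left
    proof (intro sum_mono mult_right_mono)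
      fix i assume "i \<in> {1..j}"
      then show "2 * c1 \<le> \<omega> i" using om(2)[of i] by (auto simp: c1_def)
    qed simp
    show ?thesis unfolding Veq[OF w] y2 using 1 2 3 by (simp add: algebra_simps)
  qed
  have upper: "V w y \<le> c2 * ((nrm r w)\<^sup>2 + (L2_set y {1..j})\<^sup>2)" if w: "w \<in> L2 r" for w y
  proof -
    have 1: "qform N R (\<lambda>n. cf n w) \<le> R1 * (nrm r w)\<^sup>2"
      unfolding qform_def R1_def sum_distrib_right
    proof (intro sum_mono)
      fix n m assume nm: "n \<in> {1..N}" "m \<in> {1..N}"
      have "cf n w * R n m * cf m w \<le> \<bar>cf n w * R n m * cf m w\<bar>" by simp
      also have "\<dots> = \<bar>R n m\<bar> * (\<bar>cf n w\<bar> * \<bar>cf m w\<bar>)" by (simp add: abs_mult)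
      also have "\<dots> \<le> \<bar>R n m\<bar> * (nrm r w * nrm r w)"
        by (intro mult_left_mono mult_mono coeff_bound w) (use nm nrm_nonneg in auto)
      finally show "cf n w * R n m * cf m w \<le> \<bar>R n m\<bar> * (nrm r w)\<^sup>2" by (simp add: power2_eq_square)
    qed
    have 2: "\<gamma> * ((nrm r w)\<^sup>2 - (\<Sum>n=1..N. (cf n w)\<^sup>2)) \<le> \<gamma> * (nrm r w)\<^sup>2"
      using gam by (intro mult_left_mono) (auto simp: sum_nonneg)
    have 3: "(\<Sum>i=1..j. \<omega> i * (y i)\<^sup>2) \<le> (\<Sum>i=1..j. \<omega> i) * (\<Sum>i=1..j. (y i)\<^sup>2)"
      unfolding sum_distrib_left[of "\<Sum>i=1..j. \<omega> i"]
    proof (intro sum_mono mult_right_mono)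
      fix i assume "i \<in> {1..j}"
      then show "\<omega> i \<le> (\<Sum>i=1..j. \<omega> i)"
        using om_pos by (intro member_le_sum) (auto intro: less_imp_le)
    qed simp
    have "0 \<le> (\<Sum>i=1..j. \<omega> i) * (nrm r w)\<^sup>2" "0 \<le> (R1 + \<gamma>) * (\<Sum>i=1..j. (y i)\<^sup>2)"
      using omS R1 gam by (auto intro!: mult_nonneg_nonneg sum_nonneg)
    then show ?thesis unfolding Veq[OF w] y2 c2_def using 1 2 3 by (simp add: field_simps)
  qed
  have "0 < c1" "0 < c2" using \<rho>(1) gam om(1) R1 omS by (auto simp: c1_def c2_def)
  then show thesis using that lower upper by blast
qed

lemma V_continuous:
  assumes "is_solution p r q a1 a2 b1 b2 vphi j \<mu> v w y"
  shows "continuous_on {0..} (\<lambda>t. V (w t) (y t))"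
proof -
  note S = solution_D[OF assms]
  have wL: "w t \<in> L2 r" if "0 \<le> t" for t using C0_strip_slice[OF S(1) that] L2_cont by blast
  have "continuous_on {0..} (\<lambda>t. 1/2 * Vform N R \<gamma> (w t) (w t) + 1/2 * (\<Sum>i=1..j. \<omega> i * (y t i)\<^sup>2))"
    unfolding Vform_def
    by (intro continuous_intros ip_time_continuous[OF S(1)] phi_cont C1_halfline_continuous S(3)) auto
  moreover have "1/2 * Vform N R \<gamma> (w t) (w t) + 1/2 * (\<Sum>i=1..j. \<omega> i * (y t i)\<^sup>2) = V (w t) (y t)"
    if "t \<in> {0..}" for t using Vfun_eq[OF wL] that by simp
  ultimately show ?thesis using continuous_on_cong[OF refl, of "{0..}"] by (metis (no_types, lifting))
qed

abbreviation closed_loop where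
  "closed_loop L M \<equiv> is_closed_loop_solution p r q a1 a2 b1 b2 phi vphi N R K \<gamma> j \<omega> \<mu> L M"

text \<open>\<open>Vdot_le\<close> and the upper bound for \<open>V\<close> give \<open>V' \<le> - (m / c2) V\<close>; the lower bound returns from \<open>V\<close> to
  the norms. The constants depend on the parameters only and not on the solution.\<close>

lemma closed_loop_decay:
  assumes L: "\<And>i. i \<in> {1..j} \<Longrightarrow> L i \<ge> 0" and NM: "N + 1 \<le> M"
    and gap: "4 * (lam (M + 1) - lam (N + 1)) \<ge> \<gamma> * (\<Sum>i=1..j. L i * (\<Sum>k. (cf (M + 1 + k) (vphi i))\<^sup>2))"
  obtains Kbar sbar where "0 < Kbar" "0 < sbar"
    "\<And>w0 y0 w y t. closed_loop L M w0 y0 w y \<Longrightarrow> 0 \<le> t \<Longrightarrow>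
       nrm r (w t) + L2_set (y t) {1..j} \<le> Kbar * exp (- sbar * t) * (nrm r w0 + L2_set y0 {1..j})"
proof -
  obtain c1 c2 where c: "0 < c1" "0 < c2"
    and lower: "\<And>w y. w \<in> L2 r \<Longrightarrow> c1 * ((nrm r w)\<^sup>2 + (L2_set y {1..j})\<^sup>2) \<le> V w y"
    and upper: "\<And>w y. w \<in> L2 r \<Longrightarrow> V w y \<le> c2 * ((nrm r w)\<^sup>2 + (L2_set y {1..j})\<^sup>2)"
    using V_bounds by metis
  define om where "om = Min ((\<lambda>i. \<omega> i * \<mu> i) ` {1..j})"
  have om: "0 < om" "\<And>i. i \<in> {1..j} \<Longrightarrow> om \<le> \<omega> i * \<mu> i"
    using j1 om_pos mu_pos by (auto simp: om_def)
  define m where "m = min om (min (\<gamma> * lam (N + 1)) \<sigma>) / 2"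
  have m: "0 < m" using om gam lamN sig by (auto simp: m_def)
  define sbar where "sbar = m / (2 * c2)"
  define Kbar where "Kbar = sqrt (2 * c2 / c1)"
  have est: "nrm r (w t) + L2_set (y t) {1..j} \<le> Kbar * exp (- sbar * t) * (nrm r w0 + L2_set y0 {1..j})"
    if cl: "closed_loop L M w0 y0 w y" and t: "0 \<le> t" for w0 y0 w y t
  proof -
    let ?v = "\<lambda>t. fb L M (w t) (y t)"
    have sol: "is_solution p r q a1 a2 b1 b2 vphi j \<mu> ?v w y"
      and w0: "\<And>x. x \<in> {0..1} \<Longrightarrow> w 0 x = w0 x" and y0: "\<And>i. i \<in> {1..j} \<Longrightarrow> y 0 i = y0 i"
      using cl by (auto simp: is_closed_loop_solution_def)
    note S = solution_D[OF sol]
    have wL: "w t \<in> L2 r" if "0 \<le> t" for t using C0_strip_slice[OF S(1) that] L2_cont by blast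
    have "V (w t) (y t) \<le> exp (- (m / c2) * t) * V (w 0) (y 0)"
    proof (rule exponential_decay[OF V_continuous[OF sol] V_deriv[OF sol] _ t])
      fix s :: real assume s: "0 < s"
      have "VD (w s) (y s) (?v s) \<le> - (1/2) * (\<Sum>i=1..j. \<omega> i * \<mu> i * (y s i)\<^sup>2)
               - min (\<gamma> * lam (N + 1)) \<sigma> / 2 * (nrm r (w s))\<^sup>2"
        by (rule Vdot_le[OF L NM gap S(4)[OF s]])
      moreover have "m * (\<Sum>i=1..j. (y s i)\<^sup>2) \<le> (1/2) * (\<Sum>i=1..j. \<omega> i * \<mu> i * (y s i)\<^sup>2)"
        unfolding sum_distrib_left
      proof (intro sum_mono)
        fix i assume i: "i \<in> {1..j}"
        have "m * (y s i)\<^sup>2 \<le> (\<omega> i * \<mu> i / 2) * (y s i)\<^sup>2"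
          using om(2)[OF i] by (intro mult_right_mono) (auto simp: m_def)
        then show "m * (y s i)\<^sup>2 \<le> (1/2) * (\<omega> i * \<mu> i * (y s i)\<^sup>2)" by simp
      qed
      moreover have "m * (nrm r (w s))\<^sup>2 \<le> min (\<gamma> * lam (N + 1)) \<sigma> / 2 * (nrm r (w s))\<^sup>2"
        by (intro mult_right_mono) (auto simp: m_def)
      ultimately have "VD (w s) (y s) (?v s) \<le> - m * ((nrm r (w s))\<^sup>2 + (L2_set (y s) {1..j})\<^sup>2)"
        by (simp add: L2_set_def sum_nonneg distrib_left)
      also have "\<dots> \<le> - m * (V (w s) (y s) / c2)"
      proof -
        have "V (w s) (y s) / c2 \<le> (nrm r (w s))\<^sup>2 + (L2_set (y s) {1..j})\<^sup>2"
          using upper[OF wL, of s "y s"] s c by (simp add: field_simps)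
        then have "m * (V (w s) (y s) / c2) \<le> m * ((nrm r (w s))\<^sup>2 + (L2_set (y s) {1..j})\<^sup>2)"
          using m by (intro mult_left_mono) auto
        then show ?thesis by simp
      qed
      finally show "VD (w s) (y s) (?v s) \<le> - (m / c2) * V (w s) (y s)" by simp
    qed
    moreover have "c1 * ((nrm r (w t))\<^sup>2 + (L2_set (y t) {1..j})\<^sup>2) \<le> V (w t) (y t)" by (rule lower[OF wL[OF t]])
    moreover have "V (w 0) (y 0) \<le> c2 * ((nrm r w0)\<^sup>2 + (L2_set y0 {1..j})\<^sup>2)"
    proof -
      have "nrm r (w 0) = nrm r w0" using w0 by (rule nrm_cong)
      moreover have "L2_set (y 0) {1..j} = L2_set y0 {1..j}" using y0 by (intro L2_set_cong) auto
      ultimately show ?thesis using upper[OF wL, of 0 "y 0"] by simp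
    qed
    ultimately have "c1 * ((nrm r (w t))\<^sup>2 + (L2_set (y t) {1..j})\<^sup>2)
        \<le> exp (- (m / c2) * t) * (c2 * ((nrm r w0)\<^sup>2 + (L2_set y0 {1..j})\<^sup>2))"
      by (meson exp_ge_zero mult_left_mono order_trans)
    then have sq: "(nrm r (w t))\<^sup>2 + (L2_set (y t) {1..j})\<^sup>2
        \<le> c2 / c1 * exp (- (m / c2) * t) * ((nrm r w0)\<^sup>2 + (L2_set y0 {1..j})\<^sup>2)"
      using c by (simp add: field_simps)
    show ?thesis
    proof (rule power2_le_imp_le)
      let ?a = "nrm r (w t)" and ?b = "L2_set (y t) {1..j}" and ?u = "nrm r w0" and ?z = "L2_set y0 {1..j}"
      have "(?a + ?b)\<^sup>2 \<le> 2 * (?a\<^sup>2 + ?b\<^sup>2)"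
        using zero_le_power2[of "?a - ?b"] by (simp add: power2_eq_square algebra_simps)
      also have "\<dots> \<le> 2 * (c2 / c1 * exp (- (m / c2) * t) * (?u\<^sup>2 + ?z\<^sup>2))" using sq by simp
      also have "\<dots> \<le> 2 * (c2 / c1 * exp (- (m / c2) * t) * (?u + ?z)\<^sup>2)"
      proof -
        have "?u\<^sup>2 + ?z\<^sup>2 \<le> (?u + ?z)\<^sup>2"
          using mult_nonneg_nonneg[OF nrm_nonneg[of w0] L2_set_nonneg[of y0 "{1..j}"]]
          by (simp add: power2_eq_square algebra_simps)
        then show ?thesis using c by (intro mult_left_mono) auto
      qed
      also have "\<dots> = (Kbar * exp (- sbar * t) * (?u + ?z))\<^sup>2"
      proof -
        have "(exp (- sbar * t))\<^sup>2 = exp (- (m / c2) * t)"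
          using c by (simp add: power2_eq_square exp_add[symmetric] sbar_def field_simps)
        moreover have "Kbar\<^sup>2 = 2 * c2 / c1" using c by (simp add: Kbar_def)
        ultimately show ?thesis unfolding power_mult_distrib by simp
      qed
      finally show "(?a + ?b)\<^sup>2 \<le> (Kbar * exp (- sbar * t) * (?u + ?z))\<^sup>2" .
      show "0 \<le> Kbar * exp (- sbar * t) * (?u + ?z)"
        using c nrm_nonneg L2_set_nonneg by (auto simp: Kbar_def intro!: mult_nonneg_nonneg add_nonneg_nonneg)
    qed
  qed
  have "0 < Kbar" "0 < sbar" using c m by (auto simp: Kbar_def sbar_def)
  then show thesis using that est by blast
qed

end

section \<open>Linear ordinary differential equations\<close>

text \<open>The unknowns in the finite set \<open>S\<close> form a closed linear system, and each further unknown is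
  driven by them. The solution is given by its Taylor series, whose coefficients grow at most
  geometrically up to the factorial.\<close>

lemma linear_ode_exists:
  fixes D x0 :: "'i \<Rightarrow> real" and A :: "'i \<Rightarrow> 'i \<Rightarrow> real"
  assumes S: "finite S"
  obtains x :: "'i \<Rightarrow> real \<Rightarrow> real" where "\<And>i. x i 0 = x0 i"
    "\<And>i t. (x i has_real_derivative D i * x i t + (\<Sum>m\<in>S. A i m * x m t)) (at t)"
proof -
  define u where "u = rec_nat x0 (\<lambda>k uk i. D i * uk i + (\<Sum>m\<in>S. A i m * uk m))"
  have u0: "u 0 = x0" and uS: "\<And>k i. u (Suc k) i = D i * u k i + (\<Sum>m\<in>S. A i m * u k m)"
    by (simp_all add: u_def)
  have bound: "\<exists>X \<beta>. 0 \<le> X \<and> 0 \<le> \<beta> \<and> (\<forall>k. \<bar>u k i\<bar> \<le> X * \<beta> ^ k)" for i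
  proof -
    let ?T = "insert i S"
    define X where "X = (\<Sum>a\<in>?T. \<bar>x0 a\<bar>)"
    define \<beta> where "\<beta> = (\<Sum>a\<in>?T. \<bar>D a\<bar> + (\<Sum>m\<in>S. \<bar>A a m\<bar>))"
    have X: "0 \<le> X" and \<beta>: "0 \<le> \<beta>" by (auto simp: X_def \<beta>_def intro!: sum_nonneg add_nonneg_nonneg)
    have "\<forall>a\<in>?T. \<bar>u k a\<bar> \<le> X * \<beta> ^ k" for k
    proof (induction k)
      case 0
      show ?case unfolding u0 X_def using S by (auto intro!: member_le_sum)
    next
      case (Suc k)
      show ?case
      proof
        fix a assume a: "a \<in> ?T"
        have "\<bar>u (Suc k) a\<bar> \<le> \<bar>D a * u k a\<bar> + \<bar>\<Sum>m\<in>S. A a m * u k m\<bar>"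
          unfolding uS by (rule abs_triangle_ineq)
        also have "\<dots> \<le> \<bar>D a * u k a\<bar> + (\<Sum>m\<in>S. \<bar>A a m * u k m\<bar>)" by (intro add_left_mono sum_abs)
        also have "\<dots> \<le> \<bar>D a\<bar> * (X * \<beta> ^ k) + (\<Sum>m\<in>S. \<bar>A a m\<bar> * (X * \<beta> ^ k))"
          unfolding abs_mult using Suc a by (intro add_mono sum_mono mult_left_mono) auto
        also have "\<dots> = (\<bar>D a\<bar> + (\<Sum>m\<in>S. \<bar>A a m\<bar>)) * (X * \<beta> ^ k)"
          by (simp add: distrib_right sum_distrib_right)
        also have "\<dots> \<le> \<beta> * (X * \<beta> ^ k)"
        proof (intro mult_right_mono)
          show "\<bar>D a\<bar> + (\<Sum>m\<in>S. \<bar>A a m\<bar>) \<le> \<beta>" unfolding \<beta>_def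
            by (rule member_le_sum) (use a S in \<open>auto intro!: sum_nonneg add_nonneg_nonneg\<close>)
        qed (use X \<beta> in auto)
        finally show "\<bar>u (Suc k) a\<bar> \<le> X * \<beta> ^ Suc k" by (simp add: mult_ac)
      qed
    qed
    then show ?thesis using X \<beta> by blast
  qed
  define c where "c i k = u k i / fact k" for i k
  have summ: "summable (\<lambda>k. c i k * y ^ k)" for i y
  proof -
    obtain X \<beta> where b: "0 \<le> X" "0 \<le> \<beta>" "\<And>k. \<bar>u k i\<bar> \<le> X * \<beta> ^ k" using bound by blast
    have "summable (\<lambda>k. X * (inverse (fact k) * (\<beta> * \<bar>y\<bar>) ^ k))"
      by (intro summable_mult summable_exp)
    moreover have "norm (c i k * y ^ k) \<le> X * (inverse (fact k) * (\<beta> * \<bar>y\<bar>) ^ k)" for k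
    proof -
      have "norm (c i k * y ^ k) = \<bar>u k i\<bar> * (inverse (fact k) * \<bar>y\<bar> ^ k)"
        by (simp add: c_def abs_mult power_abs divide_inverse)
      also have "\<dots> \<le> X * \<beta> ^ k * (inverse (fact k) * \<bar>y\<bar> ^ k)"
        by (intro mult_right_mono b) auto
      finally show ?thesis by (simp add: power_mult_distrib mult_ac)
    qed
    ultimately show ?thesis by (rule summable_comparison_test'[where N = 0])
  qed
  define x where "x i t = (\<Sum>k. c i k * t ^ k)" for i t
  have "x i 0 = x0 i" for i
    unfolding x_def using powser_zero[of "c i"] by (simp add: c_def u0)
  moreover have "(x i has_real_derivative D i * x i t + (\<Sum>m\<in>S. A i m * x m t)) (at t)" for i t
  proof -
    have 1: "((\<lambda>t. \<Sum>k. c i k * t ^ k) has_real_derivative (\<Sum>k. diffs (c i) k * t ^ k)) (at t)"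
      by (rule termdiffs_strong_converges_everywhere[OF summ])
    have e: "diffs (c i) k * t ^ k = D i * (c i k * t ^ k) + (\<Sum>m\<in>S. A i m * (c m k * t ^ k))" for k
    proof -
      have "diffs (c i) k = u (Suc k) i / fact k"
        unfolding diffs_def c_def fact_Suc by (simp del: of_nat_Suc)
      then show ?thesis
        by (simp add: uS c_def add_divide_distrib sum_divide_distrib distrib_right sum_distrib_right
            sum_distrib_left distrib_left mult_ac)
    qed
    have "(\<lambda>k. D i * (c i k * t ^ k) + (\<Sum>m\<in>S. A i m * (c m k * t ^ k)))
       sums (D i * x i t + (\<Sum>m\<in>S. A i m * x m t))"
      unfolding x_def by (intro sums_add sums_sum sums_mult summable_sums summ)
    then have "(\<Sum>k. diffs (c i) k * t ^ k) = D i * x i t + (\<Sum>m\<in>S. A i m * x m t)"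
      unfolding e by (rule sums_unique[symmetric])
    then show ?thesis using 1 unfolding x_def[abs_def] by simp
  qed
  ultimately show thesis using that by blast
qed

text \<open>With the integrating factor, \<open>exp (l s) (\<plusminus> z s - H / l)\<close> is nonincreasing. The point is the factor
  \<open>1 / l\<close> in front of the bound for the forcing term.\<close>

lemma damped_ode_bound:
  fixes z h :: "real \<Rightarrow> real"
  assumes d: "\<And>s. 0 \<le> s \<Longrightarrow> s \<le> T \<Longrightarrow> (z has_real_derivative - l * z s - h s) (at s)"
    and h: "\<And>s. 0 \<le> s \<Longrightarrow> s \<le> T \<Longrightarrow> \<bar>h s\<bar> \<le> H" and l: "0 < l" and t: "0 \<le> t" "t \<le> T"
  shows "\<bar>z t\<bar> \<le> exp (- l * t) * \<bar>z 0\<bar> + H / l"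
proof -
  have H: "0 \<le> H" using h[of 0] t by simp
  have one: "\<epsilon> * z t \<le> exp (- l * t) * \<bar>z 0\<bar> + H / l" if e: "\<bar>\<epsilon>\<bar> = 1" for \<epsilon>
  proof -
    let ?g = "\<lambda>s. exp (l * s) * (\<epsilon> * z s - H / l)"
    have "?g t \<le> ?g 0"
    proof (rule DERIV_nonpos_imp_nonincreasing[OF t(1)])
      fix s assume s: "0 \<le> s" "s \<le> t"
      then have sT: "s \<le> T" using t by simp
      have "(?g has_real_derivative exp (l * s) * (- H - \<epsilon> * h s)) (at s)"
        using d[OF s(1) sT] l by (auto intro!: derivative_eq_intros simp: field_simps)
      moreover have "- (\<epsilon> * h s) \<le> H"
        using h[OF s(1) sT] e by (metis abs_ge_minus_self abs_mult mult_1 order_trans)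
      then have "exp (l * s) * (- H - \<epsilon> * h s) \<le> 0" by (intro mult_nonneg_nonpos) auto
      ultimately show "\<exists>y. (?g has_real_derivative y) (at s) \<and> y \<le> 0" by blast
    qed
    also have "?g 0 \<le> \<bar>z 0\<bar>"
    proof -
      have "\<epsilon> * z 0 \<le> \<bar>z 0\<bar>" using e abs_ge_self[of "\<epsilon> * z 0"] by (simp add: abs_mult)
      moreover have "0 \<le> H / l" using H l by simp
      ultimately show ?thesis by simp
    qed
    finally have "exp (- l * t) * ?g t \<le> exp (- l * t) * \<bar>z 0\<bar>" by (intro mult_left_mono) auto
    moreover have "exp (- l * t) * ?g t = (exp (- l * t) * exp (l * t)) * (\<epsilon> * z t - H / l)"
      by (simp only: mult.assoc)
    moreover have "exp (- l * t) * exp (l * t) = 1" by (simp add: exp_minus)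
    ultimately have "\<epsilon> * z t - H / l \<le> exp (- l * t) * \<bar>z 0\<bar>" by (simp only: mult_1)
    then show ?thesis by simp
  qed
  show ?thesis using one[of 1] one[of "-1"] by (simp add: abs_le_iff)
qed

section \<open>Classical solutions from their modes\<close>

text \<open>Uniform convergence is available on bounded time intervals only. Continuity, a local property,
  carries over to the whole strip.\<close>

lemma continuous_on_strip_closed:
  fixes f :: "real \<times> real \<Rightarrow> real"
  assumes "\<And>T. 0 < T \<Longrightarrow> continuous_on ({0..T::real} \<times> X) f"
  shows "continuous_on ({0::real..} \<times> X) f"
  unfolding continuous_on_eq_continuous_within
proof
  fix z :: "real \<times> real" assume z: "z \<in> {0..} \<times> X"
  then obtain t x where tx: "z = (t, x)" "0 \<le> t" "x \<in> X" by auto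
  have "continuous (at z within {0..t+1} \<times> X) f"
    using assms[of "t + 1"] tx by (auto simp: continuous_on_eq_continuous_within)
  moreover have "at z within {0..t+1} \<times> X = at z within {0..} \<times> X"
    by (rule at_within_nhd[of _ "{..<t+1} \<times> UNIV"]) (use tx in \<open>auto intro!: open_Times\<close>)
  ultimately show "continuous (at z within {0..} \<times> X) f" by simp
qed

lemma continuous_on_strip_open:
  fixes f :: "real \<times> real \<Rightarrow> real"
  assumes "\<And>a b. 0 < a \<Longrightarrow> a < b \<Longrightarrow> continuous_on ({a..b::real} \<times> X) f"
  shows "continuous_on ({0::real<..} \<times> X) f"
  unfolding continuous_on_eq_continuous_within
proof
  fix z :: "real \<times> real" assume z: "z \<in> {0<..} \<times> X"
  then obtain t x where tx: "z = (t, x)" "0 < t" "x \<in> X" by auto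
  have "continuous (at z within {t/2..t+1} \<times> X) f"
    using assms[of "t/2" "t + 1"] tx by (auto simp: continuous_on_eq_continuous_within)
  moreover have "at z within {t/2..t+1} \<times> X = at z within {0<..} \<times> X"
    by (rule at_within_nhd[of _ "{t/2<..<t+1} \<times> UNIV"]) (use tx in \<open>auto intro!: open_Times\<close>)
  ultimately show "continuous (at z within {0<..} \<times> X) f" by simp
qed

lemma (in onb) coeffs_zero_imp:
  assumes u: "u \<in> L2 r" and z: "\<And>n. n \<ge> 1 \<Longrightarrow> cf n u = 0"
  shows "nrm r u = 0"
proof -
  have "(\<lambda>k. 0) sums ip r u u" using Parseval[OF u u] by (simp add: z)
  then have "ip r u u = 0" using sums_unique2 sums_zero by blast
  then show ?thesis by (simp add: nrm_def)
qed

text \<open>Modes \<open>c\<^sub>n\<close> that solve the modal equations for given continuously differentiable inputs \<open>v\<^sub>i\<close> with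
  profiles \<open>g\<^sub>i\<close>. Their sum is shown to be a classical solution of the open-loop equation with these
  inputs.\<close>

locale modal = sturm_liouville r p q a1 a2 b1 b2 lam phi
  for r p q a1 a2 b1 b2 lam phi +
  fixes j :: nat and g :: "nat \<Rightarrow> real \<Rightarrow> real" and w0 :: "real \<Rightarrow> real"
    and v v' :: "nat \<Rightarrow> real \<Rightarrow> real" and c :: "nat \<Rightarrow> real \<Rightarrow> real"
  assumes standing: "\<exists>N'>0. lam (N' + 1) > 0 \<and>
          summable (\<lambda>k. inverse (lam (N' + 1 + k)) * (SUP x\<in>{0..1}. \<bar>phi (N' + 1 + k) x\<bar>))"
    and g_cont: "\<And>i. i \<in> {1..j} \<Longrightarrow> continuous_on {0..1} (g i)"
    and w0: "w0 \<in> D"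
    and v: "\<And>i t. i \<in> {1..j} \<Longrightarrow> (v i has_real_derivative v' i t) (at t)"
    and v': "\<And>i. i \<in> {1..j} \<Longrightarrow> continuous_on UNIV (v' i)"
    and c0: "\<And>n. n \<ge> 1 \<Longrightarrow> c n 0 = cf n w0"
    and c: "\<And>n t. n \<ge> 1 \<Longrightarrow> (c n has_real_derivative - lam n * c n t - (\<Sum>i=1..j. cf n (g i) * v i t)) (at t)"
begin

lemma g_L2: "i \<in> {1..j} \<Longrightarrow> g i \<in> L2 r" using g_cont L2_cont by blast

lemma v_cont: "i \<in> {1..j} \<Longrightarrow> continuous_on X (v i)"
  using v by (meson DERIV_continuous continuous_at_imp_continuous_on)

lemma c_cont: "n \<ge> 1 \<Longrightarrow> continuous_on X (c n)"
  using c by (meson DERIV_continuous continuous_at_imp_continuous_on)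

definition cdot :: "nat \<Rightarrow> real \<Rightarrow> real" where
  "cdot n t = - lam n * c n t - (\<Sum>i=1..j. cf n (g i) * v i t)"

lemma c_deriv: "n \<ge> 1 \<Longrightarrow> (c n has_real_derivative cdot n t) (at t)"
  using c by (simp add: cdot_def)

lemma cdot_deriv: 
  assumes "n \<ge> 1" 
  shows "(cdot n has_real_derivative - lam n * cdot n t - (\<Sum>i=1..j. cf n (g i) * v' i t)) (at t)"
  unfolding cdot_def[abs_def]
  by (rule derivative_eq_intros refl c_deriv[OF assms] v | assumption)+ (simp add: cdot_def mult.commute)

lemma cdot_cont: "n \<ge> 1 \<Longrightarrow> continuous_on X (cdot n)"
  using cdot_deriv by (meson DERIV_continuous continuous_at_imp_continuous_on)

definition msup :: "nat \<Rightarrow> real" where "msup n = (SUP x\<in>{0..1}. \<bar>phi n x\<bar>)"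

lemma msup: "n \<ge> 1 \<Longrightarrow> x \<in> {0..1} \<Longrightarrow> \<bar>phi n x\<bar> \<le> msup n"
  unfolding msup_def
proof (rule cSUP_upper)
  assume "n \<ge> 1"
  then have "continuous_on {0..1} (\<lambda>x. \<bar>phi n x\<bar>)" by (intro continuous_intros phi_cont)
  then show "bdd_above ((\<lambda>x. \<bar>phi n x\<bar>) ` {0..1})"
    by (intro bounded_imp_bdd_above compact_imp_bounded compact_continuous_image) auto
qed

lemma lam_pos_summable:
  obtains n0 where "\<And>k. n0 \<le> k \<Longrightarrow> 0 < lam (Suc k)"
    "summable (\<lambda>k. inverse (lam (Suc k)) * msup (Suc k))"
proof -
  obtain n0 where n0: "lam (n0 + 1) > 0" "summable (\<lambda>k. inverse (lam (n0 + 1 + k)) * msup (n0 + 1 + k))"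
    using standing unfolding msup_def by blast
  have "0 < lam (Suc k)" if "n0 \<le> k" for k
    using lam_mono[of "n0 + 1" "Suc k"] n0(1) that by simp
  moreover have "summable (\<lambda>k. inverse (lam (Suc k)) * msup (Suc k))"
    using n0(2) summable_iff_shift[of "\<lambda>k. inverse (lam (Suc k)) * msup (Suc k)" n0]
    by (simp add: add.commute)
  ultimately show thesis using that by blast
qed

lemma forcing_bound:
  fixes u :: "nat \<Rightarrow> real \<Rightarrow> real" and T :: real
  assumes u: "\<And>i. i \<in> {1..j} \<Longrightarrow> continuous_on UNIV (u i)"
  obtains H where "0 \<le> H" "\<And>n t. n \<ge> 1 \<Longrightarrow> 0 \<le> t \<Longrightarrow> t \<le> T \<Longrightarrow> \<bar>\<Sum>i=1..j. cf n (g i) * u i t\<bar> \<le> (H::real)"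
proof -
  have "\<exists>B. 0 \<le> B \<and> (\<forall>t\<in>{0..T}. \<bar>u i t\<bar> \<le> B)" if i: "i \<in> {1..j}" for i
    using continuous_interval_bound[OF continuous_on_subset[OF u[OF i] subset_UNIV], of 0 T]
    by (metis less_imp_le)
  then obtain B where B: "\<And>i. i \<in> {1..j} \<Longrightarrow> 0 \<le> B i" "\<And>i t. i \<in> {1..j} \<Longrightarrow> t \<in> {0..T} \<Longrightarrow> \<bar>u i t\<bar> \<le> B i"
    by metis
  show thesis
  proof (rule that[of "\<Sum>i=1..j. nrm r (g i) * B i"])
    show "0 \<le> (\<Sum>i=1..j. nrm r (g i) * B i)" by (intro sum_nonneg mult_nonneg_nonneg nrm_nonneg B)
    fix n :: nat and t assume n: "n \<ge> 1" and t: "0 \<le> t" "t \<le> T"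
    have "\<bar>\<Sum>i=1..j. cf n (g i) * u i t\<bar> \<le> (\<Sum>i=1..j. \<bar>cf n (g i) * u i t\<bar>)" by (rule sum_abs)
    also have "\<dots> \<le> (\<Sum>i=1..j. nrm r (g i) * B i)"
      unfolding abs_mult using t by (intro sum_mono mult_mono coeff_bound n g_L2 B nrm_nonneg) auto
    finally show "\<bar>\<Sum>i=1..j. cf n (g i) * u i t\<bar> \<le> (\<Sum>i=1..j. nrm r (g i) * B i)" .
  qed
qed

lemma Aw0_L2: "A w0 \<in> L2 r" using w0 by (auto simp: SL_dom_def intro: A_L2)

lemma c_bound:
  obtains C where "\<And>n t. n \<ge> 1 \<Longrightarrow> 0 < lam n \<Longrightarrow> 0 \<le> t \<Longrightarrow> t \<le> T \<Longrightarrow> \<bar>c n t\<bar> \<le> C * inverse (lam n)"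
proof -
  obtain H where H: "0 \<le> H" "\<And>n t. n \<ge> 1 \<Longrightarrow> 0 \<le> t \<Longrightarrow> t \<le> T \<Longrightarrow> \<bar>\<Sum>i=1..j. cf n (g i) * v i t\<bar> \<le> H"
    using forcing_bound[of v T, OF v_cont] by blast
  show thesis
  proof (rule that[of "nrm r (A w0) + H"])
    fix n :: nat and t assume n: "n \<ge> 1" and l: "0 < lam n" and t: "0 \<le> t" "t \<le> T"
    have "\<bar>c n t\<bar> \<le> exp (- lam n * t) * \<bar>c n 0\<bar> + H / lam n"
      by (rule damped_ode_bound[OF c[OF n] H(2)[OF n] l t])
    also have "exp (- lam n * t) * \<bar>c n 0\<bar> \<le> 1 * \<bar>c n 0\<bar>"
      using l t by (intro mult_right_mono) auto
    also have "\<bar>c n 0\<bar> \<le> nrm r (A w0) / lam n"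
    proof -
      have "lam n * c n 0 = cf n (A w0)" using A_coeff[OF w0 n] c0[OF n] by simp
      then have "lam n * \<bar>c n 0\<bar> = \<bar>cf n (A w0)\<bar>" using l by (metis abs_mult abs_of_pos)
      then show ?thesis using coeff_bound[OF n Aw0_L2] l by (simp add: field_simps)
    qed
    finally show "\<bar>c n t\<bar> \<le> (nrm r (A w0) + H) * inverse (lam n)"
      by (simp add: divide_inverse distrib_right)
  qed
qed

text \<open>For positive times the exponential damping turns the bounded quantity \<open>\<lambda>\<^sub>n c\<^sub>n(0)\<close> into one of
  order \<open>1/\<lambda>\<^sub>n\<close>, and the input contributes \<open>1/\<lambda>\<^sub>n\<close> because it is differentiable.\<close>

lemma cdot_bound:
  assumes a: "0 < a"
  obtains C where "\<And>n t. n \<ge> 1 \<Longrightarrow> 0 < lam n \<Longrightarrow> a \<le> t \<Longrightarrow> t \<le> T \<Longrightarrow> \<bar>cdot n t\<bar> \<le> C * inverse (lam n)"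
proof -
  obtain H where H: "0 \<le> H" "\<And>n t. n \<ge> 1 \<Longrightarrow> 0 \<le> t \<Longrightarrow> t \<le> \<bar>T\<bar> \<Longrightarrow> \<bar>\<Sum>i=1..j. cf n (g i) * v i t\<bar> \<le> H"
    using forcing_bound[of v "\<bar>T\<bar>", OF v_cont] by blast
  obtain H' where H': "0 \<le> H'" "\<And>n t. n \<ge> 1 \<Longrightarrow> 0 \<le> t \<Longrightarrow> t \<le> T \<Longrightarrow> \<bar>\<Sum>i=1..j. cf n (g i) * v' i t\<bar> \<le> H'"
    using forcing_bound[of v' T, OF v'] by blast
  define E0 where "E0 = nrm r (A w0) + H"
  have E0: "0 \<le> E0" using H nrm_nonneg by (simp add: E0_def)
  show thesis
  proof (rule that[of "E0 / a + H'"])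
    fix n :: nat and t assume n: "n \<ge> 1" and l: "0 < lam n" and t: "a \<le> t" "t \<le> T"
    have t0: "0 \<le> t" using a t by simp
    have "\<bar>cdot n t\<bar> \<le> exp (- lam n * t) * \<bar>cdot n 0\<bar> + H' / lam n"
      by (rule damped_ode_bound[OF cdot_deriv[OF n] H'(2)[OF n] l t0 t(2)])
    also have "exp (- lam n * t) * \<bar>cdot n 0\<bar> \<le> (1 / (lam n * a)) * E0"
    proof (rule mult_mono)
      have "lam n * a \<le> lam n * t" using l t by simp
      also have "\<dots> \<le> exp (lam n * t)" using exp_ge_add_one_self[of "lam n * t"] by linarith
      finally have "lam n * a \<le> exp (lam n * t)" .
      then have "inverse (exp (lam n * t)) \<le> inverse (lam n * a)" using l a by (intro le_imp_inverse_le) auto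
      then show "exp (- lam n * t) \<le> 1 / (lam n * a)" by (simp add: exp_minus divide_inverse)
      have "- lam n * c n 0 = - cf n (A w0)" using A_coeff[OF w0 n] c0[OF n] by simp
      then have "cdot n 0 = - cf n (A w0) - (\<Sum>i=1..j. cf n (g i) * v i 0)" by (simp add: cdot_def)
      moreover have "\<bar>\<Sum>i=1..j. cf n (g i) * v i 0\<bar> \<le> H" by (rule H(2)[OF n]) auto
      ultimately show "\<bar>cdot n 0\<bar> \<le> E0" using coeff_bound[OF n Aw0_L2] by (simp add: E0_def)
    qed (use l a in auto)
    finally show "\<bar>cdot n t\<bar> \<le> (E0 / a + H') * inverse (lam n)"
      by (simp add: divide_inverse distrib_left mult_ac)
  qed
qed

text \<open>The Weierstrass test with the standing assumption. Only finitely many modes have \<open>\<lambda>\<^sub>n \<le> 0\<close>, and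
  these do not influence uniform convergence.\<close>

lemma mode_series_uniform:
  assumes C: "\<And>n t. n \<ge> 1 \<Longrightarrow> 0 < lam n \<Longrightarrow> t \<in> I \<Longrightarrow> \<bar>z n t\<bar> \<le> C * inverse (lam n)"
  shows "uniform_limit (I \<times> {0..1}) (\<lambda>k (t, x). \<Sum>n=1..k. z n t * phi n x)
     (\<lambda>(t, x). \<Sum>k. z (Suc k) t * phi (Suc k) x) sequentially"
    and "t \<in> I \<Longrightarrow> x \<in> {0..1} \<Longrightarrow> summable (\<lambda>k. z (Suc k) t * phi (Suc k) x)"
proof -
  obtain n0 where n0: "\<And>k. n0 \<le> k \<Longrightarrow> 0 < lam (Suc k)"
    "summable (\<lambda>k. inverse (lam (Suc k)) * msup (Suc k))" using lam_pos_summable by blast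
  let ?M = "\<lambda>k. C * (inverse (lam (Suc k)) * msup (Suc k))"
  have M: "summable ?M" by (intro summable_mult n0)
  have b: "norm (z (Suc k) t * phi (Suc k) x) \<le> ?M k" if "n0 \<le> k" "t \<in> I" "x \<in> {0..1}" for k t x
  proof -
    have "norm (z (Suc k) t * phi (Suc k) x) = \<bar>z (Suc k) t\<bar> * \<bar>phi (Suc k) x\<bar>" by (simp add: abs_mult)
    also have "\<dots> \<le> (C * inverse (lam (Suc k))) * msup (Suc k)"
    proof (rule mult_mono)
      show *: "\<bar>z (Suc k) t\<bar> \<le> C * inverse (lam (Suc k))" by (rule C) (use n0 that in auto)
      show "0 \<le> C * inverse (lam (Suc k))" using * by linarith
    qed (use msup that in auto)
    finally show ?thesis by (simp add: mult.assoc)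
  qed
  have ev: "\<forall>\<^sub>F k in sequentially. \<forall>y\<in>I \<times> {0..1}.
      norm (case y of (t, x) \<Rightarrow> z (Suc k) t * phi (Suc k) x) \<le> ?M k"
    using eventually_ge_at_top[of n0] by eventually_elim (use b in auto)
  have "uniform_limit (I \<times> {0..1}) (\<lambda>k y. \<Sum>i<k. (case y of (t, x) \<Rightarrow> z (Suc i) t * phi (Suc i) x))
     (\<lambda>y. \<Sum>i. (case y of (t, x) \<Rightarrow> z (Suc i) t * phi (Suc i) x)) sequentially"
    by (rule Weierstrass_m_test_ev[OF ev M])
  moreover have "(\<lambda>k y. \<Sum>i<k. (case y of (t, x) \<Rightarrow> z (Suc i) t * phi (Suc i) x))
     = (\<lambda>k (t, x). \<Sum>n=1..k. z n t * phi n x)"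
    by (auto simp: fun_eq_iff sum.atLeast1_atMost_eq)
  moreover have "(\<lambda>y. \<Sum>i. (case y of (t, x) \<Rightarrow> z (Suc i) t * phi (Suc i) x))
     = (\<lambda>(t, x). \<Sum>k. z (Suc k) t * phi (Suc k) x)" by auto
  ultimately show "uniform_limit (I \<times> {0..1}) (\<lambda>k (t, x). \<Sum>n=1..k. z n t * phi n x)
     (\<lambda>(t, x). \<Sum>k. z (Suc k) t * phi (Suc k) x) sequentially" by simp
  show "summable (\<lambda>k. z (Suc k) t * phi (Suc k) x)" if "t \<in> I" "x \<in> {0..1}"
    by (rule summable_comparison_test'[OF M, of n0]) (use b that in auto)
qed

lemma partial_sum_continuous:
  assumes "\<And>n. n \<ge> 1 \<Longrightarrow> continuous_on I (z n)" "\<And>n. n \<ge> 1 \<Longrightarrow> continuous_on {0..1} (f n)"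
  shows "continuous_on (I \<times> {0..1::real}) (\<lambda>(t, x). \<Sum>n=1..k. z n t * (f n x::real))"
  unfolding case_prod_beta
  by (intro continuous_on_sum continuous_on_mult)
     (auto intro!: continuous_on_compose2[OF assms(1)] continuous_on_compose2[OF assms(2)] continuous_intros)

definition W :: "real \<Rightarrow> real \<Rightarrow> real" where "W t x = (\<Sum>k. c (Suc k) t * phi (Suc k) x)"
definition Wt :: "real \<Rightarrow> real \<Rightarrow> real" where "Wt t x = (\<Sum>k. cdot (Suc k) t * phi (Suc k) x)"
definition Wsum :: "nat \<Rightarrow> real \<Rightarrow> real \<Rightarrow> real" where "Wsum k t x = (\<Sum>n=1..k. c n t * phi n x)"

lemma W_uniform: 
  shows "uniform_limit ({0..T} \<times> {0..1}) (\<lambda>k (t, x). Wsum k t x) (\<lambda>(t, x). W t x) sequentially"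
    and "0 \<le> t \<Longrightarrow> t \<le> T \<Longrightarrow> x \<in> {0..1} \<Longrightarrow> summable (\<lambda>k. c (Suc k) t * phi (Suc k) x)"
proof -
  obtain C where C: "\<And>n t. n \<ge> 1 \<Longrightarrow> 0 < lam n \<Longrightarrow> 0 \<le> t \<Longrightarrow> t \<le> T \<Longrightarrow> \<bar>c n t\<bar> \<le> C * inverse (lam n)"
    using c_bound by blast
  show "uniform_limit ({0..T} \<times> {0..1}) (\<lambda>k (t, x). Wsum k t x) (\<lambda>(t, x). W t x) sequentially"
    unfolding Wsum_def W_def by (rule mode_series_uniform(1)) (use C in auto)
  show "summable (\<lambda>k. c (Suc k) t * phi (Suc k) x)" if "0 \<le> t" "t \<le> T" "x \<in> {0..1}"
    by (rule mode_series_uniform(2)[of "{0..T}" c C]) (use C that in auto)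
qed

lemma Wt_uniform:
  assumes "0 < a"
  shows "uniform_limit ({a..T} \<times> {0..1}) (\<lambda>k (t, x). \<Sum>n=1..k. cdot n t * phi n x) (\<lambda>(t, x). Wt t x) sequentially"
proof -
  obtain C where C: "\<And>n t. n \<ge> 1 \<Longrightarrow> 0 < lam n \<Longrightarrow> a \<le> t \<Longrightarrow> t \<le> T \<Longrightarrow> \<bar>cdot n t\<bar> \<le> C * inverse (lam n)"
    using cdot_bound[OF assms] by blast
  show ?thesis unfolding Wt_def by (rule mode_series_uniform(1)) (use C in auto)
qed

lemma W_C0: "W \<in> C0_strip"
proof -
  have "continuous_on ({0..T} \<times> {0..1}) (\<lambda>(t, x). W t x)" for T
    by (rule uniform_limit_theorem[OF _ W_uniform(1) sequentially_bot])
       (unfold Wsum_def, intro always_eventually allI partial_sum_continuous c_cont phi_cont)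
  then show ?thesis unfolding C0_strip_def using continuous_on_strip_closed by blast
qed

lemma Wt_continuous: "continuous_on ({0<..} \<times> {0..1}) (\<lambda>(t, x). Wt t x)"
proof (rule continuous_on_strip_open)
  fix a b :: real assume a: "0 < a"
  show "continuous_on ({a..b} \<times> {0..1}) (\<lambda>(t, x). Wt t x)"
    by (rule uniform_limit_theorem[OF _ Wt_uniform[OF a] sequentially_bot])
       (intro always_eventually allI partial_sum_continuous cdot_cont phi_cont)
qed

lemma W_time_deriv:
  assumes t: "0 < t" and x: "x \<in> {0..1}"
  shows "((\<lambda>s. W s x) has_real_derivative Wt t x) (at t)"
  unfolding W_def Wt_def
proof (rule has_field_derivative_series'(2)[where S = "{t/2..t+1}"])
  show "((\<lambda>s. c (Suc n) s * phi (Suc n) x) has_real_derivative cdot (Suc n) s * phi (Suc n) x) (at s within {t/2..t+1})"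
    for n s
    using c_deriv[of "Suc n" s] by (auto intro!: derivative_eq_intros intro: has_field_derivative_at_within)
  have "uniform_limit {t/2..t+1} (\<lambda>k s. (\<lambda>(t, x). \<Sum>n=1..k. cdot n t * phi n x) (s, x)) (\<lambda>s. (\<lambda>(t, x). Wt t x) (s, x)) sequentially"
    by (rule uniform_limit_compose'[OF Wt_uniform[of "t/2" "t+1"]]) (use t x in auto)
  then have "uniform_limit {t/2..t+1} (\<lambda>k s. \<Sum>i<k. cdot (Suc i) s * phi (Suc i) x) (\<lambda>s. Wt s x) sequentially"
    by (simp add: sum.atLeast1_atMost_eq)
  then show "uniformly_convergent_on {t/2..t+1} (\<lambda>k s. \<Sum>i<k. cdot (Suc i) s * phi (Suc i) x)"
    by (auto simp: uniformly_convergent_on_def)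
  show "summable (\<lambda>n. c (Suc n) t * phi (Suc n) x)" by (rule W_uniform(2)[of t t]) (use t x in auto)
qed (use t in auto)

lemma W_slice_uniform: "0 \<le> t \<Longrightarrow> uniform_limit {0..1} (\<lambda>k. Wsum k t) (W t) sequentially"
proof -
  assume t: "0 \<le> t"
  have "uniform_limit {0..1} (\<lambda>k x. (\<lambda>(t, x). Wsum k t x) (t, x)) (\<lambda>x. (\<lambda>(t, x). W t x) (t, x)) sequentially"
    by (rule uniform_limit_compose'[OF W_uniform(1)[of t]]) (use t in auto)
  then show ?thesis by simp
qed

lemma Wsum_C2: "Wsum k t \<in> C2_01" unfolding Wsum_def[abs_def] by (rule eigenfunction_sum(1))

lemma Wsum_cont: "continuous_on {0..1} (Wsum k t)"
  using Wsum_C2 C2_01D C1_01_continuous by blast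

lemma W_cont: "0 \<le> t \<Longrightarrow> continuous_on {0..1} (W t)"
  by (rule C0_strip_slice[OF W_C0])

text \<open>Uniform convergence allows the inner product with \<open>\<phi>\<^sub>n\<close> to be taken term by term.\<close>

lemma W_coeff:
  assumes t: "0 \<le> t" and n: "n \<ge> 1"
  shows "cf n (W t) = c n t"
proof -
  have WL: "W t \<in> L2 r" and SL: "Wsum k t \<in> L2 r" for k
    using W_cont[OF t] Wsum_cont L2_cont by auto
  have "(\<lambda>k. cf n (\<lambda>x. Wsum k t x - W t x)) \<longlonglongrightarrow> 0"
  proof (rule Lim_null_comparison)
    show "\<forall>\<^sub>F k in sequentially. norm (cf n (\<lambda>x. Wsum k t x - W t x)) \<le> nrm r (\<lambda>x. Wsum k t x - W t x)"
      using coeff_bound[OF n L2_diff[OF SL WL]] by simp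
    show "(\<lambda>k. nrm r (\<lambda>x. Wsum k t x - W t x)) \<longlonglongrightarrow> 0"
      by (rule nrm_uniform_limit[OF W_slice_uniform[OF t] Wsum_cont W_cont[OF t]])
  qed
  moreover have "\<forall>\<^sub>F k in sequentially. cf n (\<lambda>x. Wsum k t x - W t x) = c n t - cf n (W t)"
    using eventually_ge_at_top[of n]
  proof eventually_elim
    case (elim k)
    have "cf n (Wsum k t) = c n t" unfolding Wsum_def[abs_def] using coeff_sum[OF n] elim by simp
    then show ?case using ip_diff[OF phi_L2[OF n] SL WL] by simp
  qed
  ultimately have "(\<lambda>k::nat. c n t - cf n (W t)) \<longlonglongrightarrow> 0" by (rule Lim_transform_eventually)
  then show ?thesis by (simp add: LIMSEQ_const_iff)
qed

text \<open>Both sides have the same coefficients, hence agree in \<open>L\<^sub>r\<^sup>2\<close>, and both are continuous.\<close>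

lemma W_initial: "x \<in> {0..1} \<Longrightarrow> W 0 x = w0 x"
proof -
  assume x: "x \<in> {0..1}"
  have WL: "W 0 \<in> L2 r" using W_cont L2_cont by auto
  have "nrm r (\<lambda>x. W 0 x - w0 x) = 0"
  proof (rule coeffs_zero_imp)
    show "(\<lambda>x. W 0 x - w0 x) \<in> L2 r" by (intro L2_diff WL D_D(3) w0)
    show "cf n (\<lambda>x. W 0 x - w0 x) = 0" if "n \<ge> 1" for n
      using ip_diff[OF phi_L2[OF that] WL D_D(3)[OF w0]] W_coeff[OF _ that, of 0] c0[OF that] by simp
  qed
  then have "W 0 x - w0 x = 0"
    by (rule nrm_zero_imp[OF continuous_on_diff[OF W_cont[OF order_refl] D_D(2)[OF w0]] _ x])
  then show ?thesis by simp
qed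

text \<open>The function that the differential equation prescribes for \<open>A W\<close>; that it is \<open>A W\<close> is shown in
  \<open>W_A\<close>.\<close>

definition AW :: "real \<Rightarrow> real \<Rightarrow> real" where "AW t x = - Wt t x - (\<Sum>i=1..j. v i t * g i x)"

lemma Wt_slice: "0 < t \<Longrightarrow> continuous_on {0..1} (Wt t)"
  by (rule continuous_on_strip_slice[OF Wt_continuous]) auto

lemma AW_cont: "0 < t \<Longrightarrow> continuous_on {0..1} (AW t)"
  unfolding AW_def[abs_def] by (intro continuous_intros Wt_slice g_cont) auto

text \<open>The input profiles need not lie in the domain, so their expansions converge in \<open>L\<^sub>r\<^sup>2\<close> only;
  that is enough because they enter with coefficients depending on time alone.\<close>

lemma A_Wsum_limit:
  assumes a: "0 < a" and ep: "0 < \<epsilon>"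
  shows "\<forall>\<^sub>F k in sequentially. \<forall>t\<in>{a..b}. nrm r (\<lambda>x. A (Wsum k t) x - AW t x) \<le> \<epsilon>"
proof -
  define N1 where "N1 = nrm r (\<lambda>_. 1)"
  have N1: "0 \<le> N1" by (simp add: N1_def nrm_nonneg)
  define d where "d = \<epsilon> / (2 * (N1 + 1))"
  have d: "0 < d" "d * N1 \<le> \<epsilon> / 2" using ep N1 by (auto simp: d_def field_simps)
  have "\<exists>B>0. \<forall>t\<in>{a..b}. \<bar>v i t\<bar> \<le> B" if i: "i \<in> {1..j}" for i
    using continuous_interval_bound[OF v_cont[OF i], of a b] by metis
  then obtain B where B: "\<And>i. i \<in> {1..j} \<Longrightarrow> 0 < B i" "\<And>i t. i \<in> {1..j} \<Longrightarrow> t \<in> {a..b} \<Longrightarrow> \<bar>v i t\<bar> \<le> B i"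
    by metis
  define Q where "Q i k x = g i x - (\<Sum>n=1..k. cf n (g i) * phi n x)" for i k x
  have QL: "Q i k \<in> L2 r" if "i \<in> {1..j}" for i k
    unfolding Q_def[abs_def] by (intro L2_intros g_L2 that phi_L2) auto
  have "(\<lambda>k. \<Sum>i=1..j. B i * nrm r (Q i k)) \<longlonglongrightarrow> (\<Sum>i=1..j. B i * 0)"
    unfolding Q_def[abs_def] by (intro tendsto_intros expansion g_L2)
  then have "\<forall>\<^sub>F k in sequentially. (\<Sum>i=1..j. B i * nrm r (Q i k)) < \<epsilon> / 2"
    using ep by (intro order_tendstoD(2)[of _ 0]) auto
  moreover note uniform_limitD[OF Wt_uniform[OF a, of b] d(1)]
  ultimately show ?thesis
  proof eventually_elim
    case (elim k)
    show ?case
    proof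
      fix t assume t: "t \<in> {a..b}"
      then have t0: "0 < t" using a by simp
      define P where "P x = Wt t x - (\<Sum>n=1..k. cdot n t * phi n x)" for x
      have Pc: "continuous_on {0..1} P"
        unfolding P_def[abs_def] by (intro continuous_intros Wt_slice[OF t0] phi_cont) auto
      have eq: "A (Wsum k t) x - AW t x = P x + (\<Sum>i=1..j. v i t * Q i k x)" if x: "x \<in> {0..1}" for x
      proof -
        have "A (Wsum k t) x = (\<Sum>n=1..k. lam n * c n t * phi n x)"
          unfolding Wsum_def[abs_def] by (rule eigenfunction_sum(2)[OF x])
        also have "\<dots> = (\<Sum>n=1..k. - (cdot n t * phi n x) - (\<Sum>i=1..j. v i t * (cf n (g i) * phi n x)))"
          by (intro sum.cong refl) (simp add: cdot_def algebra_simps sum_distrib_left)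
        also have "\<dots> = - (\<Sum>n=1..k. cdot n t * phi n x) - (\<Sum>n=1..k. \<Sum>i=1..j. v i t * (cf n (g i) * phi n x))"
          by (simp add: sum_subtractf sum_negf)
        also have "(\<Sum>n=1..k. \<Sum>i=1..j. v i t * (cf n (g i) * phi n x))
           = (\<Sum>i=1..j. v i t * (\<Sum>n=1..k. cf n (g i) * phi n x))"
          unfolding sum_distrib_left by (rule sum.swap)
        finally show ?thesis
          by (simp add: AW_def P_def Q_def right_diff_distrib sum_subtractf)
      qed
      have "nrm r (\<lambda>x. A (Wsum k t) x - AW t x) = nrm r (\<lambda>x. P x + (\<Sum>i=1..j. v i t * Q i k x))"
        by (rule nrm_cong) (rule eq)
      also have "\<dots> \<le> nrm r P + nrm r (\<lambda>x. \<Sum>i=1..j. v i t * Q i k x)"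
        by (intro nrm_triangle L2_cont Pc L2_sum QL) auto
      also have "nrm r P \<le> d * N1" unfolding N1_def
      proof (rule nrm_le_sup[OF L2_cont[OF Pc]])
        fix x :: real assume x: "x \<in> {0..1}"
        have "dist (\<Sum>n=1..k. cdot n t * phi n x) (Wt t x) < d" using elim(2) t x by force
        then show "\<bar>P x\<bar> \<le> d" unfolding P_def dist_real_def by linarith
      qed (use d in auto)
      also have "nrm r (\<lambda>x. \<Sum>i=1..j. v i t * Q i k x) \<le> (\<Sum>i=1..j. \<bar>v i t\<bar> * nrm r (Q i k))"
        by (intro nrm_triangle_sum QL) auto
      also have "\<dots> \<le> (\<Sum>i=1..j. B i * nrm r (Q i k))"
        by (intro sum_mono mult_right_mono B t nrm_nonneg)
      finally show "nrm r (\<lambda>x. A (Wsum k t) x - AW t x) \<le> \<epsilon>" using elim(1) d(2) by linarith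
    qed
  qed
qed

lemma
  assumes t: "0 < t"
  shows W_C2: "W t \<in> C2_01" and W_A: "\<And>x. x \<in> {0..1} \<Longrightarrow> A (W t) x = AW t x"
    and W_dlim: "\<And>x. x \<in> {0..1} \<Longrightarrow> (\<lambda>k. deriv01 (Wsum k t) x) \<longlonglongrightarrow> deriv01 (W t) x"
proof -
  have lim: "(\<lambda>k. nrm r (\<lambda>x. A (Wsum k t) x - AW t x)) \<longlonglongrightarrow> 0"
  proof (rule tendstoI)
    fix ep :: real assume "0 < ep"
    then have "\<forall>\<^sub>F k in sequentially. \<forall>s\<in>{t..t}. nrm r (\<lambda>x. A (Wsum k s) x - AW s x) \<le> ep / 2"
      by (intro A_Wsum_limit t) auto
    then show "\<forall>\<^sub>F k in sequentially. dist (nrm r (\<lambda>x. A (Wsum k t) x - AW t x)) 0 < ep"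
      by eventually_elim (use \<open>0 < ep\<close> nrm_nonneg in \<open>simp add: abs_of_nonneg\<close>)
  qed
  note cl = A_closed[OF Wsum_C2 W_slice_uniform[OF less_imp_le[OF t]] AW_cont[OF t] lim]
  show "W t \<in> C2_01" by (rule cl(1))
  show "\<And>x. x \<in> {0..1} \<Longrightarrow> A (W t) x = AW t x" by (rule cl(2))
  show "\<And>x. x \<in> {0..1} \<Longrightarrow> (\<lambda>k. deriv01 (Wsum k t) x) \<longlonglongrightarrow> deriv01 (W t) x" by (rule cl(3))
qed

lemma W_D:
  assumes t: "0 < t" shows "W t \<in> D"
proof -
  have wl: "(\<lambda>k. Wsum k t x) \<longlonglongrightarrow> W t x" if "x \<in> {0..1}" for x
    using tendsto_uniform_limitI[OF W_slice_uniform that] t by simp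
  have dS: "deriv01 (Wsum k t) x = (\<Sum>n=1..k. c n t * deriv01 (phi n) x)" if "x \<in> {0..1}" for k x
    unfolding Wsum_def[abs_def] by (rule eigenfunction_sum(3)[OF that])
  have bc0: "b1 * phi n 0 + b2 * deriv01 (phi n) 0 = 0" and bc1: "a1 * phi n 1 + a2 * deriv01 (phi n) 1 = 0"
    if "n \<ge> 1" for n using phi_D[OF that] by (auto simp: SL_dom_def)
  have comb: "\<alpha> * Wsum k t x + \<beta> * deriv01 (Wsum k t) x = (\<Sum>n=1..k. c n t * (\<alpha> * phi n x + \<beta> * deriv01 (phi n) x))"
    if "x \<in> {0..1}" for \<alpha> \<beta> k x
    unfolding dS[OF that] Wsum_def by (simp add: sum_distrib_left sum.distrib distrib_left mult_ac)
  have lim: "(\<lambda>k. \<alpha> * Wsum k t x + \<beta> * deriv01 (Wsum k t) x) \<longlonglongrightarrow> \<alpha> * W t x + \<beta> * deriv01 (W t) x"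
    if "x \<in> {0..1}" for \<alpha> \<beta> x
    by (intro tendsto_intros wl W_dlim t that)
  have "b1 * Wsum k t 0 + b2 * deriv01 (Wsum k t) 0 = 0" for k
    by (subst comb) (auto intro!: sum.neutral simp: bc0)
  then have 0: "b1 * W t 0 + b2 * deriv01 (W t) 0 = 0"
    using lim[of 0 b1 b2] by (simp add: LIMSEQ_const_iff)
  have "a1 * Wsum k t 1 + a2 * deriv01 (Wsum k t) 1 = 0" for k
    by (subst comb) (auto intro!: sum.neutral simp: bc1)
  then have 1: "a1 * W t 1 + a2 * deriv01 (W t) 1 = 0"
    using lim[of 1 a1 a2] by (simp add: LIMSEQ_const_iff)
  show ?thesis using 0 1 C2_01_H2[OF W_C2[OF t]] by (simp add: SL_dom_def)
qed

text \<open>The a priori bound, applied to the difference of \<open>W\<close> and its partial sums, makes the space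
  derivatives converge uniformly in both variables.\<close>

lemma W_x_continuous: "continuous_on ({0<..} \<times> {0..1}) (\<lambda>(t, x). deriv01 (W t) x)"
proof (rule continuous_on_strip_open)
  fix a b :: real assume a: "0 < a" "a < b"
  obtain C where C: "0 < C" "\<And>f e x. f \<in> C2_01 \<Longrightarrow> (\<And>x. x \<in> {0..1} \<Longrightarrow> \<bar>f x\<bar> \<le> e) \<Longrightarrow> x \<in> {0..1} \<Longrightarrow>
    \<bar>deriv01 f x\<bar> \<le> C * (e + nrm r (A f))" using deriv_bound by metis
  have ul: "uniform_limit ({a..b} \<times> {0..1}) (\<lambda>k (t, x). deriv01 (Wsum k t) x) (\<lambda>(t, x). deriv01 (W t) x) sequentially"
  proof (rule uniform_limitI)
    fix ep :: real assume ep: "0 < ep"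
    define d where "d = ep / (4 * C)"
    have d: "0 < d" using ep C by (simp add: d_def)
    show "\<forall>\<^sub>F k in sequentially. \<forall>z\<in>{a..b} \<times> {0..1}.
        dist (case z of (t, x) \<Rightarrow> deriv01 (Wsum k t) x) (case z of (t, x) \<Rightarrow> deriv01 (W t) x) < ep"
      using uniform_limitD[OF W_uniform(1)[of b] d] A_Wsum_limit[OF a(1) d, of b]
    proof eventually_elim
      case (elim k)
      show ?case
      proof
        fix z assume "z \<in> {a..b} \<times> {0..1::real}"
        then obtain t x where z: "z = (t, x)" and t: "t \<in> {a..b}" and x: "x \<in> {0..1}" by auto
        have t0: "0 < t" using t a by simp
        let ?h = "\<lambda>x. 1 * Wsum k t x + (-1) * W t x"
        have h: "?h \<in> C2_01" by (rule C2_01_lincomb[OF Wsum_C2 W_C2[OF t0]])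
        have "\<bar>?h y\<bar> \<le> d" if "y \<in> {0..1}" for y
        proof -
          have "dist (Wsum k t y) (W t y) < d" using elim(1) t a that by force
          then show ?thesis by (simp add: dist_real_def)
        qed
        then have "\<bar>deriv01 ?h x\<bar> \<le> C * (d + nrm r (A ?h))" by (intro C(2)[OF h _ x])
        also have "nrm r (A ?h) = nrm r (\<lambda>x. A (Wsum k t) x - AW t x)"
          by (rule nrm_cong, subst A_lincomb[OF Wsum_C2 W_C2[OF t0]]) (simp_all add: W_A[OF t0])
        also have "C * (d + nrm r (\<lambda>x. A (Wsum k t) x - AW t x)) \<le> C * (d + d)"
          using elim(2) t C by (intro mult_left_mono) auto
        also have "\<dots> < ep" using C ep by (simp add: d_def)
        finally show "dist (case z of (t, x) \<Rightarrow> deriv01 (Wsum k t) x) (case z of (t, x) \<Rightarrow> deriv01 (W t) x) < ep"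
          using C1_01_lincomb(2)[OF C2_01D(1)[OF Wsum_C2] C2_01D(1)[OF W_C2[OF t0]] x, of 1 k t "-1"]
          by (simp add: z dist_real_def)
      qed
    qed
  qed
  have "continuous_on ({a..b} \<times> {0..1}) (\<lambda>(t, x). deriv01 (Wsum k t) x)" for k
  proof -
    have "continuous_on ({a..b} \<times> {0..1}) (\<lambda>(t, x). \<Sum>n=1..k. c n t * deriv01 (phi n) x)"
      by (intro partial_sum_continuous c_cont C1_01_deriv_continuous C2_01D phi_C2)
    moreover have "(\<Sum>n=1..k. c n t * deriv01 (phi n) x) = deriv01 (Wsum k t) x" if "x \<in> {0..1}" for t x
      unfolding Wsum_def[abs_def] by (rule eigenfunction_sum(3)[OF that, symmetric])
    ultimately show ?thesis
      by (subst continuous_on_cong[OF refl, of _ _ "\<lambda>(t, x). \<Sum>n=1..k. c n t * deriv01 (phi n) x"]) auto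
  qed
  then show "continuous_on ({a..b} \<times> {0..1}) (\<lambda>(t, x). deriv01 (W t) x)"
    by (intro uniform_limit_theorem[OF always_eventually[OF allI] ul sequentially_bot])
qed

lemma W_C1: "W \<in> C1_strip"
proof -
  have td: "vector_derivative (\<lambda>s. W s x) (at t) = Wt t x" if "0 < t" "x \<in> {0..1}" for t x
    using W_time_deriv[OF that] by (intro vector_derivative_at) (simp add: has_real_derivative_iff_has_vector_derivative)
  have "continuous_on ({0<..} \<times> {0..1}) (\<lambda>(t, x). vector_derivative (\<lambda>s. W s x) (at t))"
    using Wt_continuous
    by (subst continuous_on_cong[OF refl, of _ _ "\<lambda>(t, x). Wt t x"]) (auto simp: td)
  moreover have "(\<lambda>s. W s x) differentiable (at t)" "W t differentiable (at x within {0..1})"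
    if "0 < t" "x \<in> {0..1}" for t x
    using W_time_deriv[OF that] C1_01_deriv[OF C2_01D(1)[OF W_C2[OF that(1)]] that(2)]
      real_differentiable_def by blast+
  ultimately show ?thesis using W_x_continuous by (simp add: C1_strip_def)
qed

lemma W_pde:
  assumes "0 < t" "x \<in> {0..1}"
  shows "vector_derivative (\<lambda>s. W s x) (at t) = - A (W t) x - (\<Sum>i=1..j. g i x * v i t)"
proof -
  have "vector_derivative (\<lambda>s. W s x) (at t) = Wt t x"
    using W_time_deriv[OF assms] by (intro vector_derivative_at) (simp add: has_real_derivative_iff_has_vector_derivative)
  then show ?thesis using W_A[OF assms] by (simp add: AW_def mult.commute)
qed

end

section \<open>The closed loop\<close>

lemma at_within_halfline_nontrivial: "0 \<le> t \<Longrightarrow> at t within {0::real..} \<noteq> bot"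
proof -
  assume "0 \<le> t"
  then have "at t within {t<..} \<le> at t within {0..}" by (intro at_le) auto
  then show ?thesis using trivial_limit_at_right_real[of t] by (metis bot.extremum_unique)
qed

lemma C1_halfline_iff:
  "g \<in> C1_halfline \<longleftrightarrow> (\<exists>g'. continuous_on {0..} g' \<and> (\<forall>t\<ge>0. (g has_real_derivative g' t) (at t within {0..})))"
proof
  assume g: "g \<in> C1_halfline"
  then have "(g has_real_derivative vector_derivative g (at t within {0..})) (at t within {0..})" if "0 \<le> t" for t
    using that vector_derivative_works[of g "at t within {0..}"]
    by (simp add: C1_halfline_def differentiable_on_def has_real_derivative_iff_has_vector_derivative)
  then show "\<exists>g'. continuous_on {0..} g' \<and> (\<forall>t\<ge>0. (g has_real_derivative g' t) (at t within {0..}))"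
    using g by (auto simp: C1_halfline_def)
next
  assume "\<exists>g'. continuous_on {0..} g' \<and> (\<forall>t\<ge>0. (g has_real_derivative g' t) (at t within {0..}))"
  then obtain g' where g': "continuous_on {0..} g'" "\<And>t. t \<ge> 0 \<Longrightarrow> (g has_real_derivative g' t) (at t within {0..})"
    by blast
  have "vector_derivative g (at t within {0..}) = g' t" if "t \<in> {0..}" for t
    using g'(2)[of t] that
    by (intro vector_derivative_within at_within_halfline_nontrivial)
       (auto simp: has_real_derivative_iff_has_vector_derivative)
  then have "continuous_on {0..} (\<lambda>t. vector_derivative g (at t within {0..}))"
    by (intro continuous_on_eq[OF g'(1)]) simp
  moreover have "g differentiable_on {0..}"
    unfolding differentiable_on_def using g'(2) real_differentiable_def by (metis atLeast_iff)
  ultimately show "g \<in> C1_halfline" by (simp add: C1_halfline_def)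
qed

lemma C1_halfline_diff:
  assumes "g \<in> C1_halfline" "h \<in> C1_halfline" shows "(\<lambda>t. g t - h t) \<in> C1_halfline"
proof -
  obtain g' h' where "continuous_on {0..} g'" "\<And>t. t \<ge> 0 \<Longrightarrow> (g has_real_derivative g' t) (at t within {0..})"
    "continuous_on {0..} h'" "\<And>t. t \<ge> 0 \<Longrightarrow> (h has_real_derivative h' t) (at t within {0..})"
    using assms unfolding C1_halfline_iff by blast
  then show ?thesis unfolding C1_halfline_iff
    by (intro exI[of _ "\<lambda>t. g' t - h' t"]) (auto intro!: continuous_intros derivative_eq_intros)
qed

lemma time_deriv_diff:
  assumes "w \<in> C1_strip" "z \<in> C1_strip" "0 < t" "x \<in> {0..1}"
  shows "time_deriv (\<lambda>t x. w t x - z t x) t x = time_deriv w t x - time_deriv z t x"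
proof -
  have "((\<lambda>s. w s x - z s x) has_real_derivative time_deriv w t x - time_deriv z t x) (at t)"
    using C1_strip_time(1)[OF assms(1,3,4)] C1_strip_time(1)[OF assms(2,3,4)]
    by (auto intro!: derivative_eq_intros)
  then show ?thesis unfolding time_deriv_def[of "\<lambda>t x. w t x - z t x"]
    by (intro vector_derivative_at) (simp add: has_real_derivative_iff_has_vector_derivative)
qed

lemma C1_strip_diff:
  assumes w: "w \<in> C1_strip" and z: "z \<in> C1_strip"
    and wC: "\<And>t. 0 < t \<Longrightarrow> w t \<in> C1_01" and zC: "\<And>t. 0 < t \<Longrightarrow> z t \<in> C1_01"
  shows "(\<lambda>t x. w t x - z t x) \<in> C1_strip"
proof -
  have d: "deriv01 (\<lambda>x. w t x - z t x) x = deriv01 (w t) x - deriv01 (z t) x"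
    and C: "(\<lambda>x. w t x - z t x) \<in> C1_01" if "0 < t" "x \<in> {0..1}" for t x
    using C1_01_lincomb(2)[OF wC[OF that(1)] zC[OF that(1)] that(2), of 1 "-1"]
      C1_01_lincomb(1)[OF wC[OF that(1)] zC[OF that(1)], of 1 "-1"] by simp_all
  have "continuous_on ({0<..} \<times> {0..1}) (\<lambda>y. (case y of (t, x) \<Rightarrow> time_deriv w t x) - (case y of (t, x) \<Rightarrow> time_deriv z t x))"
    by (intro continuous_on_diff C1_strip_time(2) w z)
  then have 1: "continuous_on ({0<..} \<times> {0..1}) (\<lambda>(t, x). time_deriv (\<lambda>t x. w t x - z t x) t x)"
    by (rule continuous_on_eq) (auto simp: time_deriv_diff[OF w z])
  have "continuous_on ({0<..} \<times> {0..1}) (\<lambda>y. (case y of (t, x) \<Rightarrow> deriv01 (w t) x) - (case y of (t, x) \<Rightarrow> deriv01 (z t) x))"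
    using w z by (intro continuous_on_diff) (auto simp: C1_strip_def)
  then have 2: "continuous_on ({0<..} \<times> {0..1}) (\<lambda>(t, x). deriv01 (\<lambda>x. w t x - z t x) x)"
    by (rule continuous_on_eq) (auto simp: d)
  have 3: "(\<lambda>s. w s x - z s x) differentiable (at t)" if "0 < t" "x \<in> {0..1}" for t x
    using w z that by (intro derivative_intros) (auto simp: C1_strip_def)
  have 4: "(\<lambda>x. w t x - z t x) differentiable (at x within {0..1})" if "0 < t" "x \<in> {0..1}" for t x
    using w z that by (intro derivative_intros) (auto simp: C1_strip_def)
  show ?thesis using 1 2 3 4 by (simp add: C1_strip_def time_deriv_def)
qed

context lyapunov_setting
begin

text \<open>The coefficients of the functions \<open>k\<^sub>i\<close> in the eigenbasis.\<close>

definition kcoeff :: "(nat \<Rightarrow> real) \<Rightarrow> nat \<Rightarrow> nat \<Rightarrow> real" where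
  "kcoeff L i n = (if n \<le> N then K i n + L i * (\<Sum>m=1..N. R n m * cf m (vphi i))
     else \<gamma> * L i * cf n (vphi i))"

lemma feedback_modes:
  assumes w: "w \<in> L2 r" and i: "i \<in> {1..j}" and NM: "N \<le> M"
  shows "fb L M w y i = (\<Sum>n=1..M. kcoeff L i n * cf n w) - \<omega> i * L i * y i"
proof -
  have "{1..M} = {1..N} \<union> {N+1..M}" using NM by auto
  then have "(\<Sum>n=1..M. kcoeff L i n * cf n w)
     = (\<Sum>n=1..N. kcoeff L i n * cf n w) + (\<Sum>n=N+1..M. kcoeff L i n * cf n w)"
    by (simp add: sum.union_disjoint)
  also have "(\<Sum>n=1..N. kcoeff L i n * cf n w)
     = (\<Sum>n=1..N. K i n * cf n w + L i * (\<Sum>m=1..N. R n m * cf n w * cf m (vphi i)))"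
    by (intro sum.cong refl) (simp add: kcoeff_def distrib_right distrib_left sum_distrib_left sum_distrib_right mult_ac)
  also have "\<dots> = (\<Sum>n=1..N. K i n * cf n w) + L i * (\<Sum>n=1..N. \<Sum>m=1..N. R n m * cf n w * cf m (vphi i))"
    unfolding sum.distrib sum_distrib_left[of "L i"] ..
  also have "(\<Sum>n=N+1..M. kcoeff L i n * cf n w) = L i * (\<gamma> * (\<Sum>n=N+1..M. cf n (vphi i) * cf n w))"
    unfolding sum_distrib_left by (intro sum.cong refl) (simp add: kcoeff_def mult_ac)
  finally show ?thesis unfolding feedback_eq[OF w i] gain_def by (simp add: algebra_simps)
qed

lemma feedback_diff:
  assumes "w \<in> L2 r" "z \<in> L2 r" "i \<in> {1..j}" "N \<le> M"
  shows "fb L M (\<lambda>x. w x - z x) (\<lambda>i. y i - u i) i = fb L M w y i - fb L M z u i"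
proof -
  have "(\<Sum>n=1..M. kcoeff L i n * cf n (\<lambda>x. w x - z x))
     = (\<Sum>n=1..M. kcoeff L i n * cf n w - kcoeff L i n * cf n z)"
    by (intro sum.cong refl) (use assms in \<open>simp add: ip_diff phi_L2 right_diff_distrib\<close>)
  then show ?thesis
    using assms by (simp add: feedback_modes L2_diff sum_subtractf algebra_simps)
qed

text \<open>All ingredients of the closed loop are linear. The difference is again twice continuously
  differentiable, which puts it into the domain once the boundary conditions are checked.\<close>

lemma closed_loop_diff:
  assumes w: "closed_loop L M w0 y0 w y" and z: "closed_loop L M w0 y0 z u" and NM: "N \<le> M"
  shows "closed_loop L M (\<lambda>_. 0) (\<lambda>_. 0) (\<lambda>t x. w t x - z t x) (\<lambda>t i. y t i - u t i)"
proof -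
  have sw: "is_solution p r q a1 a2 b1 b2 vphi j \<mu> (\<lambda>t. fb L M (w t) (y t)) w y"
    and sz: "is_solution p r q a1 a2 b1 b2 vphi j \<mu> (\<lambda>t. fb L M (z t) (u t)) z u"
    using w z by (auto simp: is_closed_loop_solution_def)
  note W = solution_D[OF sw] and Z = solution_D[OF sz]
  have wL: "w t \<in> L2 r" "z t \<in> L2 r" if "0 < t" for t using W(4) Z(4) D_D(3) that by blast+
  have C0: "(\<lambda>t x. w t x - z t x) \<in> C0_strip"
    using W(1) Z(1) unfolding C0_strip_def case_prod_beta by (auto intro!: continuous_on_diff)
  have C1: "(\<lambda>t x. w t x - z t x) \<in> C1_strip"
    by (rule C1_strip_diff[OF W(2) Z(2)]) (use W(5) Z(5) C2_01D in blast)+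
  have C2: "(\<lambda>x. w t x - z t x) \<in> C2_01" if "0 < t" for t
    using C2_01_lincomb[OF W(5) Z(5), of t t 1 "-1"] that by simp
  have dd: "deriv01 (\<lambda>x. w t x - z t x) x = deriv01 (w t) x - deriv01 (z t) x" if "0 < t" "x \<in> {0..1}" for t x
    using C1_01_lincomb(2)[OF C2_01D(1)[OF W(5)] C2_01D(1)[OF Z(5)], of t t x 1 "-1"] that by simp
  have bc: "b1 * (w t 0 - z t 0) + b2 * deriv01 (\<lambda>x. w t x - z t x) 0 = 0"
      "a1 * (w t 1 - z t 1) + a2 * deriv01 (\<lambda>x. w t x - z t x) 1 = 0" if t: "0 < t" for t
    using W(4)[OF t] Z(4)[OF t] dd[OF t, of 0] dd[OF t, of 1] by (simp_all add: SL_dom_def right_diff_distrib)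
  have dom: "(\<lambda>x. w t x - z t x) \<in> D" if t: "0 < t" for t
    using bc[OF t] C2_01_H2[OF C2[OF t]] by (simp add: SL_dom_def)
  have pde: "vector_derivative (\<lambda>s. w s x - z s x) (at t)
      = - A (\<lambda>x. w t x - z t x) x
        - (\<Sum>i=1..j. vphi i x * fb L M (\<lambda>x. w t x - z t x) (\<lambda>i. y t i - u t i) i)"
    if t: "0 < t" and x: "x \<in> {0<..<1}" for t x
  proof -
    have x': "x \<in> {0..1}" using x by auto
    have "(\<Sum>i=1..j. vphi i x * fb L M (\<lambda>x. w t x - z t x) (\<lambda>i. y t i - u t i) i)
       = (\<Sum>i=1..j. fb L M (w t) (y t) i * vphi i x - fb L M (z t) (u t) i * vphi i x)"
      by (intro sum.cong refl) (simp add: feedback_diff[OF wL(1)[OF t] wL(2)[OF t] _ NM] algebra_simps)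
    moreover have "A (\<lambda>x. w t x - z t x) x = A (w t) x - A (z t) x"
      using A_lincomb[OF W(5)[OF t] Z(5)[OF t] x', of 1 "-1"] by simp
    moreover have "vector_derivative (\<lambda>s. w s x - z s x) (at t) = time_deriv w t x - time_deriv z t x"
      using time_deriv_diff[OF W(2) Z(2) t x'] by (simp add: time_deriv_def)
    ultimately show ?thesis unfolding W(6)[OF t x] Z(6)[OF t x] by (simp add: sum_subtractf)
  qed
  have ode: "vector_derivative (\<lambda>s. y s i - u s i) (at t)
      = - \<mu> i * (y t i - u t i) + fb L M (\<lambda>x. w t x - z t x) (\<lambda>i. y t i - u t i) i"
    if t: "0 < t" and i: "i \<in> {1..j}" for t i
  proof -
    have "((\<lambda>s. y s i - u s i) has_real_derivative
       (- \<mu> i * y t i + fb L M (w t) (y t) i) - (- \<mu> i * u t i + fb L M (z t) (u t) i)) (at t)"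
      by (intro derivative_intros W(7) Z(7) t i)
    then show ?thesis unfolding feedback_diff[OF wL(1)[OF t] wL(2)[OF t] i NM]
      by (intro vector_derivative_at)
         (simp add: has_real_derivative_iff_has_vector_derivative algebra_simps)
  qed
  have init: "w 0 x - z 0 x = 0" "y 0 i - u 0 i = 0" if "x \<in> {0..1}" "i \<in> {1..j}" for x i
    using w z that by (auto simp: is_closed_loop_solution_def)
  have "w 0 x - z 0 x = 0" if "x \<in> {0..1}" for x using init(1)[OF that, of 1] j1 by simp
  moreover have "y 0 i - u 0 i = 0" if "i \<in> {1..j}" for i using init(2)[of 0 i] that by simp
  moreover have "is_solution p r q a1 a2 b1 b2 vphi j \<mu>
      (\<lambda>t. fb L M (\<lambda>x. w t x - z t x) (\<lambda>i. y t i - u t i)) (\<lambda>t x. w t x - z t x) (\<lambda>t i. y t i - u t i)"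
    unfolding is_solution_def
    using C0 C1 C1_halfline_diff[OF W(3) Z(3)] C2 dom pde ode bc by blast
  ultimately show ?thesis by (simp add: is_closed_loop_solution_def)
qed

text \<open>The unknowns \<open>c\<^sub>1, \<dots>, c\<^sub>M\<close> and \<open>y\<close>, which determine the feedback, form the closed subsystem of
  \<open>linear_ode_exists\<close>, and all other modes are driven by it. The inputs obtained in this way are
  smooth, so the modes add up to a classical solution by the results on \<open>modal\<close>.\<close>

lemma closed_loop_exists:
  assumes standing: "\<exists>N'>0. lam (N' + 1) > 0 \<and>
          summable (\<lambda>k. inverse (lam (N' + 1 + k)) * (SUP x\<in>{0..1}. \<bar>phi (N' + 1 + k) x\<bar>))"
    and w0: "w0 \<in> D" and NM: "N \<le> M"
  obtains w y where "closed_loop L M w0 y0 w y"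
proof -
  define S :: "(nat + nat) set" where "S = {1..M} <+> {1..j}"
  \<comment> \<open>the inputs as linear forms in the modes (left summand) and the components of \<open>y\<close> (right summand)\<close>
  define vc :: "nat \<Rightarrow> nat + nat \<Rightarrow> real" where
    "vc i = case_sum (kcoeff L i) (\<lambda>k. if k = i then - \<omega> i * L i else 0)" for i
  define Dg :: "nat + nat \<Rightarrow> real" where "Dg = case_sum (\<lambda>n. - lam n) (\<lambda>i. - \<mu> i)"
  define Am :: "nat + nat \<Rightarrow> nat + nat \<Rightarrow> real" where
    "Am s m = (case s of Inl n \<Rightarrow> - (\<Sum>i=1..j. cf n (vphi i) * vc i m) | Inr i \<Rightarrow> vc i m)" for s m
  have finS: "finite S" by (simp add: S_def)
  obtain X where X0: "\<And>s. X s 0 = case_sum (\<lambda>n. cf n w0) y0 s"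
    and X: "\<And>s t. (X s has_real_derivative Dg s * X s t + (\<Sum>m\<in>S. Am s m * X m t)) (at t)"
    using linear_ode_exists[OF finS] by blast
  define v where "v i t = (\<Sum>m\<in>S. vc i m * X m t)" for i t
  define v' where "v' i t = (\<Sum>m\<in>S. vc i m * (Dg m * X m t + (\<Sum>m'\<in>S. Am m m' * X m' t)))" for i t
  define c where "c n t = X (Inl n) t" for n t
  define y where "y t i = X (Inr i) t" for t i
  have Xc: "continuous_on U (X s)" for U s
    using X by (meson DERIV_continuous continuous_at_imp_continuous_on)
  have v_eq: "v i t = (\<Sum>n=1..M. kcoeff L i n * c n t) - \<omega> i * L i * y t i" if "i \<in> {1..j}" for i t
  proof -
    have "v i t = (\<Sum>n=1..M. kcoeff L i n * c n t) + (\<Sum>k=1..j. (if k = i then - \<omega> i * L i else 0) * y t k)"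
      unfolding v_def S_def by (simp add: sum.Plus vc_def c_def y_def)
    also have "(\<Sum>k=1..j. (if k = i then - \<omega> i * L i else 0) * y t k) = (\<Sum>k=1..j. if k = i then - \<omega> i * L i * y t i else 0)"
      by (intro sum.cong) auto
    finally show ?thesis using that by simp
  qed
  have yd: "((\<lambda>t. y t i) has_real_derivative - \<mu> i * y t i + v i t) (at t)" for i t
    using X[of "Inr i" t] by (simp add: y_def v_def Dg_def Am_def)
  have vd: "(v i has_real_derivative v' i t) (at t)" for i t
    unfolding v_def[abs_def] v'_def by (auto intro!: derivative_eq_intros X sum.cong)
  have v'c: "continuous_on UNIV (v' i)" for i
    unfolding v'_def[abs_def] by (intro continuous_intros Xc)
  have cd: "(c n has_real_derivative - lam n * c n t - (\<Sum>i=1..j. cf n (vphi i) * v i t)) (at t)" for n t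
  proof -
    have "(\<Sum>m\<in>S. (\<Sum>i=1..j. cf n (vphi i) * vc i m) * X m t) = (\<Sum>m\<in>S. \<Sum>i=1..j. cf n (vphi i) * (vc i m * X m t))"
      by (simp add: sum_distrib_right mult.assoc)
    also have "\<dots> = (\<Sum>i=1..j. cf n (vphi i) * v i t)"
      unfolding v_def sum_distrib_left by (rule sum.swap)
    finally show ?thesis
      using X[of "Inl n" t] by (simp add: c_def[abs_def] Dg_def Am_def sum_negf)
  qed
  interpret md: modal r p q a1 a2 b1 b2 lam phi j vphi w0 v v' c
    by unfold_locales
       (use standing w0 vphi_cont vd v'c cd X0 in \<open>simp_all add: c_def\<close>)
  have WL: "md.W t \<in> L2 r" if "0 \<le> t" for t using md.W_cont[OF that] L2_cont by blast
  have fb_eq: "fb L M (md.W t) (y t) i = v i t" if t: "0 < t" and i: "i \<in> {1..j}" for t i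
    using feedback_modes[OF WL i NM, of t L "y t"] md.W_coeff[of t] v_eq[OF i, of t] t by simp
  have "closed_loop L M w0 y0 md.W y"
    unfolding is_closed_loop_solution_def is_solution_def
  proof (intro conjI ballI allI impI)
    show "md.W \<in> C0_strip" by (rule md.W_C0)
    show "md.W \<in> C1_strip" by (rule md.W_C1)
    show "(\<lambda>t. y t i) \<in> C1_halfline" for i
      unfolding C1_halfline_iff
      by (intro exI[of _ "\<lambda>t. - \<mu> i * y t i + v i t"] conjI allI impI has_field_derivative_at_within[OF yd])
         (auto simp: v_def y_def intro!: continuous_intros Xc)
    show "md.W 0 x = w0 x" if "x \<in> {0..1}" for x by (rule md.W_initial[OF that])
    show "y 0 i = y0 i" for i by (simp add: y_def X0)
    fix t :: real assume t: "0 < t"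
    show "md.W t \<in> D \<inter> C2_01" using md.W_D[OF t] md.W_C2[OF t] by simp
    then show "b1 * md.W t 0 + b2 * deriv01 (md.W t) 0 = 0" "a1 * md.W t 1 + a2 * deriv01 (md.W t) 1 = 0"
      by (auto simp: SL_dom_def)
    show "vector_derivative (\<lambda>s. md.W s x) (at t)
        = - A (md.W t) x - (\<Sum>i=1..j. vphi i x * fb L M (md.W t) (y t) i)" if "x \<in> {0<..<1}" for x
      using md.W_pde[OF t, of x] that fb_eq[OF t] by simp
    show "vector_derivative (\<lambda>s. y s i) (at t) = - \<mu> i * y t i + fb L M (md.W t) (y t) i" if "i \<in> {1..j}" for i
      unfolding fb_eq[OF t that] using yd[of i t]
      by (intro vector_derivative_at) (simp add: has_real_derivative_iff_has_vector_derivative)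
  qed
  then show thesis by (rule that)
qed

text \<open>The decay estimate for the difference of two solutions, whose initial data vanish.\<close>

lemma closed_loop_unique:
  assumes L: "\<And>i. i \<in> {1..j} \<Longrightarrow> L i \<ge> 0" and NM: "N + 1 \<le> M"
    and gap: "4 * (lam (M + 1) - lam (N + 1)) \<ge> \<gamma> * (\<Sum>i=1..j. L i * (\<Sum>k. (cf (M + 1 + k) (vphi i))\<^sup>2))"
    and w: "closed_loop L M w0 y0 w y" and z: "closed_loop L M w0 y0 z u" and t: "0 \<le> t"
  shows "\<And>x. x \<in> {0..1} \<Longrightarrow> z t x = w t x" and "\<And>i. i \<in> {1..j} \<Longrightarrow> u t i = y t i"
proof -
  obtain Kbar sbar where est: "\<And>w0 y0 w y t. closed_loop L M w0 y0 w y \<Longrightarrow> 0 \<le> t \<Longrightarrow>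
       nrm r (w t) + L2_set (y t) {1..j} \<le> Kbar * exp (- sbar * t) * (nrm r w0 + L2_set y0 {1..j})"
    using closed_loop_decay[OF L NM gap] by metis
  have d: "closed_loop L M (\<lambda>_. 0) (\<lambda>_. 0) (\<lambda>t x. w t x - z t x) (\<lambda>t i. y t i - u t i)"
    by (rule closed_loop_diff[OF w z]) (use NM in simp)
  have "nrm r (\<lambda>x. w t x - z t x) + L2_set (\<lambda>i. y t i - u t i) {1..j} \<le> 0"
    using est[OF d t] by (simp add: nrm_def ip_zero L2_set_def)
  then have n: "nrm r (\<lambda>x. w t x - z t x) = 0" and l: "L2_set (\<lambda>i. y t i - u t i) {1..j} = 0"
    using nrm_nonneg[of "\<lambda>x. w t x - z t x"] L2_set_nonneg[of "\<lambda>i. y t i - u t i" "{1..j}"] by linarith+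
  have "(\<lambda>t x. w t x - z t x) \<in> C0_strip" using d by (simp add: is_closed_loop_solution_def is_solution_def)
  then have c: "continuous_on {0..1} (\<lambda>x. w t x - z t x)" using C0_strip_slice t by blast
  show "z t x = w t x" if "x \<in> {0..1}" for x using nrm_zero_imp[OF c n that] by simp
  show "u t i = y t i" if "i \<in> {1..j}" for i using l that by (simp add: L2_set_eq_0_iff)
qed

end

theorem theorem2p2:
  fixes p r q :: "real \<Rightarrow> real" and a1 a2 b1 b2 :: real
    and lam :: "nat \<Rightarrow> real" and phi :: "nat \<Rightarrow> real \<Rightarrow> real"
    and N j :: nat and \<mu> :: "nat \<Rightarrow> real" and vphi :: "nat \<Rightarrow> real \<Rightarrow> real"
    and K R :: "nat \<Rightarrow> nat \<Rightarrow> real" and \<sigma> \<gamma> :: real and \<omega> :: "nat \<Rightarrow> real"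
  assumes p: "p \<in> C1_01" "\<forall>x\<in>{0..1}. p x > 0"
    and r: "continuous_on {0..1} r" "\<forall>x\<in>{0..1}. r x > 0"
    and q: "continuous_on {0..1} q"
    and bc: "a1\<^sup>2 + a2\<^sup>2 = 1" "b1\<^sup>2 + b2\<^sup>2 = 1"
    and eigen: "SL_eigensystem p r q a1 a2 b1 b2 lam phi"
    and standing: "\<exists>N'>0. lam (N' + 1) > 0 \<and>
          summable (\<lambda>k. inverse (lam (N' + 1 + k)) * (SUP x\<in>{0..1}. \<bar>phi (N' + 1 + k) x\<bar>))"
    and N: "N \<ge> 1" "lam (N + 1) > 0"
    and j: "j \<ge> 1"
    and \<mu>: "\<forall>i\<in>{1..j}. \<mu> i > 0" "\<forall>i\<in>{1..j}. \<forall>n\<ge>1. \<mu> i \<noteq> lam n"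
    and vphi: "\<forall>i\<in>{1..j}. vphi i \<in> C2_01 \<and>
          (\<forall>x\<in>{0..1}. deriv01 (\<lambda>s. p s * deriv01 (vphi i) s) x - q x * vphi i x
                        = - \<mu> i * r x * vphi i x) \<and>
          b1 * vphi i 0 + b2 * deriv01 (vphi i) 0 = 0 \<and>
          a1 * vphi i 1 + a2 * deriv01 (vphi i) 1 = 1"
    and \<sigma>: "\<sigma> > 0"
    and R: "sym_pos_def N R"
    and LMI: "let S = closed_loop_mat r lam phi vphi j K in
          loewner_le N (\<lambda>n m. mmul N R S n m + mmul N (mtransp S) R n m)
                       (\<lambda>n m. - 2 * \<sigma> * (if n = m then 1 else 0))"
    and \<omega>: "\<forall>i\<in>{1..j}. \<omega> i > 0" and \<gamma>: "\<gamma> > 0"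
    and small1: "\<forall>i\<in>{1..j}. \<sigma> * \<mu> i \<ge> 2 * real j * \<omega> i * (L2_set (K i) {1..N})\<^sup>2"
    and small2: "\<sigma> * lam (N + 1)
          \<ge> 2 * real j * \<gamma> * (\<Sum>i=1..j. (nrm r (vphi i))\<^sup>2 * (L2_set (K i) {1..N})\<^sup>2)"
  shows
    \<comment> \<open>\<open>Vdot\<close> is the derivative of \<open>Vfun\<close> along solutions with an arbitrary input \<open>v\<close>\<close>
    "(\<forall>v w y. is_solution p r q a1 a2 b1 b2 vphi j \<mu> v w y \<longrightarrow>
        (\<forall>t>0. ((\<lambda>s. Vfun r phi N R \<gamma> j \<omega> (w s) (y s)) has_real_derivative
                 Vdot p r q phi vphi N R \<gamma> j \<omega> \<mu> (w t) (y t) (v t)) (at t)))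
     \<and>
     (\<forall>(L :: nat \<Rightarrow> real) (M :: nat).
        (\<forall>i\<in>{1..j}. L i \<ge> 0) \<and> M \<ge> N + 1 \<and>
        4 * (lam (M + 1) - lam (N + 1))
          \<ge> \<gamma> * (\<Sum>i=1..j. L i * (\<Sum>k. (ip r (phi (M + 1 + k)) (vphi i))\<^sup>2)) \<longrightarrow>
        (\<forall>w\<in>SL_dom a1 a2 b1 b2. \<forall>y :: nat \<Rightarrow> real.
           Vdot p r q phi vphi N R \<gamma> j \<omega> \<mu> w y (feedback r phi vphi N R K \<gamma> \<omega> L M w y)
             \<le> - (1/2) * (\<Sum>i=1..j. \<omega> i * \<mu> i * (y i)\<^sup>2)
               - min (\<gamma> * lam (N + 1)) \<sigma> / 2 * (nrm r w)\<^sup>2)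
        \<and>
        (\<exists>Kbar>0. \<exists>sbar>0. \<forall>w0\<in>SL_dom a1 a2 b1 b2. \<forall>y0 :: nat \<Rightarrow> real. \<exists>w y.
           is_closed_loop_solution p r q a1 a2 b1 b2 phi vphi N R K \<gamma> j \<omega> \<mu> L M w0 y0 w y \<and>
           (\<forall>w' y'.
              is_closed_loop_solution p r q a1 a2 b1 b2 phi vphi N R K \<gamma> j \<omega> \<mu> L M w0 y0 w' y' \<longrightarrow>
              (\<forall>t\<ge>0. (\<forall>x\<in>{0..1}. w' t x = w t x) \<and> (\<forall>i\<in>{1..j}. y' t i = y t i))) \<and>
           (\<forall>t\<ge>0. nrm r (w t) + L2_set (y t) {1..j}
               \<le> Kbar * exp (- sbar * t) * (nrm r w0 + L2_set y0 {1..j}))))"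
proof -
  interpret lyapunov_setting r p q a1 a2 b1 b2 lam phi N j \<mu> vphi K R \<sigma> \<gamma> \<omega>
    by unfold_locales (use assms in \<open>auto simp: Let_def\<close>)
  show ?thesis
  proof (intro conjI allI impI)
    show "((\<lambda>s. V (w s) (y s)) has_real_derivative VD (w t) (y t) (v t)) (at t)"
      if "is_solution p r q a1 a2 b1 b2 vphi j \<mu> v w y" "0 < t" for v w y t
      by (rule V_deriv[OF that])
  next
    fix L :: "nat \<Rightarrow> real" and M :: nat
    assume LM: "(\<forall>i\<in>{1..j}. L i \<ge> 0) \<and> M \<ge> N + 1 \<and>
        4 * (lam (M + 1) - lam (N + 1))
          \<ge> \<gamma> * (\<Sum>i=1..j. L i * (\<Sum>k. (ip r (phi (M + 1 + k)) (vphi i))\<^sup>2))"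
    then have L: "\<And>i. i \<in> {1..j} \<Longrightarrow> L i \<ge> 0" and NM: "N + 1 \<le> M"
      and gap: "4 * (lam (M + 1) - lam (N + 1)) \<ge> \<gamma> * (\<Sum>i=1..j. L i * (\<Sum>k. (cf (M + 1 + k) (vphi i))\<^sup>2))"
      by blast+
    show "\<forall>w\<in>D. \<forall>y. VD w y (fb L M w y) \<le> - (1/2) * (\<Sum>i=1..j. \<omega> i * \<mu> i * (y i)\<^sup>2)
               - min (\<gamma> * lam (N + 1)) \<sigma> / 2 * (nrm r w)\<^sup>2"
      by (intro ballI allI Vdot_le[OF L NM gap])
    obtain Kbar sbar where pos: "0 < Kbar" "0 < sbar" and est: "\<And>w0 y0 w y t. closed_loop L M w0 y0 w y \<Longrightarrow> 0 \<le> t \<Longrightarrow>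
       nrm r (w t) + L2_set (y t) {1..j} \<le> Kbar * exp (- sbar * t) * (nrm r w0 + L2_set y0 {1..j})"
      using closed_loop_decay[OF L NM gap] by metis
    have "\<exists>w y. closed_loop L M w0 y0 w y \<and>
           (\<forall>w' y'. closed_loop L M w0 y0 w' y' \<longrightarrow>
              (\<forall>t\<ge>0. (\<forall>x\<in>{0..1}. w' t x = w t x) \<and> (\<forall>i\<in>{1..j}. y' t i = y t i))) \<and>
           (\<forall>t\<ge>0. nrm r (w t) + L2_set (y t) {1..j} \<le> Kbar * exp (- sbar * t) * (nrm r w0 + L2_set y0 {1..j}))"
      if w0: "w0 \<in> D" for w0 y0
    proof -
      have "N \<le> M" using NM by simp
      then obtain w y where wy: "closed_loop L M w0 y0 w y"
        using closed_loop_exists[OF standing w0] by metis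
      show ?thesis
        by (intro exI[of _ w] exI[of _ y] conjI allI impI ballI wy est[OF wy]
            closed_loop_unique[OF L NM gap wy])
    qed
    then show "\<exists>Kbar>0. \<exists>sbar>0. \<forall>w0\<in>D. \<forall>y0. \<exists>w y. closed_loop L M w0 y0 w y \<and>
           (\<forall>w' y'. closed_loop L M w0 y0 w' y' \<longrightarrow>
              (\<forall>t\<ge>0. (\<forall>x\<in>{0..1}. w' t x = w t x) \<and> (\<forall>i\<in>{1..j}. y' t i = y t i))) \<and>
           (\<forall>t\<ge>0. nrm r (w t) + L2_set (y t) {1..j} \<le> Kbar * exp (- sbar * t) * (nrm r w0 + L2_set y0 {1..j}))"
      using pos by blast
  qed
qed

end
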